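(* Let $\varepsilon>0$ be fixed. For $x$ large, let $a_1<a_2<\cdots$ be the $x^{\varepsilon}$-smooth numbers in increasing order. Then $$\sum_{a_n\le x}(a_{n+1}-a_n)^{3/2}\ll_{\varepsilon} x^{1+\varepsilon}.$$
   Context: For a positive real number $y$, a positive integer $n$ is called $y$-smooth if all prime factors $p\mid n$ satisfy $p\le y$ (so $1$ is $y$-smooth). The sequence $(a_n)$ is the infinite sequence of all $x^{\varepsilon}$-smooth positive integers, and depends on $x$ and $\varepsilon$. The notation $A\ll_{\varepsilon}B$ means that there are constants $C(\varepsilon)>0$ and $x_0(\varepsilon)$, depending only on $\varepsilon$, such that $|A|\le C(\varepsilon)B$ for all real $x\ge x_0(\varepsilon)$. *)

theory Defs
  imports Complex_Main "HOL-Library.Infinite_Set" "HOL-Computational_Algebra.Primes"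
begin

definition smooth :: "real \<Rightarrow> nat \<Rightarrow> bool" where
  "smooth y n \<longleftrightarrow> n > 0 \<and> (\<forall>p. prime p \<longrightarrow> p dvd n \<longrightarrow> real p \<le> y)"

text \<open>
  The increasing enumeration of the smooth numbers, indexed from 0. It is meaningful only when
  there are infinitely many of them, i.e. for \<open>y \<ge> 2\<close> (see \<open>infinite_smooth\<close>).
\<close>

definition smooth_seq :: "real \<Rightarrow> nat \<Rightarrow> nat" where
  "smooth_seq y = enumerate {n. smooth y n}"

lemma infinite_smooth:
  assumes "y \<ge> 2"
  shows "infinite {n. smooth y n}"
proof -
  have "smooth y (2 ^ k)" for k
    unfolding smooth_def
  proof (intro conjI allI impI)
    fix p :: nat assume "prime p" "p dvd 2 ^ k"
    then have "p dvd 2" by (rule prime_dvd_power)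
    then have "p \<le> 2" by (simp add: dvd_imp_le)
    then show "real p \<le> y" using assms by linarith
  qed simp
  then have "range (\<lambda>k. 2 ^ k) \<subseteq> {n. smooth y n}" by auto
  moreover have "infinite (range (\<lambda>k. 2 ^ k :: nat))"
    by (rule range_inj_infinite) (simp add: inj_on_def)
  ultimately show ?thesis using infinite_super by blast
qed

lemma strict_mono_smooth_seq: "y \<ge> 2 \<Longrightarrow> strict_mono (smooth_seq y)"
  unfolding smooth_seq_def by (rule strict_mono_enumerate[OF infinite_smooth])

lemma range_smooth_seq: "y \<ge> 2 \<Longrightarrow> range (smooth_seq y) = {n. smooth y n}"
  unfolding smooth_seq_def by (rule range_enumerate[OF infinite_smooth])

end

theory Submission
  imports Defs "HOL-Real_Asymp.Real_Asymp" "HOL-Analysis.Convex"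
begin

text \<open>
  Fix a large \<open>k\<close> and let \<open>N\<close> grow. All products of \<open>k\<close> integers from the block
  \<open>{N..N + N div k}\<close> are smooth for the bound \<open>2 * N\<close> and lie between \<open>X = N ^ k\<close> and \<open>3 * X\<close>. The theorem
  follows once the number of gaps of length at least \<open>H\<close> near \<open>X\<close> is bounded by \<open>X / H powr (3 / 2)\<close> up to a
  bounded power of \<open>N\<close> (lemma \<open>card_level_gaps\<close>), because bounded powers of \<open>N\<close> are
  \<open>X powr (O (1 / k))\<close>, and \<open>k\<close> may be chosen in terms of \<open>\<epsilon>\<close>.

  Let \<open>exp u\<close> be the middle of an interval of length \<open>H\<close> without products. Count the products \<open>m\<close>
  with the weight of a Fejer kernel at \<open>u - ln m\<close>. For a kernel of degree \<open>J\<close> slightly larger than \<open>X / H\<close> the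
  weighted number is small, whereas for a kernel of bounded degree it is of order \<open>X\<close>. The difference is a
  trigonometric sum in \<open>u\<close> with coefficients bounded by \<open>\<bar>P t\<bar> ^ k\<close>, where \<open>P t\<close> is the sum of \<open>n\<close> to the power
  \<open>\<i> * t\<close> over the block and \<open>t\<close> runs through the integers up to \<open>J\<close>. Hence this trigonometric sum
  has order \<open>X\<close> at every such \<open>u\<close>. Integers \<open>t\<close> suffice since all logarithms involved lie in an
  interval shorter than \<open>pi\<close>; in this way the argument uses only finite sums.

  The frequencies \<open>\<bar>t\<bar> < N\<close> contribute little by the Kusmin--Landau inequality. For the others write
  \<open>\<bar>P t\<bar> = N powr (1 - \<sigma>)\<close>. Weyl differencing gives \<open>\<sigma> \<ge> c\<close> for some \<open>c > 0\<close> depending only on \<open>k\<close>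
  (lemma \<open>osc_sum_weyl\<close>). For \<open>\<sigma> \<le> 1 / 4\<close> the Halasz--Montgomery method, applied to a suitable power of
  \<open>P\<close>, shows that such values occur for at most about \<open>J powr (\<sigma> / (1 - 2 * \<sigma>))\<close> of the \<open>t\<close> (lemma
  \<open>card_large_values\<close>). If \<open>J\<close> is below about \<open>X powr (1 - 2 * \<sigma>)\<close> they are so rare that their total
  contribution is \<open>o(X)\<close> for every \<open>u\<close> (lemma \<open>sum_peaks\<close>). For the remaining \<open>t\<close> the same
  bound yields a mean square of at most about \<open>X powr (3 / 2) * J powr (1 / 2)\<close>, and for \<open>\<sigma> \<ge> 1 / 4\<close> the mean value
  estimate for Dirichlet polynomials yields this as well (lemma \<open>sum_off_peaks\<close>).

  If there are \<open>R\<close> such points \<open>u\<close>, they are separated by about \<open>H / X\<close>. The mean value estimate used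
  in its dual form then gives that \<open>R * X ^ 2\<close> is at most about \<open>J * (X powr (3 / 2) * J powr (1 / 2))\<close>, so \<open>R\<close> is at most
  about \<open>J powr (3 / 2) / X powr (1 / 2)\<close>, which is \<open>X / H powr (3 / 2)\<close> (lemma \<open>card_isolated_points\<close>).
\<close>

section \<open>Exponential sums with controlled differences\<close>

text \<open>
  By concavity: a point below the chord would force the derivative, which is decreasing, to be first
  smaller and then larger than the slope of the chord.
\<close>
lemma sin_ge_two_over_pi:
  fixes x :: real
  assumes "0 \<le> x" "x \<le> pi / 2"
  shows "2 / pi * x \<le> sin x"
proof -
  define g where "g = (\<lambda>x::real. sin x - 2 / pi * x)"
  have "g x \<ge> 0"
  proof (rule ccontr)
    assume neg: "\<not> g x \<ge> 0"
    have g0: "g 0 = 0" and g1: "g (pi/2) = 0" by (auto simp: g_def)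
    have der: "(g has_real_derivative (cos y - 2 / pi)) (at y)" for y
      unfolding g_def by (auto intro!: derivative_eq_intros)
    have x: "0 < x" "x < pi/2" using neg g0 g1 assms by (metis less_le order_refl)+
    obtain y where y: "0 < y" "y < x" "g x - g 0 = (x - 0) * (cos y - 2/pi)"
      using MVT2[of 0 x g "\<lambda>y. cos y - 2/pi"] der x by auto
    obtain z where z: "x < z" "z < pi/2" "g (pi/2) - g x = (pi/2 - x) * (cos z - 2/pi)"
      using MVT2[of x "pi/2" g "\<lambda>y. cos y - 2/pi"] der x by auto
    have "cos y - 2/pi < 0" using y x neg g0
      by (smt (verit) mult_nonneg_nonneg)
    moreover have "cos z - 2/pi > 0" using z x neg g1
      by (smt (verit) mult_nonneg_nonpos)
    moreover have "cos z \<le> cos y" using y z x by (intro cos_monotone_0_pi_le) auto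
    ultimately show False by linarith
  qed
  then show ?thesis by (simp add: g_def)
qed

lemma sin_ge_near_ends:
  fixes h \<theta> :: real
  assumes "0 < \<theta>" "\<theta> / 2 \<le> h" "h \<le> pi - \<theta> / 2"
  shows "\<theta> / pi \<le> sin h"
proof (cases "h \<le> pi / 2")
  case True
  have "\<theta> / pi \<le> 2 / pi * h" using assms by (simp add: field_simps)
  also have "\<dots> \<le> sin h" using assms True by (intro sin_ge_two_over_pi) auto
  finally show ?thesis .
next
  case False
  have "\<theta> / pi \<le> 2 / pi * (pi - h)" using assms by (simp add: field_simps)
  also have "\<dots> \<le> sin (pi - h)" using assms False by (intro sin_ge_two_over_pi) auto
  finally show ?thesis by simp
qed

text \<open>
  The real part does not depend on \<open>h\<close>. This makes the total variation of the weights in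
  \<open>kusmin_landau\<close> that of a cotangent.
\<close>
lemma inverse_cis_double_minus_one:
  assumes "sin h \<noteq> 0"
  shows "1 / (cis (2 * h) - 1) = Complex (- 1 / 2) (- cot h / 2)"
proof -
  have "cis (2 * h) - 1 = Complex (- 2 * (sin h)\<^sup>2) (2 * sin h * cos h)"
    by (simp add: complex_eq_iff cos_double_sin sin_double)
  moreover have "Complex (- 2 * (sin h)\<^sup>2) (2 * sin h * cos h) * Complex (- 1 / 2) (- cot h / 2) = 1"
    using assms sin_cos_squared_add[of h]
    by (simp add: complex_eq_iff cot_def field_simps power2_eq_square)
  ultimately show ?thesis
    by (metis div_by_1 mult_zero_left nonzero_divide_eq_eq mult.commute zero_neq_one)
qed

lemma cot_antimono:
  fixes x y :: real
  assumes "0 < x" "x \<le> y" "y < pi"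
  shows "cot y \<le> cot x"
proof -
  have s: "sin x > 0" "sin y > 0" using assms by (auto intro!: sin_gt_zero)
  have "sin (y - x) \<ge> 0" using assms by (intro sin_ge_zero) auto
  then have "cot x - cot y \<ge> 0"
    using s by (simp add: cot_def sin_diff field_simps)
  then show ?thesis by simp
qed

text \<open>
  The Kusmin--Landau argument: \<open>cis (f n) = w n * (cis (f (n + 1)) - cis (f n))\<close> with
  \<open>w n = 1 / (cis (f (n + 1) - f n) - 1)\<close>, whose real part is constant and whose imaginary part
  is a cotangent of a monotone sequence. Summation by parts therefore costs only the boundary values
  of \<open>w\<close>, which are of size \<open>1 / \<theta>\<close>.
\<close>
lemma kusmin_landau:
  fixes f :: "nat \<Rightarrow> real" and z :: int
  assumes \<theta>: "\<theta> > 0"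
    and lo: "\<And>n. a \<le> n \<Longrightarrow> n < b \<Longrightarrow> \<theta> \<le> f (Suc n) - f n - 2 * pi * z"
    and hi: "\<And>n. a \<le> n \<Longrightarrow> n < b \<Longrightarrow> f (Suc n) - f n - 2 * pi * z \<le> 2 * pi - \<theta>"
    and mono: "\<And>n. a \<le> n \<Longrightarrow> Suc n < b \<Longrightarrow> f (Suc n) - f n \<le> f (Suc (Suc n)) - f (Suc n)"
  shows "norm (\<Sum>n\<in>{a..<b}. cis (f n)) \<le> 8 / \<theta>"
proof (cases "a < b")
  case False
  then show ?thesis using \<theta> by simp
next
  case True
  define h where "h = (\<lambda>n. (f (Suc n) - f n - 2 * pi * z) / 2)"
  define w where "w = (\<lambda>n. Complex (- 1 / 2) (- cot (h n) / 2))"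
  have hb: "\<theta> / 2 \<le> h n" "h n \<le> pi - \<theta> / 2" if "a \<le> n" "n < b" for n
    using lo[OF that] hi[OF that] by (auto simp: h_def)
  have sb: "\<theta> / pi \<le> sin (h n)" if "a \<le> n" "n < b" for n
    using hb[OF that] \<theta> by (intro sin_ge_near_ends)
  have spos: "0 < sin (h n)" if "a \<le> n" "n < b" for n
    using sb[OF that] \<theta> by (smt (verit) divide_pos_pos pi_gt_zero)
  have step: "cis (f n) = w n * (cis (f (Suc n)) - cis (f n))" if "a \<le> n" "n < b" for n
  proof -
    have w: "w n = 1 / (cis (2 * h n) - 1)"
      using inverse_cis_double_minus_one[of "h n"] spos[OF that] by (simp add: w_def)
    have ne: "cis (2 * h n) - 1 \<noteq> 0"
    proof
      assume "cis (2 * h n) - 1 = 0"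
      then have "Re (cis (2 * h n)) = 1" by simp
      then have "1 - 2 * (sin (h n))\<^sup>2 = 1" by (simp add: cos_double_sin)
      then show False using spos[OF that] by simp
    qed
    have "cis (2 * h n) = cis (f (Suc n)) / cis (f n)"
    proof -
      have "2 * h n = f (Suc n) - f n + 2 * pi * of_int (- z)" by (simp add: h_def)
      then have "cis (2 * h n) = cis (f (Suc n) - f n) * cis (2 * pi * of_int (- z))"
        by (simp only: cis_mult)
      also have "cis (2 * pi * of_int (- z)) = 1" by (rule cis_multiple_2pi) auto
      finally show ?thesis by (simp add: cis_divide)
    qed
    then have "cis (f (Suc n)) - cis (f n) = cis (f n) * (cis (2 * h n) - 1)"
      by (simp add: algebra_simps)
    then show ?thesis using ne by (simp add: w)
  qed
  have cdec: "cot (h (Suc n)) \<le> cot (h n)" if "a \<le> n" "Suc n < b" for n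
    using hb[of n] hb[of "Suc n"] mono[of n] that \<theta>
    by (intro cot_antimono) (auto simp: h_def)
  have cotb: "\<bar>cot (h n)\<bar> \<le> pi / \<theta>" if "a \<le> n" "n < b" for n
  proof -
    have "\<bar>cot (h n)\<bar> = \<bar>cos (h n)\<bar> / sin (h n)"
      using spos[OF that] by (simp add: cot_def abs_div)
    also have "\<dots> \<le> 1 / sin (h n)"
      using spos[OF that] by (intro divide_right_mono) auto
    also have "\<dots> \<le> 1 / (\<theta> / pi)"
      using sb[OF that] spos[OF that] \<theta> by (intro divide_left_mono) auto
    finally show ?thesis by simp
  qed
  have wb: "norm (w n) \<le> pi / (2 * \<theta>)" if "a \<le> n" "n < b" for n
  proof -
    have "(norm (w n))\<^sup>2 = (1 / (2 * sin (h n)))\<^sup>2"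
      using spos[OF that] sin_cos_squared_add[of "h n"]
      unfolding w_def cmod_power2 by (simp add: cot_def field_simps power2_eq_square)
    then have "norm (w n) = 1 / (2 * sin (h n))"
      using spos[OF that] by (simp add: power2_eq_iff_nonneg)
    also have "\<dots> \<le> 1 / (2 * (\<theta> / pi))"
      using sb[OF that] spos[OF that] \<theta> by (intro divide_left_mono) auto
    finally show ?thesis by simp
  qed
  have main: "norm ((\<Sum>n\<in>{a..<Suc m}. cis (f n)) - w m * cis (f (Suc m)))
      \<le> norm (w a) + (cot (h a) - cot (h m)) / 2" if "a \<le> m" "m < b" for m
    using that
  proof (induction m rule: dec_induct)
    case base
    have "cis (f a) - w a * cis (f (Suc a)) = - w a * cis (f a)"
      using step[of a] True by (simp add: algebra_simps)
    then have "norm (cis (f a) - w a * cis (f (Suc a))) = norm (w a)"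
      by (simp only: norm_mult norm_minus_cancel norm_cis mult_1_right)
    then show ?case by simp
  next
    case (step m)
    note IH = step.IH
    let ?S = "(\<Sum>n\<in>{a..<Suc m}. cis (f n))"
    have "(\<Sum>n\<in>{a..<Suc (Suc m)}. cis (f n)) - w (Suc m) * cis (f (Suc (Suc m)))
        = ?S + (cis (f (Suc m)) - w (Suc m) * cis (f (Suc (Suc m))))"
      using step.hyps by simp
    also have "cis (f (Suc m)) - w (Suc m) * cis (f (Suc (Suc m))) = - w (Suc m) * cis (f (Suc m))"
      using \<open>\<And>n. a \<le> n \<Longrightarrow> n < b \<Longrightarrow> cis (f n) = w n * (cis (f (Suc n)) - cis (f n))\<close>[of "Suc m"]
        step.prems step.hyps by (simp add: algebra_simps)
    also have "?S + - w (Suc m) * cis (f (Suc m))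
       = (?S - w m * cis (f (Suc m))) + (w m - w (Suc m)) * cis (f (Suc m))"
      by (simp add: algebra_simps)
    finally have eq: "(\<Sum>n\<in>{a..<Suc (Suc m)}. cis (f n)) - w (Suc m) * cis (f (Suc (Suc m)))
       = (?S - w m * cis (f (Suc m))) + (w m - w (Suc m)) * cis (f (Suc m))" .
    have d: "w m - w (Suc m) = Complex 0 ((cot (h (Suc m)) - cot (h m)) / 2)"
      by (simp add: w_def complex_eq_iff field_simps)
    have "norm ((w m - w (Suc m)) * cis (f (Suc m))) = (cot (h m) - cot (h (Suc m))) / 2"
      unfolding d norm_mult norm_cis using cdec[of m] step.hyps step.prems
      by (simp add: cmod_def)
    moreover have "norm (?S - w m * cis (f (Suc m))) \<le> norm (w a) + (cot (h a) - cot (h m)) / 2"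
      using IH step.prems step.hyps by simp
    moreover have "norm ((?S - w m * cis (f (Suc m))) + (w m - w (Suc m)) * cis (f (Suc m)))
      \<le> norm (?S - w m * cis (f (Suc m))) + norm ((w m - w (Suc m)) * cis (f (Suc m)))"
      by (rule norm_triangle_ineq)
    moreover have "z \<le> w + (a - B) / 2" if "x = (A - B) / 2" "y \<le> w + (a - A) / 2" "z \<le> y + x"
      for x y z w a A B :: real using that by (simp add: field_simps)
    ultimately show ?case
      unfolding eq by blast
  qed
  obtain m where m: "b = Suc m" using True by (cases b) auto
  have am: "a \<le> m" "m < b" using True m by auto
  let ?S = "(\<Sum>n\<in>{a..<b}. cis (f n))"
  have "norm ?S \<le> norm (?S - w m * cis (f (Suc m))) + norm (w m * cis (f (Suc m)))"
    using norm_triangle_ineq[of "?S - w m * cis (f (Suc m))" "w m * cis (f (Suc m))"] by simp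
  also have "\<dots> \<le> (norm (w a) + (cot (h a) - cot (h m)) / 2) + norm (w m)"
    using main[OF am] m by (simp add: norm_mult)
  also have "\<dots> \<le> pi / (2 * \<theta>) + (pi / \<theta> + pi / \<theta>) / 2 + pi / (2 * \<theta>)"
  proof -
    have "w + (a - b) / 2 + w' \<le> p + (q + q) / 2 + p" if "w \<le> p" "w' \<le> p" "\<bar>a\<bar> \<le> q" "\<bar>b\<bar> \<le> q"
      for w w' a b p q :: real using that by (simp add: field_simps abs_le_iff)
    then show ?thesis using wb[OF order_refl True] wb[OF am] cotb[OF order_refl True] cotb[OF am] by blast
  qed
  also have "\<dots> = 2 * pi / \<theta>" using \<theta> by (simp add: field_simps)
  also have "\<dots> \<le> 8 / \<theta>" using \<theta> pi_less_4 by (intro divide_right_mono) auto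
  finally show ?thesis .
qed

text \<open>
  On each stretch where the derivative \<open>f (n + 1) - f n\<close> stays in one period, the terms
  with derivative within \<open>sqrt \<mu>\<close> of a multiple of \<open>2 * pi\<close> are few because the
  derivative moves by at least \<open>\<mu>\<close> at each step; Kusmin--Landau handles the others.
\<close>
lemma second_difference_test:
  fixes f :: "nat \<Rightarrow> real"
  assumes \<mu>: "0 < \<mu>" "\<mu> \<le> 1"
    and lo: "\<And>n. n < L \<Longrightarrow> \<mu> \<le> (f (n + 2) - f (n + 1)) - (f (n + 1) - f n)"
    and hi: "\<And>n. n < L \<Longrightarrow> (f (n + 2) - f (n + 1)) - (f (n + 1) - f n) \<le> h * \<mu>"
  shows "norm (\<Sum>n<L. cis (f n)) \<le> 12 * (h * \<mu> * L + 2) / sqrt \<mu>"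
proof (cases "L = 0")
  case True
  then show ?thesis using \<mu> by simp
next
  case False
  define g where "g = (\<lambda>n. f (Suc n) - f n)"
  define \<theta> where "\<theta> = sqrt \<mu>"
  have \<theta>: "0 < \<theta>" "\<theta> \<le> 1" "\<theta> * \<theta> = \<mu>" using \<mu> by (auto simp: \<theta>_def)
  have glo: "g m + \<mu> * (n - m) \<le> g n" if "m \<le> n" "n \<le> L" for m n
    using that
  proof (induction n rule: dec_induct)
    case (step n)
    then show ?case using lo[of n] by (simp add: g_def algebra_simps of_nat_diff)
  qed simp
  have ghi: "g n \<le> g 0 + h * \<mu> * n" if "n \<le> L" for n
    using that
  proof (induction n)
    case (Suc n)
    then show ?case using hi[of n] by (simp add: g_def algebra_simps)
  qed simp
  have gmono: "g m \<le> g n" if "m \<le> n" "n \<le> L" for m n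
    using glo[OF that] that \<mu> by (smt (verit) mult_nonneg_nonneg of_nat_0_le_iff of_nat_le_iff)
  define fl where "fl = (\<lambda>n. \<lfloor>g n / (2 * pi)\<rfloor>)"
  define Z where "Z = fl ` {..<L}"
  have h0: "0 \<le> h * \<mu>" using lo[of 0] hi[of 0] False \<mu> by simp
  have block_set: "card {n. n < L \<and> \<alpha> \<le> g n \<and> g n < \<alpha> + \<theta>} \<le> \<theta> / \<mu> + 1" for \<alpha>
  proof -
    let ?B = "{n. n < L \<and> \<alpha> \<le> g n \<and> g n < \<alpha> + \<theta>}"
    have fin: "finite ?B" by simp
    show ?thesis
    proof (cases "?B = {}")
      case True
      then show ?thesis using \<theta> \<mu> unfolding True by simp
    next
      case False
      define a where "a = Min ?B"
      define b where "b = Max ?B"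
      have a: "a \<in> ?B" and b: "b \<in> ?B" using Min_in[OF fin False] Max_in[OF fin False]
        by (auto simp: a_def b_def)
      have sub: "?B \<subseteq> {a..b}" using fin by (auto simp: a_def b_def)
      have ab: "a \<le> b" using sub a by auto
      have "card ?B \<le> card {a..b}" by (rule card_mono[OF _ sub]) simp
      then have "real (card ?B) \<le> real b - real a + 1" using ab by simp
      moreover have "\<mu> * (real b - real a) \<le> \<theta>" using glo[OF ab] a b of_nat_diff[OF ab, where ?'a = real] by auto
      then have "real b - real a \<le> \<theta> / \<mu>" using \<mu> by (simp add: field_simps)
      ultimately show ?thesis by linarith
    qed
  qed
  have block: "norm (\<Sum>n | n < L \<and> fl n = z. cis (f n)) \<le> 12 / \<theta>" for z
  proof -
    let ?B = "{n. n < L \<and> fl n = z}"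
    let ?A1 = "{n. n < L \<and> 2 * pi * z \<le> g n \<and> g n < 2 * pi * z + \<theta>}"
    let ?A2 = "{n. n < L \<and> (2 * pi * z + 2 * pi - \<theta>) \<le> g n \<and> g n < (2 * pi * z + 2 * pi - \<theta>) + \<theta>}"
    let ?M = "{n. n < L \<and> 2 * pi * z + \<theta> \<le> g n \<and> g n < 2 * pi * z + 2 * pi - \<theta>}"
    have Bdef: "n \<in> ?B \<longleftrightarrow> n < L \<and> 2 * pi * z \<le> g n \<and> g n < 2 * pi * z + 2 * pi" for n
    proof -
      have "fl n = z \<longleftrightarrow> of_int z \<le> g n / (2 * pi) \<and> g n / (2 * pi) < of_int z + 1"
        unfolding fl_def by (rule floor_eq_iff)
      also have "\<dots> \<longleftrightarrow> 2 * pi * z \<le> g n \<and> g n < 2 * pi * z + 2 * pi"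
        by (simp add: field_simps)
      finally show ?thesis by auto
    qed
    have \<theta>pi: "\<theta> < pi" using \<theta> pi_ge_two by linarith
    have Mint: "norm (\<Sum>n\<in>?M. cis (f n)) \<le> 8 / \<theta>"
    proof (cases "?M = {}")
      case True
      then show ?thesis using \<theta> by (simp only: sum.empty norm_zero) simp
    next
      case False
      have fin: "finite ?M" by simp
      define a where "a = Min ?M"
      define b where "b = Suc (Max ?M)"
      have a: "a \<in> ?M" and b: "Max ?M \<in> ?M" using Min_in[OF fin False] Max_in[OF fin False]
        by (auto simp: a_def)
      have "?M \<subseteq> {a..<b}" using fin by (auto simp: a_def b_def less_Suc_eq_le)
      moreover have inM: "n \<in> ?M" if "n \<in> {a..<b}" for n
      proof -
        have "n \<le> Max ?M" "a \<le> n" using that by (auto simp: b_def)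
        then show ?thesis using a b gmono[of a n] gmono[of n "Max ?M"] by simp
      qed
      ultimately have eq: "?M = {a..<b}" by blast
      show ?thesis unfolding eq
      proof (rule kusmin_landau[of \<theta> a b f z])
        show "\<theta> > 0" by fact
      next
        fix n assume n: "a \<le> n" "n < b"
        then show "\<theta> \<le> f (Suc n) - f n - 2 * pi * z" "f (Suc n) - f n - 2 * pi * z \<le> 2 * pi - \<theta>"
          using inM[of n] by (auto simp: g_def)
      next
        fix n assume n: "a \<le> n" "Suc n < b"
        then show "f (Suc n) - f n \<le> f (Suc (Suc n)) - f (Suc n)"
          using inM[of "Suc n"] gmono[of n "Suc n"] by (auto simp: g_def)
      qed
    qed
    have Bsub: "?B = (?A1 \<union> ?A2) \<union> ?M" unfolding set_eq_iff Un_iff Bdef using \<theta> \<theta>pi by auto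
    have disj: "(?A1 \<union> ?A2) \<inter> ?M = {}" by auto
    have "norm (\<Sum>n\<in>?B. cis (f n)) = norm ((\<Sum>n\<in>?A1 \<union> ?A2. cis (f n)) + (\<Sum>n\<in>?M. cis (f n)))"
      unfolding Bsub by (subst sum.union_disjoint[OF _ _ disj]) auto
    also have "\<dots> \<le> norm (\<Sum>n\<in>?A1 \<union> ?A2. cis (f n)) + norm (\<Sum>n\<in>?M. cis (f n))"
      by (rule norm_triangle_ineq)
    also have "norm (\<Sum>n\<in>?A1 \<union> ?A2. cis (f n)) \<le> card (?A1 \<union> ?A2)"
      using sum_norm_le[of "?A1 \<union> ?A2" "\<lambda>n. cis (f n)" "\<lambda>_. 1"] by simp
    also have "real (card (?A1 \<union> ?A2)) \<le> real (card ?A1) + real (card ?A2)"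
      using card_Un_le[of ?A1 ?A2] by linarith
    also have "\<dots> \<le> (1 / \<theta> + 1) + (1 / \<theta> + 1)"
    proof -
      have "\<theta> / \<mu> = 1 / \<theta>"
        using \<theta> \<mu> by (simp add: field_simps)
      then show ?thesis
        using add_mono[OF block_set[of "2 * pi * z"] block_set[of "2 * pi * z + 2 * pi - \<theta>"]] by simp
    qed
    also note Mint
    also have "(1 / \<theta> + 1) + (1 / \<theta> + 1) + 8 / \<theta> \<le> 12 / \<theta>"
      using \<theta>(1,2) by (simp add: field_simps)
    finally show ?thesis by simp
  qed
  have "Z \<subseteq> {fl 0..fl 0 + \<lceil>h * \<mu> * L / (2 * pi)\<rceil>}"
  proof
    fix z assume "z \<in> Z"
    then obtain n where n: "n < L" "z = fl n" by (auto simp: Z_def)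
    have "g 0 / (2 * pi) \<le> g n / (2 * pi)" using gmono[of 0 n] n by (intro divide_right_mono) auto
    then have 1: "fl 0 \<le> z" using n by (simp add: fl_def floor_mono)
    have "g n \<le> g 0 + h * \<mu> * L"
      using ghi[of n] n mult_left_mono[OF _ h0, of "real n" "real L"] by simp
    then have "g n / (2 * pi) \<le> g 0 / (2 * pi) + h * \<mu> * L / (2 * pi)"
      by (simp add: add_divide_distrib[symmetric] divide_right_mono)
    also have "\<dots> \<le> g 0 / (2 * pi) + of_int \<lceil>h * \<mu> * L / (2 * pi)\<rceil>" by simp
    finally have "z \<le> \<lfloor>g 0 / (2 * pi) + of_int \<lceil>h * \<mu> * L / (2 * pi)\<rceil>\<rfloor>"
      unfolding n(2) fl_def by (rule floor_mono)
    then have "z \<le> fl 0 + \<lceil>h * \<mu> * L / (2 * pi)\<rceil>" by (simp add: fl_def)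
    with 1 show "z \<in> {fl 0..fl 0 + \<lceil>h * \<mu> * L / (2 * pi)\<rceil>}" by simp
  qed
  then have "card Z \<le> card {fl 0..fl 0 + \<lceil>h * \<mu> * L / (2 * pi)\<rceil>}" by (intro card_mono) auto
  also have "\<dots> = nat (\<lceil>h * \<mu> * L / (2 * pi)\<rceil> + 1)" by simp
  finally have "real (card Z) \<le> real (nat (\<lceil>h * \<mu> * L / (2 * pi)\<rceil> + 1))" by linarith
  also have "\<dots> \<le> h * \<mu> * L / (2 * pi) + 2"
  proof -
    have "0 \<le> h * \<mu> * L / (2 * pi)" using h0 by simp
    then have "0 \<le> \<lceil>h * \<mu> * L / (2 * pi)\<rceil>" by linarith
    then show ?thesis by linarith
  qed
  also have "h * \<mu> * L / (2 * pi) \<le> h * \<mu> * L / 1"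
    using h0 pi_ge_two by (intro divide_left_mono) auto
  finally have cardZ: "real (card Z) \<le> h * \<mu> * L + 2" by simp
  have "(\<Sum>n<L. cis (f n)) = (\<Sum>z\<in>Z. \<Sum>n | n \<in> {..<L} \<and> fl n = z. cis (f n))"
    unfolding Z_def by (rule sum.image_gen) simp
  then have "norm (\<Sum>n<L. cis (f n)) \<le> (\<Sum>z\<in>Z. 12 / \<theta>)"
    using block by (auto intro!: sum_norm_le simp del: sum_constant)
  also have "\<dots> = card Z * (12 / \<theta>)" by simp
  also have "\<dots> \<le> (h * \<mu> * L + 2) * (12 / \<theta>)" using cardZ \<theta> by (intro mult_right_mono) auto
  finally show ?thesis by (simp add: \<theta>_def mult.commute)
qed

lemma norm_sum_Cauchy_Schwarz:
  fixes a b :: "'a \<Rightarrow> complex"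
  shows "(norm (\<Sum>i\<in>I. a i * b i))\<^sup>2 \<le> (\<Sum>i\<in>I. (norm (a i))\<^sup>2) * (\<Sum>i\<in>I. (norm (b i))\<^sup>2)"
proof -
  have "norm (\<Sum>i\<in>I. a i * b i) \<le> (\<Sum>i\<in>I. norm (a i) * norm (b i))"
    by (rule order_trans[OF norm_sum]) (simp add: norm_mult)
  then have "(norm (\<Sum>i\<in>I. a i * b i))\<^sup>2 \<le> (\<Sum>i\<in>I. norm (a i) * norm (b i))\<^sup>2"
    by (intro power_mono) auto
  also have "\<dots> \<le> (\<Sum>i\<in>I. (norm (a i))\<^sup>2) * (\<Sum>i\<in>I. (norm (b i))\<^sup>2)"
    by (rule Cauchy_Schwarz_ineq_sum)
  finally show ?thesis .
qed

lemma norm_sum_square_expand: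
  fixes z :: "'b \<Rightarrow> 'a \<Rightarrow> complex"
  assumes "finite Q"
  shows "complex_of_real (\<Sum>n\<in>A. (norm (\<Sum>q\<in>Q. z q n))\<^sup>2)
    = (\<Sum>q'\<in>Q. \<Sum>q\<in>Q. \<Sum>n\<in>A. z q' n * cnj (z q n))"
proof -
  have "complex_of_real (\<Sum>n\<in>A. (norm (\<Sum>q\<in>Q. z q n))\<^sup>2)
    = (\<Sum>n\<in>A. (\<Sum>q\<in>Q. z q n) * cnj (\<Sum>q\<in>Q. z q n))"
    by (simp add: complex_norm_square del: of_real_power)
  also have "\<dots> = (\<Sum>n\<in>A. \<Sum>q'\<in>Q. \<Sum>q\<in>Q. z q' n * cnj (z q n))"
    by (simp add: sum_product)
  also have "\<dots> = (\<Sum>q'\<in>Q. \<Sum>n\<in>A. \<Sum>q\<in>Q. z q' n * cnj (z q n))"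
    by (rule sum.swap)
  also have "\<dots> = (\<Sum>q'\<in>Q. \<Sum>q\<in>Q. \<Sum>n\<in>A. z q' n * cnj (z q n))"
    by (intro sum.cong refl sum.swap)
  finally show ?thesis .
qed

text \<open>
  Weyl--van der Corput differencing: averaging the sum over \<open>Q\<close> shifts and applying
  Cauchy--Schwarz in \<open>n\<close> leaves only the correlations of the sequence with its own shifts.
\<close>
lemma van_der_corput_differencing:
  fixes z :: "nat \<Rightarrow> complex"
  assumes z1: "\<And>n. norm (z n) \<le> 1" and Q: "1 \<le> Q" "Q \<le> L" and B: "0 \<le> B"
    and corr: "\<And>q q'. q < q' \<Longrightarrow> q' < Q \<Longrightarrow> norm (\<Sum>n<L-Q. z (n + q') * cnj (z (n + q))) \<le> B"
  shows "norm (\<Sum>n<L. z n) \<le> Q + sqrt ((real L)\<^sup>2 / Q + L * B)"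
proof -
  define L' where "L' = L - Q"
  define S where "S = (\<Sum>n<L. z n)"
  define W where "W = (\<Sum>n<L'. \<Sum>q<Q. z (n + q))"
  have L: "L = L' + Q" using Q by (simp add: L'_def)
  have shift: "norm (S - (\<Sum>n<L'. z (n + q))) \<le> Q" if q: "q < Q" for q
  proof -
    have "(\<Sum>n<L'. z (n + q)) = sum z {q..<q+L'}"
      using sum.shift_bounds_nat_ivl[of z 0 q L'] by (simp add: atLeast0LessThan add.commute)
    moreover have "S = sum z ({..<L} - {q..<q+L'}) + sum z {q..<q+L'}"
      unfolding S_def by (rule sum.subset_diff) (use q L in auto)
    ultimately have "S - (\<Sum>n<L'. z (n + q)) = sum z ({..<L} - {q..<q+L'})" by simp
    moreover have "norm (sum z ({..<L} - {q..<q+L'})) \<le> (\<Sum>n\<in>{..<L} - {q..<q+L'}. 1)"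
      using z1 by (intro sum_norm_le) auto
    moreover have "card ({..<L} - {q..<q+L'}) = Q"
      using q L by (subst card_Diff_subset) auto
    ultimately show ?thesis by simp
  qed
  have Weq: "W = (\<Sum>q<Q. \<Sum>n<L'. z (n + q))" unfolding W_def by (rule sum.swap)
  have "Q * S - W = (\<Sum>q<Q. S - (\<Sum>n<L'. z (n + q)))"
    by (simp add: Weq sum_subtractf)
  then have "norm (Q * S - W) \<le> (\<Sum>q<Q. real Q)"
    using shift by (auto intro!: sum_norm_le simp del: sum_constant)
  then have SW: "norm (Q * S - W) \<le> real Q * real Q" by simp
  have "(norm W)\<^sup>2 \<le> (\<Sum>n<L'. (norm (1::complex))\<^sup>2) * (\<Sum>n<L'. (norm (\<Sum>q<Q. z (n + q)))\<^sup>2)"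
    using norm_sum_Cauchy_Schwarz[of "\<lambda>_. 1" "\<lambda>n. \<Sum>q<Q. z (n + q)" "{..<L'}"] by (simp add: W_def)
  then have W1: "(norm W)\<^sup>2 \<le> L' * (\<Sum>n<L'. (norm (\<Sum>q<Q. z (n + q)))\<^sup>2)" by simp
  have corr': "norm (\<Sum>n<L'. z (n + q') * cnj (z (n + q))) \<le> (if q = q' then real L else 0) + B"
    if "q < Q" "q' < Q" for q q'
  proof (cases q q' rule: linorder_cases)
    case less
    then show ?thesis using corr[of q q'] that by (simp add: L'_def)
  next
    case equal
    have "norm (\<Sum>n<L'. z (n + q') * cnj (z (n + q))) \<le> (\<Sum>n<L'. 1)"
      using z1 by (intro sum_norm_le) (auto simp: norm_mult intro!: mult_le_one)
    then show ?thesis using equal B L by simp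
  next
    case greater
    have "(\<Sum>n<L'. z (n + q') * cnj (z (n + q))) = cnj (\<Sum>n<L'. z (n + q) * cnj (z (n + q')))"
      by (simp add: mult.commute)
    then show ?thesis using corr[of q' q] that greater by (simp add: L'_def del: cnj_sum)
  qed
  have "(\<Sum>n<L'. (norm (\<Sum>q<Q. z (n + q)))\<^sup>2)
     \<le> norm (complex_of_real (\<Sum>n<L'. (norm (\<Sum>q<Q. z (n + q)))\<^sup>2))"
    by (simp add: sum_nonneg del: of_real_sum)
  also have "\<dots> = norm (\<Sum>q'<Q. \<Sum>q<Q. \<Sum>n<L'. z (n + q') * cnj (z (n + q)))"
    by (subst norm_sum_square_expand) auto
  also have "\<dots> \<le> (\<Sum>q'<Q. \<Sum>q<Q. (if q = q' then real L else 0) + B)"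
    by (intro sum_norm_le) (use corr' in auto)
  also have "\<dots> = Q * L + Q * Q * B"
    by (simp add: sum.distrib algebra_simps)
  finally have "(norm W)\<^sup>2 \<le> L' * (Q * L + Q * Q * B)"
    using W1 by (meson mult_left_mono of_nat_0_le_iff order_trans)
  also have "\<dots> \<le> L * (Q * L + Q * Q * B)"
    using L B by (intro mult_right_mono) auto
  also have "\<dots> = (Q * sqrt ((real L)\<^sup>2 / Q + L * B))\<^sup>2"
    using Q B by (simp add: power_mult_distrib field_simps power2_eq_square)
  finally have "norm W \<le> Q * sqrt ((real L)\<^sup>2 / Q + L * B)"
    by (rule power2_le_imp_le) (use B in auto)
  moreover have "norm (Q * S) \<le> norm (Q * S - W) + norm W"
    using norm_triangle_ineq[of "Q * S - W" W] by simp
  ultimately have "Q * norm S \<le> Q * Q + Q * sqrt ((real L)\<^sup>2 / Q + L * B)"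
    using SW by (simp add: norm_mult)
  also have "\<dots> = Q * (Q + sqrt ((real L)\<^sup>2 / Q + L * B))" by (simp add: algebra_simps)
  finally show ?thesis using Q by (simp add: S_def)
qed

definition fdiff :: "(nat \<Rightarrow> real) \<Rightarrow> nat \<Rightarrow> real" where
  "fdiff f n = f (Suc n) - f n"

lemma fdiff_iter_sum:
  assumes "finite I"
  shows "(fdiff ^^ d) (\<lambda>n. \<Sum>i\<in>I. f i n) = (\<lambda>n. \<Sum>i\<in>I. (fdiff ^^ d) (f i) n)"
  by (induction d) (simp_all add: fdiff_def[abs_def] sum_subtractf)

lemma fdiff_iter_shift: "(fdiff ^^ d) (\<lambda>n. f (n + i)) = (\<lambda>n. (fdiff ^^ d) f (n + i))"
  by (induction d) (simp_all add: fdiff_def[abs_def])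

text \<open>
  A difference over a step \<open>q\<close> is a sum of \<open>q\<close> unit differences, so its iterated
  differences of one order less are \<open>q\<close> times as large as those of the original function.
\<close>
lemma fdiff_iter_step:
  "(fdiff ^^ d) (\<lambda>n. f (n + b + q) - f (n + b)) n = (\<Sum>i<q. (fdiff ^^ Suc d) f (n + (b + i)))"
proof -
  have "(\<lambda>n. f (n + b + q) - f (n + b)) = (\<lambda>n. \<Sum>i<q. (\<lambda>n. fdiff f (n + (b + i))) n)"
  proof
    fix n
    show "f (n + b + q) - f (n + b) = (\<Sum>i<q. (\<lambda>n. fdiff f (n + (b + i))) n)"
      by (induction q) (simp_all add: fdiff_def add.assoc)
  qed
  then have "(fdiff ^^ d) (\<lambda>n. f (n + b + q) - f (n + b)) n
    = (\<Sum>i<q. (fdiff ^^ d) (\<lambda>n. fdiff f (n + (b + i))) n)"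
    by (simp only: fdiff_iter_sum[OF finite_lessThan])
  also have "\<dots> = (\<Sum>i<q. (fdiff ^^ Suc d) f (n + (b + i)))"
    by (simp only: fdiff_iter_shift funpow_Suc_right o_apply)
  finally show ?thesis .
qed

text \<open>
  The power saving in the \<open>k\<close>-th derivative test. The exponent obtained is far from optimal; the
  induction halves \<open>\<alpha>\<close> because differencing over steps up to \<open>N powr (\<alpha> / 2)\<close> moves
  \<open>\<mu>\<close> towards the upper end of its range.
\<close>
lemma weyl_bound:
  assumes "2 \<le> k" "0 < \<alpha>" "\<alpha> \<le> 1" "1 \<le> h"
  shows "\<exists>c>0. \<exists>C\<ge>0. \<forall>N\<ge>1. \<forall>\<mu>. \<forall>f. \<forall>L::nat.
     N powr (\<alpha> - 2) \<le> \<mu> \<longrightarrow> \<mu> \<le> N powr (- \<alpha>) \<longrightarrow> real L \<le> N \<longrightarrow>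
     (\<forall>n<L. \<mu> \<le> (fdiff ^^ k) f n \<and> (fdiff ^^ k) f n \<le> h * \<mu>) \<longrightarrow>
     norm (\<Sum>n<L. cis (f n)) \<le> C * N powr (1 - c)"
  using assms
proof (induction k arbitrary: \<alpha> rule: dec_induct)
  case base
  show ?case
  proof (rule exI[of _ "\<alpha> / 2"], rule conjI[rotated], rule exI[of _ "12 * (h + 2)"], intro conjI allI impI)
    fix N \<mu> :: real and f and L :: nat
    assume N: "N \<ge> 1" and l: "N powr (\<alpha> - 2) \<le> \<mu>" "\<mu> \<le> N powr (- \<alpha>)" and L: "real L \<le> N"
      and f: "\<forall>n<L. \<mu> \<le> (fdiff ^^ 2) f n \<and> (fdiff ^^ 2) f n \<le> h * \<mu>"
    have mpos: "0 < \<mu>" using l N by (smt (verit) powr_gt_zero)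
    have "N powr (- \<alpha>) \<le> 1" using N base powr_mono[of "- \<alpha>" 0 N] by simp
    then have m1: "\<mu> \<le> 1" using l by linarith
    have "norm (\<Sum>n<L. cis (f n)) \<le> 12 * (h * \<mu> * L + 2) / sqrt \<mu>"
      using f by (intro second_difference_test mpos m1) (auto simp: numeral_2_eq_2 fdiff_def)
    also have "\<dots> \<le> 12 * (h * \<mu> * N + 2) / sqrt \<mu>"
      using L base mpos by (intro divide_right_mono mult_left_mono add_right_mono) auto
    also have "\<dots> = 12 * h * N * sqrt \<mu> + 24 / sqrt \<mu>"
      using mpos by (simp add: field_simps)
    finally have *: "norm (\<Sum>n<L. cis (f n)) \<le> 12 * h * N * sqrt \<mu> + 24 / sqrt \<mu>" .
    have "sqrt \<mu> \<le> N powr (- \<alpha> / 2)"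
    proof -
      have "sqrt \<mu> \<le> sqrt (N powr (- \<alpha>))" using l by simp
      then show ?thesis using N by (simp add: powr_half_sqrt[symmetric] powr_powr)
    qed
    then have "12 * h * N * sqrt \<mu> \<le> 12 * h * N * N powr (- \<alpha> / 2)"
      using base N by (intro mult_left_mono) auto
    also have "\<dots> = 12 * h * N powr (1 - \<alpha> / 2)"
      using N powr_mult_base[of N "- \<alpha> / 2"] by simp
    finally have **: "12 * h * N * sqrt \<mu> \<le> 12 * h * N powr (1 - \<alpha> / 2)" .
    have "N powr (\<alpha> / 2 - 1) \<le> sqrt \<mu>"
    proof -
      have "sqrt (N powr (\<alpha> - 2)) \<le> sqrt \<mu>" using l by simp
      then show ?thesis using N by (simp add: powr_half_sqrt[symmetric] powr_powr diff_divide_distrib)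
    qed
    then have "1 / sqrt \<mu> \<le> 1 / N powr (\<alpha> / 2 - 1)" using N mpos by (intro divide_left_mono) auto
    also have "\<dots> = N powr (1 - \<alpha> / 2)" by (simp add: powr_minus_divide[symmetric])
    finally have "24 / sqrt \<mu> \<le> 24 * N powr (1 - \<alpha> / 2)" by simp
    with * ** show "norm (\<Sum>n<L. cis (f n)) \<le> 12 * (h + 2) * N powr (1 - \<alpha> / 2)"
      by (simp add: algebra_simps)
  qed (use base in auto)
next
  case (step k)
  obtain c C where c: "c > 0" and C: "C \<ge> 0" and IH: "\<And>N \<mu> f L. N \<ge> 1 \<Longrightarrow>
     N powr (\<alpha> / 2 - 2) \<le> \<mu> \<Longrightarrow> \<mu> \<le> N powr (- (\<alpha> / 2)) \<Longrightarrow> real L \<le> N \<Longrightarrow>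
     (\<And>n. n < L \<Longrightarrow> \<mu> \<le> (fdiff ^^ k) f n \<and> (fdiff ^^ k) f n \<le> h * \<mu>) \<Longrightarrow>
     norm (\<Sum>n<L. cis (f n)) \<le> C * N powr (1 - c)"
    using step.IH[of "\<alpha> / 2"] step.prems by auto
  define e where "e = min (\<alpha> / 4) (c / 2)"
  have e: "0 < e" "e \<le> \<alpha> / 4" "e \<le> c / 2" using c step.prems by (auto simp: e_def)
  show ?case
  proof (rule exI[of _ e], rule conjI[rotated], rule exI[of _ "1 + sqrt (2 + C)"], intro conjI allI impI)
    fix N \<mu> :: real and f and L :: nat
    assume N: "N \<ge> 1" and l: "N powr (\<alpha> - 2) \<le> \<mu>" "\<mu> \<le> N powr (- \<alpha>)" and L: "real L \<le> N"
      and f: "\<forall>n<L. \<mu> \<le> (fdiff ^^ Suc k) f n \<and> (fdiff ^^ Suc k) f n \<le> h * \<mu>"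
    have mpos: "0 < \<mu>" using l N by (smt (verit) powr_gt_zero)
    define Q where "Q = nat \<lfloor>N powr (\<alpha> / 2)\<rfloor>"
    have N1: "1 \<le> N powr (\<alpha> / 2)" using N step.prems by (intro ge_one_powr_ge_zero) auto
    have Q: "1 \<le> Q" "real Q \<le> N powr (\<alpha> / 2)" "N powr (\<alpha> / 2) \<le> 2 * real Q"
    proof -
      have "1 \<le> \<lfloor>N powr (\<alpha> / 2)\<rfloor>" using N1 by simp
      then have 1: "1 \<le> Q" "real Q = of_int \<lfloor>N powr (\<alpha> / 2)\<rfloor>" unfolding Q_def by linarith+
      then show "1 \<le> Q" "real Q \<le> N powr (\<alpha> / 2)" "N powr (\<alpha> / 2) \<le> 2 * real Q" by linarith+
    qed
    have mono: "N powr a \<le> N powr b" if "a \<le> b" for a b using N that by (rule powr_mono[rotated])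
    have QN: "real Q \<le> N powr (1 - e)"
      using Q(2) mono[of "\<alpha> / 2" "1 - e"] e step.prems by linarith
    show "norm (\<Sum>n<L. cis (f n)) \<le> (1 + sqrt (2 + C)) * N powr (1 - e)"
    proof (cases "Q \<le> L")
      case False
      have "norm (\<Sum>n<L. cis (f n)) \<le> (\<Sum>n<L. 1)" by (intro sum_norm_le) auto
      then have "norm (\<Sum>n<L. cis (f n)) \<le> N powr (1 - e)" using QN False by simp
      also have "\<dots> \<le> (1 + sqrt (2 + C)) * N powr (1 - e)"
        using C by (simp add: algebra_simps)
      finally show ?thesis .
    next
      case True
      have corr: "norm (\<Sum>n<L-Q. cis (f (n + q')) * cnj (cis (f (n + q)))) \<le> C * N powr (1 - c)"
        if qq: "q < q'" "q' < Q" for q q'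
      proof -
        define d where "d = q' - q"
        have d: "q' = q + d" "1 \<le> d" "d \<le> Q" using qq by (auto simp: d_def)
        have dlo: "\<mu> \<le> d * \<mu>" using d mpos by simp
        have "d * \<mu> \<le> N powr (\<alpha> / 2) * N powr (- \<alpha>)"
          using d Q l mpos by (intro mult_mono) auto
        then have dhi: "d * \<mu> \<le> N powr (- (\<alpha> / 2))" by (simp add: powr_add[symmetric])
        have "norm (\<Sum>n<L-Q. cis (f (n + q + d) - f (n + q))) \<le> C * N powr (1 - c)"
        proof (rule IH[where \<mu> = "d * \<mu>"])
          show "N \<ge> 1" by fact
          show "N powr (\<alpha> / 2 - 2) \<le> d * \<mu>"
            using mono[of "\<alpha> / 2 - 2" "\<alpha> - 2"] l dlo step.prems by linarith
          show "d * \<mu> \<le> N powr (- (\<alpha> / 2))" by fact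
          show "real (L - Q) \<le> N" using L by linarith
          fix n assume n: "n < L - Q"
          have ran: "n + (q + i) < L" if "i < d" for i using n qq d that by linarith
          have "(\<Sum>i<d. \<mu>) \<le> (\<Sum>i<d. (fdiff ^^ Suc k) f (n + (q + i)))"
            using f ran by (intro sum_mono) blast
          moreover have "(\<Sum>i<d. (fdiff ^^ Suc k) f (n + (q + i))) \<le> (\<Sum>i<d. h * \<mu>)"
            using f ran by (intro sum_mono) blast
          ultimately show "d * \<mu> \<le> (fdiff ^^ k) (\<lambda>n. f (n + q + d) - f (n + q)) n \<and>
             (fdiff ^^ k) (\<lambda>n. f (n + q + d) - f (n + q)) n \<le> h * (d * \<mu>)"
            unfolding fdiff_iter_step by (simp add: mult_ac)
        qed
        then show ?thesis by (simp add: d cis_cnj cis_mult add.assoc)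
      qed
      have "norm (\<Sum>n<L. cis (f n)) \<le> Q + sqrt ((real L)\<^sup>2 / Q + L * (C * N powr (1 - c)))"
        using van_der_corput_differencing[of "\<lambda>n. cis (f n)" Q L "C * N powr (1 - c)"] corr Q True C by simp
      also have "\<dots> \<le> N powr (1 - e) + sqrt (2 + C) * N powr (1 - e)"
      proof (intro add_mono QN)
        have "real L * (C * N powr (1 - c)) \<le> N * (C * N powr (1 - c))"
          using L C by (intro mult_right_mono) auto
        also have "\<dots> = C * N powr (2 - c)" using N by (simp add: powr_diff power2_eq_square)
        also have "\<dots> \<le> C * N powr (2 - 2 * e)" using C e by (intro mult_left_mono mono) auto
        finally have 1: "real L * (C * N powr (1 - c)) \<le> C * N powr (2 - 2 * e)" .
        have "(real L)\<^sup>2 / Q \<le> N\<^sup>2 / (N powr (\<alpha> / 2) / 2)"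
          using L N Q by (intro frac_le) (auto intro!: power_mono)
        also have "\<dots> = 2 * N powr (2 - \<alpha> / 2)" using N by (simp add: powr_diff)
        also have "\<dots> \<le> 2 * N powr (2 - 2 * e)" using e by (intro mult_left_mono mono) auto
        finally have 2: "(real L)\<^sup>2 / Q \<le> 2 * N powr (2 - 2 * e)" .
        have "N powr (2 - 2 * e) = (N powr (1 - e))\<^sup>2"
          using N by (simp add: algebra_simps powr_power)
        then have "(real L)\<^sup>2 / Q + real L * (C * N powr (1 - c)) \<le> (2 + C) * (N powr (1 - e))\<^sup>2"
          using 1 2 by (simp add: algebra_simps)
        then have "sqrt ((real L)\<^sup>2 / Q + real L * (C * N powr (1 - c))) \<le> sqrt ((2 + C) * (N powr (1 - e))\<^sup>2)"
          by (rule real_sqrt_le_mono)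
        also have "\<dots> = sqrt (2 + C) * N powr (1 - e)" by (simp add: real_sqrt_mult)
        finally show "sqrt ((real L)\<^sup>2 / Q + real L * (C * N powr (1 - c))) \<le> sqrt (2 + C) * N powr (1 - e)" .
      qed
      finally show ?thesis by (simp add: algebra_simps)
    qed
  qed (use e C in auto)
qed

section \<open>Sums of \<open>n\<close> to an imaginary power\<close>

text \<open>
  Here \<open>cis (t * ln n)\<close> is \<open>n\<close> to the power \<open>\<i> * t\<close>.
\<close>
definition osc_sum :: "nat set \<Rightarrow> real \<Rightarrow> complex" where
  "osc_sum A t = (\<Sum>n\<in>A. cis (t * ln (real n)))"

lemma osc_sum_uminus: "osc_sum A (- t) = cnj (osc_sum A t)"
  by (simp add: osc_sum_def cis_cnj)

lemma norm_osc_sum_abs: "norm (osc_sum A \<bar>t\<bar>) = norm (osc_sum A t)"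
  by (cases "t \<ge> 0") (simp_all add: osc_sum_uminus)

lemma norm_osc_sum_le_card: "norm (osc_sum A t) \<le> card A"
  unfolding osc_sum_def using sum_norm_le[of A "\<lambda>n. cis (t * ln (real n))" "\<lambda>_. 1"] by simp

lemma osc_sum_interval: "osc_sum {M..<M+L} t = (\<Sum>n<L. cis (t * ln (real (M + n))))"
  unfolding osc_sum_def using sum.shift_bounds_nat_ivl[of "\<lambda>n. cis (t * ln (real n))" 0 M L]
  by (simp add: atLeast0LessThan add.commute)

text \<open>
  For \<open>\<bar>t\<bar> \<le> M\<close> the phase \<open>t * ln n\<close> changes by less than one full turn between consecutive \<open>n\<close>,
  and by at least a constant times \<open>\<bar>t\<bar> / M\<close>.
\<close>
lemma osc_sum_first_derivative:
  assumes M: "1 \<le> M" and L: "L \<le> 3 * M" and t: "1 \<le> \<bar>t\<bar>" "\<bar>t\<bar> \<le> M"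
  shows "norm (osc_sum {M..<M+L} t) \<le> 40 * real M / \<bar>t\<bar>"
proof -
  define s where "s = \<bar>t\<bar>"
  define f where "f = (\<lambda>n. - s * ln (real (M + n)))"
  have s: "1 \<le> s" "s \<le> M" using t by (auto simp: s_def)
  have diff: "f (Suc n) - f n = - s * ln (1 + 1 / (real M + n))" for n
  proof -
    have "1 + 1 / (real M + n) = real (M + Suc n) / real (M + n)"
      using M by (simp add: field_simps)
    then show ?thesis using M unfolding f_def by (simp add: ln_div algebra_simps)
  qed
  \<comment> \<open>The sign in \<open>f\<close> makes the differences increase; they lie in \<open>[-1, 0)\<close>, so \<open>z = -1\<close>.\<close>
  have "norm (\<Sum>n\<in>{0..<L}. cis (f n)) \<le> 8 / (s / (5 * M))"
  proof (rule kusmin_landau[where z = "-1"])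
    show "0 < s / (5 * M)" using s M by simp
  next
    fix n assume n: "0 \<le> n" "n < L"
    let ?x = "1 / (real M + n)"
    have "ln (1 + ?x) \<le> ?x" by (intro ln_add_one_self_le_self) auto
    also have "\<dots> \<le> 1 / M" using M by (intro divide_left_mono) auto
    finally have "s * ln (1 + ?x) \<le> M * (1 / M)" using s M by (intro mult_mono) auto
    then have 1: "s * ln (1 + ?x) \<le> 1" using M by simp
    have "s / (5 * M) \<le> (1 / 5)" using s M by (simp add: field_simps)
    then show "s / (5 * M) \<le> f (Suc n) - f n - 2 * pi * real_of_int (-1)"
      unfolding diff using 1 pi_ge_two by simp
    have "?x / (1 + ?x) \<le> ln (1 + ?x)"
    proof -
      have "ln (1 / (1 + ?x)) \<le> 1 / (1 + ?x) - 1" using M by (intro ln_le_minus_one) (auto simp: add_pos_nonneg)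
      moreover have "ln (1 / (1 + ?x)) = - ln (1 + ?x)" using M by (simp add: ln_div add_pos_nonneg)
      moreover have "1 / (1 + ?x) - 1 = - (?x / (1 + ?x))" using M by (simp add: field_simps add_pos_nonneg)
      ultimately show ?thesis by linarith
    qed
    moreover have "1 / (5 * M) \<le> ?x / (1 + ?x)"
    proof -
      have "?x / (1 + ?x) = 1 / (real M + n + 1)" using M by (simp add: field_simps)
      moreover have "1 / (5 * real M) \<le> 1 / (real M + n + 1)"
        using M L n by (intro divide_left_mono) auto
      ultimately show ?thesis by simp
    qed
    ultimately have "s * (1 / (5 * M)) \<le> s * ln (1 + ?x)"
      using s by (intro mult_left_mono) auto
    then show "f (Suc n) - f n - 2 * pi * real_of_int (-1) \<le> 2 * pi - s / (5 * M)"
      unfolding diff by simp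
  next
    fix n
    have "ln (1 + 1 / (real M + Suc n)) \<le> ln (1 + 1 / (real M + n))"
      using M by (subst ln_le_cancel_iff) (auto intro!: divide_left_mono add_pos_nonneg)
    then show "f (Suc n) - f n \<le> f (Suc (Suc n)) - f (Suc n)"
      unfolding diff using s by simp
  qed
  also have "(\<Sum>n\<in>{0..<L}. cis (f n)) = osc_sum {M..<M+L} (- s)"
    by (simp add: osc_sum_interval f_def atLeast0LessThan)
  also have "norm \<dots> = norm (osc_sum {M..<M+L} t)"
    by (simp add: osc_sum_uminus s_def norm_osc_sum_abs)
  finally show ?thesis by (simp add: s_def)
qed

lemma osc_sum_second_derivative:
  assumes M: "1 \<le> M" and L: "L \<le> 3 * M" and t: "M \<le> \<bar>t\<bar>" "\<bar>t\<bar> \<le> real M ^ 2"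
  shows "norm (osc_sum {M..<M+L} t) \<le> 240 * sqrt \<bar>t\<bar>"
proof -
  \<comment> \<open>The sign in \<open>f\<close> makes the second differences positive.\<close>
  define s where "s = \<bar>t\<bar>"
  define f where "f = (\<lambda>n. - s * ln (real (M + n)))"
  define \<mu> where "\<mu> = s / (16 * real M ^ 2)"
  have s: "M \<le> s" "s \<le> real M ^ 2" "0 < s" using t M by (auto simp: s_def)
  have diff: "(f (n + 2) - f (n + 1)) - (f (n + 1) - f n) = s * ln (1 + 1 / ((real M + n) * (real M + n + 2)))" for n
  proof -
    define x where "x = real M + real n"
    have x: "x \<ge> 1" using M by (simp add: x_def)
    have x0: "x \<noteq> 0" "x + 2 \<noteq> 0" using x by auto
    have "((x + 1) / x) * ((x + 1) / (x + 2)) = (x * (x + 2) + 1) / (x * (x + 2))"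
      using x0 by (simp add: algebra_simps)
    also have "\<dots> = 1 + 1 / (x * (x + 2))" using x0 by (simp add: add_divide_distrib)
    finally have eq: "1 + 1 / (x * (x + 2)) = ((x + 1) / x) * ((x + 1) / (x + 2))" by simp
    have "ln (1 + 1 / (x * (x + 2))) = 2 * ln (x + 1) - ln x - ln (x + 2)"
      unfolding eq using x by (simp add: ln_div ln_mult)
    then have "s * ln (1 + 1 / (x * (x + 2))) = s * (2 * ln (x + 1) - ln x - ln (x + 2))"
      by simp
    then show ?thesis unfolding f_def x_def by (simp add: algebra_simps)
  qed
  have "norm (\<Sum>n<L. cis (f n)) \<le> 12 * (16 * \<mu> * L + 2) / sqrt \<mu>"
  proof (rule second_difference_test)
    show "0 < \<mu>" using s M by (simp add: \<mu>_def)
    show "\<mu> \<le> 1" using s M by (simp add: \<mu>_def field_simps)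
  next
    fix n assume n: "n < L"
    define x where "x = real M + real n"
    have x: "x \<ge> M" "x \<ge> 1" "x + 1 \<le> 4 * M" using M n L unfolding x_def by linarith+
    define y where "y = 1 / (x * (x + 2))"
    have y: "y > 0" using x by (simp add: y_def)
    have "ln (1 / (1 + y)) \<le> 1 / (1 + y) - 1" using y by (intro ln_le_minus_one) auto
    moreover have "ln (1 / (1 + y)) = - ln (1 + y)" using y by (simp add: ln_div)
    moreover have "1 / (1 + y) - 1 = - (1 / (x + 1) ^ 2)"
    proof -
      have x0: "x \<noteq> 0" "x + 2 \<noteq> 0" using x by auto
      have "(x + 1)^2 = x * (x + 2) + 1" by (simp add: power2_eq_square algebra_simps)
      then have "1 + y = (x + 1)^2 / (x * (x + 2))" using x0 by (simp add: y_def add_divide_distrib)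
      then have "1 / (1 + y) = x * (x + 2) / (x + 1)^2" by simp
      also have "\<dots> = ((x + 1)^2 - 1) / (x + 1)^2" by (simp add: power2_eq_square algebra_simps)
      also have "\<dots> = 1 - 1 / (x + 1)^2" using x by (simp add: diff_divide_distrib)
      finally show ?thesis by simp
    qed
    ultimately have "1 / (x + 1) ^ 2 \<le> ln (1 + y)" by linarith
    moreover have "1 / (4 * real M) ^ 2 \<le> 1 / (x + 1) ^ 2"
      using x M by (intro divide_left_mono power_mono) auto
    ultimately have "s * (1 / (4 * real M) ^ 2) \<le> s * ln (1 + y)" using s by (intro mult_left_mono) auto
    then show "\<mu> \<le> (f (n + 2) - f (n + 1)) - (f (n + 1) - f n)"
      unfolding diff by (simp add: \<mu>_def y_def x_def power_mult_distrib)
    have "ln (1 + y) \<le> y" using y by (intro ln_add_one_self_le_self) auto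
    also have "y \<le> 1 / (real M) ^ 2"
      unfolding y_def power2_eq_square using x M by (intro divide_left_mono mult_mono) auto
    finally have "s * ln (1 + y) \<le> s * (1 / (real M) ^ 2)" using s by (intro mult_left_mono) auto
    then show "(f (n + 2) - f (n + 1)) - (f (n + 1) - f n) \<le> 16 * \<mu>"
      unfolding diff by (simp add: \<mu>_def y_def x_def)
  qed
  also have "\<dots> \<le> 12 * (5 * s / M) / sqrt \<mu>"
  proof -
    have "16 * \<mu> * L \<le> 16 * \<mu> * (3 * M)"
      using L s M by (intro mult_left_mono) (auto simp: \<mu>_def)
    also have "\<dots> = 3 * s / M" using M by (simp add: \<mu>_def power2_eq_square)
    finally have "16 * \<mu> * L + 2 \<le> 3 * s / M + 2 * (s / M)" using s M by (simp add: field_simps)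
    then show ?thesis using s by (intro divide_right_mono mult_left_mono) (auto simp: \<mu>_def)
  qed
  also have "sqrt \<mu> = sqrt s / (4 * M)"
    using M by (simp add: \<mu>_def real_sqrt_divide real_sqrt_mult)
  also have "12 * (5 * s / M) / (sqrt s / (4 * M)) = 240 * (s / sqrt s)"
    using M s by (simp add: field_simps)
  also have "s / sqrt s = sqrt s" using s by (simp add: real_div_sqrt)
  also have "(\<Sum>n<L. cis (f n)) = osc_sum {M..<M+L} (- s)"
    by (simp add: osc_sum_interval f_def)
  also have "norm \<dots> = norm (osc_sum {M..<M+L} t)"
    by (simp add: osc_sum_uminus s_def norm_osc_sum_abs)
  finally show ?thesis by (simp add: s_def)
qed

text \<open>
  This is the only input on correlations that the Halasz--Montgomery method needs. The second term
  comes from the second difference of the phase, which is about \<open>\<bar>t\<bar> / M ^ 2\<close>.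
\<close>
lemma osc_sum_zeta_bound:
  assumes M: "1 \<le> M" and t: "1 \<le> \<bar>t\<bar>" "\<bar>t\<bar> \<le> real M ^ 2"
  shows "norm (osc_sum {M..3*M} t) \<le> 240 * (M / \<bar>t\<bar> + sqrt \<bar>t\<bar>)"
proof -
  have eq: "{M..3*M} = {M..<M + (2 * M + 1)}" by auto
  have L: "2 * M + 1 \<le> 3 * M" using M by simp
  show ?thesis
  proof (cases "\<bar>t\<bar> \<le> M")
    case True
    have "norm (osc_sum {M..3*M} t) \<le> 40 * real M / \<bar>t\<bar>"
      unfolding eq by (rule osc_sum_first_derivative[OF M L t(1) True])
    also have "\<dots> \<le> 240 * (M / \<bar>t\<bar>)" by (simp add: divide_right_mono)
    finally show ?thesis by (smt (verit) real_sqrt_ge_zero)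
  next
    case False
    have "norm (osc_sum {M..3*M} t) \<le> 240 * sqrt \<bar>t\<bar>"
      unfolding eq using False by (intro osc_sum_second_derivative[OF M L _ t(2)]) auto
    also have "\<dots> \<le> 240 * (M / \<bar>t\<bar> + sqrt \<bar>t\<bar>)" by (intro mult_left_mono) auto
    finally show ?thesis .
  qed
qed

text \<open>
  Iterating the mean value theorem expresses a \<open>d\<close>-th difference through a \<open>d\<close>-th derivative.
\<close>
lemma fdiff_iter_MVT:
  assumes "\<And>i x. i < d \<Longrightarrow> a \<le> x \<Longrightarrow> (G i has_real_derivative G (Suc i) x) (at x)"
  shows "\<exists>\<xi>. a + n \<le> \<xi> \<and> \<xi> \<le> a + n + d \<and> (fdiff ^^ d) (\<lambda>n. G 0 (a + real n)) n = G d \<xi>"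
  using assms
proof (induction d arbitrary: G)
  case 0
  then show ?case by (intro exI[of _ "a + n"]) auto
next
  case (Suc d)
  define K where "K = (\<lambda>i x. G i (x + 1) - G i x)"
  have "(K i has_real_derivative K (Suc i) x) (at x)" if "i < d" "a \<le> x" for i x
  proof -
    have "(G i has_real_derivative G (Suc i) x) (at x)"
      "(G i has_real_derivative G (Suc i) (x + 1)) (at (x + 1))"
      using Suc.prems[of i x] Suc.prems[of i "x + 1"] that by auto
    then show ?thesis unfolding K_def
      by (intro DERIV_diff DERIV_shift[THEN iffD1])
  qed
  from Suc.IH[of K, OF this] obtain \<eta> where \<eta>: "a + n \<le> \<eta>" "\<eta> \<le> a + n + d"
    "(fdiff ^^ d) (\<lambda>n. K 0 (a + real n)) n = K d \<eta>" by blast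
  have "\<And>x. \<eta> \<le> x \<Longrightarrow> (G d has_real_derivative G (Suc d) x) (at x)"
    using Suc.prems[of d] \<eta> by (smt (verit) lessI of_nat_0_le_iff)
  then obtain \<xi> where \<xi>: "\<eta> < \<xi>" "\<xi> < \<eta> + 1" "G d (\<eta> + 1) - G d \<eta> = (\<eta> + 1 - \<eta>) * G (Suc d) \<xi>"
    using MVT2[of \<eta> "\<eta> + 1" "G d" "G (Suc d)"] by auto
  have "(fdiff ^^ Suc d) (\<lambda>n. G 0 (a + real n)) n = (fdiff ^^ d) (\<lambda>n. K 0 (a + real n)) n"
    unfolding funpow_Suc_right o_apply fdiff_def[abs_def] K_def by (simp add: add_ac)
  then show ?case using \<eta> \<xi> by (intro exI[of _ \<xi>]) (auto simp: K_def)
qed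

lemma fdiff_iter_ln:
  assumes "d \<ge> 1" "a > 0"
  shows "\<exists>\<xi>. a + n \<le> \<xi> \<and> \<xi> \<le> a + n + d \<and>
    (fdiff ^^ d) (\<lambda>n. s * ln (a + real n)) n = s * (-1) ^ (d - 1) * fact (d - 1) / \<xi> ^ d"
proof -
  define G where "G = (\<lambda>i x. case i of 0 \<Rightarrow> s * ln x | Suc j \<Rightarrow> s * (-1) ^ j * fact j / x ^ Suc j)"
  have "(G i has_real_derivative G (Suc i) x) (at x)" if "a \<le> x" for i x
  proof (cases i)
    case 0
    then show ?thesis using that assms unfolding G_def
      by (auto intro!: derivative_eq_intros)
  next
    case (Suc j)
    have x: "x > 0" using that assms by simp
    have "((\<lambda>x. s * (-1) ^ j * fact j / x ^ Suc j) has_real_derivative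
        s * (-1) ^ Suc j * fact (Suc j) / x ^ Suc (Suc j)) (at x)"
      using x by (auto intro!: derivative_eq_intros simp: field_simps simp del: power_Suc)
         (simp add: field_simps)
    then show ?thesis by (simp add: G_def Suc)
  qed
  from fdiff_iter_MVT[of d a G n, OF this] obtain \<xi> where
    "a + n \<le> \<xi>" "\<xi> \<le> a + n + d" "(fdiff ^^ d) (\<lambda>n. G 0 (a + real n)) n = G d \<xi>" by blast
  then show ?thesis using assms by (intro exI[of _ \<xi>]) (cases d; auto simp: G_def)
qed

lemma eventually_powr_ge:
  assumes "a > 0"
  shows "eventually (\<lambda>N::nat. K \<le> real N powr a) sequentially"
proof -
  have "filterlim (\<lambda>N::nat. real N powr a) at_top sequentially" using assms by real_asymp
  then show ?thesis by (simp add: filterlim_at_top)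
qed

text \<open>
  The \<open>d\<close>-th difference of \<open>t * ln n\<close> is about \<open>\<bar>t\<bar> / N ^ d\<close>, hence between
  \<open>N powr (- 3 / 2)\<close> and \<open>N powr (- 1 / 2)\<close> up to constants. Using \<open>weyl_bound\<close> with \<open>\<alpha> = 1 / 4\<close> instead of
  \<open>1 / 2\<close> leaves room for these constants.
\<close>
lemma osc_sum_weyl_single:
  fixes d :: nat
  assumes d: "2 \<le> d"
  shows "\<exists>c>0. eventually (\<lambda>N. \<forall>L t. L \<le> N \<longrightarrow> real N powr (d - 3 / 2) \<le> \<bar>t\<bar> \<longrightarrow>
     \<bar>t\<bar> \<le> real N powr (d - 1 / 2) \<longrightarrow> norm (osc_sum {N..<N+L} t) \<le> real N powr (1 - c)) sequentially"
proof -
  define h where "h = (2 + real d) ^ d"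
  have h1: "h \<ge> 1" unfolding h_def by (rule one_le_power) simp
  define K where "K = fact (d - 1) / h"
  have K: "K > 0" using h1 by (simp add: K_def)
  obtain c C where c: "c > 0" and C: "C \<ge> 0" and W: "\<And>N \<mu> f L. N \<ge> 1 \<Longrightarrow>
     N powr (1 / 4 - 2) \<le> \<mu> \<Longrightarrow> \<mu> \<le> N powr (- (1 / 4)) \<Longrightarrow> real L \<le> N \<Longrightarrow>
     (\<And>n. n < L \<Longrightarrow> \<mu> \<le> (fdiff ^^ d) f n \<and> (fdiff ^^ d) f n \<le> h * \<mu>) \<Longrightarrow>
     norm (\<Sum>n<L. cis (f n)) \<le> C * N powr (1 - c)"
    using weyl_bound[OF d, of "1/4" h] h1 by auto
  have e1: "eventually (\<lambda>N::nat. max K (1 / K) \<le> real N powr (1 / 4)) sequentially"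
    and e2: "eventually (\<lambda>N::nat. C \<le> real N powr (c / 2)) sequentially"
    using c by (auto intro!: eventually_powr_ge simp del: max.bounded_iff)
  have "eventually (\<lambda>N. \<forall>L t. L \<le> N \<longrightarrow> real N powr (d - 3 / 2) \<le> \<bar>t\<bar> \<longrightarrow>
     \<bar>t\<bar> \<le> real N powr (d - 1 / 2) \<longrightarrow> norm (osc_sum {N..<N+L} t) \<le> real N powr (1 - c / 2)) sequentially"
    using e1 e2 eventually_ge_at_top[of 1]
  proof eventually_elim
    case (elim N)
    show ?case
    proof (intro allI impI)
      fix L t assume L: "L \<le> N" and t: "real N powr (d - 3 / 2) \<le> \<bar>t\<bar>" "\<bar>t\<bar> \<le> real N powr (d - 1 / 2)"
      have N: "real N \<ge> 1" using elim by simp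
      have dN: "d - 1 / 2 = real d + (- (1/2))" "d - 3 / 2 = real d + (- (3/2))" by auto
      have Nd: "real N powr (real d + x) = real N ^ d * real N powr x" for x
        using N by (simp add: powr_add powr_realpow)
      \<comment> \<open>The sign makes the \<open>d\<close>-th difference of \<open>s * ln n\<close> positive.\<close>
      define s where "s = \<bar>t\<bar> * (-1) ^ (d - 1)"
      define \<mu> where "\<mu> = \<bar>t\<bar> * K / real N ^ d"
      have "norm (\<Sum>n<L. cis (s * ln (real N + real n))) \<le> C * N powr (1 - c)"
      proof (rule W[where \<mu> = \<mu>])
        show "1 \<le> real N" by fact
        have "real N powr (1 / 4 - 2) = real N powr (- (1/4)) * real N powr (- (3 / 2))"
          by (simp add: powr_add[symmetric])
        also have "real N powr (- (1/4)) \<le> K"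
        proof -
          have "1 / K \<le> real N powr (1 / 4)" using elim by simp
          then have "1 / real N powr (1 / 4) \<le> K" using K N by (simp add: field_simps)
          then show ?thesis by (simp add: powr_minus_divide)
        qed
        also have "K * real N powr (- (3 / 2)) = real N powr (d - 3 / 2) * K / real N ^ d"
          unfolding dN Nd using N by simp
        also have "\<dots> \<le> \<mu>" unfolding \<mu>_def using t K by (intro divide_right_mono mult_right_mono) auto
        finally show "real N powr (1 / 4 - 2) \<le> \<mu>" by (simp add: mult_right_mono)
        have "\<mu> \<le> real N powr (d - 1 / 2) * K / real N ^ d"
          unfolding \<mu>_def using t K by (intro divide_right_mono mult_right_mono) auto
        also have "\<dots> = K * real N powr (- (1/2))" unfolding dN Nd using N by simp
        also have "\<dots> \<le> real N powr (1/4) * real N powr (- (1/2))"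
          using elim by (intro mult_right_mono) auto
        also have "\<dots> = real N powr (- (1/4))" by (simp add: powr_add[symmetric])
        finally show "\<mu> \<le> real N powr (- (1/4))" .
        show "real L \<le> real N" using L by simp
        fix n assume n: "n < L"
        obtain \<xi> where \<xi>: "real N + n \<le> \<xi>" "\<xi> \<le> real N + n + d"
          "(fdiff ^^ d) (\<lambda>n. s * ln (real N + real n)) n = s * (-1) ^ (d - 1) * fact (d - 1) / \<xi> ^ d"
          using fdiff_iter_ln[of d "real N" n s] d N by auto
        have "s * (-1) ^ (d - 1) = \<bar>t\<bar>" by (simp add: s_def power_mult_distrib[symmetric] mult.assoc)
        then have val: "(fdiff ^^ d) (\<lambda>n. s * ln (real N + real n)) n = \<bar>t\<bar> * fact (d - 1) / \<xi> ^ d"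
          using \<xi> by simp
        have \<xi>N: "real N \<le> \<xi>" using \<xi> by simp
        have "d \<le> d * real N" using N by (simp add: mult_le_cancel_left1)
        then have "\<xi> \<le> (2 + d) * real N" using \<xi> n L by (simp add: algebra_simps)
        then have "\<xi> ^ d \<le> h * real N ^ d"
          using power_mono[of \<xi> "(2 + d) * real N" d] \<xi>N N by (simp add: h_def power_mult_distrib)
        then have "\<bar>t\<bar> * fact (d - 1) / (h * real N ^ d) \<le> \<bar>t\<bar> * fact (d - 1) / \<xi> ^ d"
          using \<xi>N N h1 by (intro divide_left_mono mult_pos_pos zero_less_power) auto
        moreover have "\<bar>t\<bar> * fact (d - 1) / (h * real N ^ d) = \<mu>" by (simp add: \<mu>_def K_def)
        moreover have "\<bar>t\<bar> * fact (d - 1) / \<xi> ^ d \<le> \<bar>t\<bar> * fact (d - 1) / real N ^ d"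
          using \<xi>N N by (intro divide_left_mono power_mono mult_pos_pos zero_less_power) auto
        moreover have "\<bar>t\<bar> * fact (d - 1) / real N ^ d = h * \<mu>" using h1 by (simp add: \<mu>_def K_def)
        ultimately show "\<mu> \<le> (fdiff ^^ d) (\<lambda>n. s * ln (real N + real n)) n \<and>
          (fdiff ^^ d) (\<lambda>n. s * ln (real N + real n)) n \<le> h * \<mu>" unfolding val by simp
      qed
      also have "(\<Sum>n<L. cis (s * ln (real N + real n))) = osc_sum {N..<N+L} s"
        by (simp add: osc_sum_interval)
      also have "norm \<dots> = norm (osc_sum {N..<N+L} t)"
      proof -
        have "\<bar>s\<bar> = \<bar>t\<bar>" by (simp add: s_def abs_mult power_abs)
        then show ?thesis using norm_osc_sum_abs by metis
      qed
      also have "C * real N powr (1 - c) \<le> real N powr (c / 2) * real N powr (1 - c)"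
        using elim by (intro mult_right_mono) auto
      also have "\<dots> = real N powr (1 - c / 2)" by (simp add: powr_add[symmetric])
      finally show "norm (osc_sum {N..<N+L} t) \<le> real N powr (1 - c / 2)" .
    qed
  qed
  then show ?thesis using c by (intro exI[of _ "c / 2"]) auto
qed

text \<open>
  The ranges of \<open>osc_sum_weyl_single\<close> for consecutive \<open>d\<close> are adjacent, so finitely many of them cover
  \<open>N \<le> \<bar>t\<bar> \<le> N ^ Suc k\<close>.
\<close>
lemma osc_sum_weyl:
  shows "\<exists>c>0. c \<le> 1 \<and> eventually (\<lambda>N. \<forall>L t. L \<le> N \<longrightarrow> real N \<le> \<bar>t\<bar> \<longrightarrow>
     \<bar>t\<bar> \<le> real N ^ Suc k \<longrightarrow> norm (osc_sum {N..<N+L} t) \<le> real N powr (1 - c)) sequentially"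
proof (induction k)
  case 0
  obtain c where c: "c > 0" and ev: "eventually (\<lambda>N. \<forall>L t. L \<le> N \<longrightarrow> real N powr (2 - 3 / 2) \<le> \<bar>t\<bar> \<longrightarrow>
     \<bar>t\<bar> \<le> real N powr (2 - 1 / 2) \<longrightarrow> norm (osc_sum {N..<N+L} t) \<le> real N powr (1 - c)) sequentially"
    using osc_sum_weyl_single[of 2] by auto
  show ?case
  proof (intro exI[of _ "min c 1"] conjI)
    show "\<forall>\<^sub>F N in sequentially. \<forall>L t. L \<le> N \<longrightarrow> real N \<le> \<bar>t\<bar> \<longrightarrow> \<bar>t\<bar> \<le> real N ^ Suc 0 \<longrightarrow>
       norm (osc_sum {N..<N+L} t) \<le> real N powr (1 - min c 1)"
      using ev eventually_ge_at_top[of 1]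
    proof eventually_elim
      case (elim N)
      have N: "real N \<ge> 1" using elim by simp
      have 1: "real N powr (2 - 3 / 2) \<le> real N powr 1" "real N powr 1 \<le> real N powr (2 - 1/2)"
        "real N powr (1 - c) \<le> real N powr (1 - min c 1)"
        using N by (intro powr_mono; simp)+
      show ?case
      proof (intro allI impI)
        fix L t assume "L \<le> N" "real N \<le> \<bar>t\<bar>" "\<bar>t\<bar> \<le> real N ^ Suc 0"
        then have "norm (osc_sum {N..<N+L} t) \<le> real N powr (1 - c)" using elim 1 N by auto
        then show "norm (osc_sum {N..<N+L} t) \<le> real N powr (1 - min c 1)" using 1 by linarith
      qed
    qed
  qed (use c in auto)
next
  case (Suc k)
  obtain c1 where c1: "c1 > 0" "c1 \<le> 1" and ev1: "eventually (\<lambda>N. \<forall>L t. L \<le> N \<longrightarrow> real N \<le> \<bar>t\<bar> \<longrightarrow>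
     \<bar>t\<bar> \<le> real N ^ Suc k \<longrightarrow> norm (osc_sum {N..<N+L} t) \<le> real N powr (1 - c1)) sequentially"
    using Suc.IH by blast
  have single: "\<exists>c>0. eventually (\<lambda>N. \<forall>L t. L \<le> N \<longrightarrow> real N powr (real (k + e) - 3 / 2) \<le> \<bar>t\<bar> \<longrightarrow>
     \<bar>t\<bar> \<le> real N powr (real (k + e) - 1 / 2) \<longrightarrow> norm (osc_sum {N..<N+L} t) \<le> real N powr (1 - c)) sequentially"
    if "e \<ge> 2" for e using osc_sum_weyl_single[of "k + e"] that by simp
  obtain c2 where c2: "c2 > 0" and ev2: "eventually (\<lambda>N. \<forall>L t. L \<le> N \<longrightarrow> real N powr (real (k + 2) - 3 / 2) \<le> \<bar>t\<bar> \<longrightarrow>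
     \<bar>t\<bar> \<le> real N powr (real (k + 2) - 1 / 2) \<longrightarrow> norm (osc_sum {N..<N+L} t) \<le> real N powr (1 - c2)) sequentially"
    using single[of 2] by auto
  obtain c3 where c3: "c3 > 0" and ev3: "eventually (\<lambda>N. \<forall>L t. L \<le> N \<longrightarrow> real N powr (real (k + 3) - 3 / 2) \<le> \<bar>t\<bar> \<longrightarrow>
     \<bar>t\<bar> \<le> real N powr (real (k + 3) - 1 / 2) \<longrightarrow> norm (osc_sum {N..<N+L} t) \<le> real N powr (1 - c3)) sequentially"
    using single[of 3] by auto
  define c where "c = min c1 (min c2 c3)"
  have c: "c > 0" "c \<le> 1" "c \<le> c1" "c \<le> c2" "c \<le> c3" using c1 c2 c3 by (auto simp: c_def)
  show ?case
  proof (intro exI[of _ c] conjI)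
    show "\<forall>\<^sub>F N in sequentially. \<forall>L t. L \<le> N \<longrightarrow> real N \<le> \<bar>t\<bar> \<longrightarrow> \<bar>t\<bar> \<le> real N ^ Suc (Suc k) \<longrightarrow>
       norm (osc_sum {N..<N+L} t) \<le> real N powr (1 - c)"
      using ev1 ev2 ev3 eventually_ge_at_top[of 1]
    proof eventually_elim
      case (elim N)
      have N: "real N \<ge> 1" using elim by simp
      have mono: "real N powr x \<le> real N powr y" if "x \<le> y" for x y
        using N that by (intro powr_mono)
      show ?case
      proof (intro allI impI)
        fix L t assume L: "L \<le> N" and t: "real N \<le> \<bar>t\<bar>" "\<bar>t\<bar> \<le> real N ^ Suc (Suc k)"
        have pw: "real N ^ Suc k = real N powr (real k + 1)" "real N ^ Suc (Suc k) = real N powr (real k + 2)"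
          using N powr_realpow[of "real N" "Suc k"] powr_realpow[of "real N" "Suc (Suc k)"]
          by (simp_all add: add.commute)
        consider "\<bar>t\<bar> \<le> real N ^ Suc k"
          | "real N ^ Suc k \<le> \<bar>t\<bar>" "\<bar>t\<bar> \<le> real N powr (real (k + 2) - 1 / 2)"
          | "real N powr (real (k + 2) - 1 / 2) \<le> \<bar>t\<bar>" by linarith
        then show "norm (osc_sum {N..<N+L} t) \<le> real N powr (1 - c)"
        proof cases
          case 1
          then have "norm (osc_sum {N..<N+L} t) \<le> real N powr (1 - c1)" using elim L t by blast
          then show ?thesis using mono[of "1 - c1" "1 - c"] c by linarith
        next
          case 2
          have "real N powr (real (k + 2) - 3 / 2) \<le> real N ^ Suc k"
            unfolding pw by (intro mono) simp
          then have "norm (osc_sum {N..<N+L} t) \<le> real N powr (1 - c2)" using elim L 2 order_trans by blast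
          then show ?thesis using mono[of "1 - c2" "1 - c"] c by linarith
        next
          case 3
          have "real N ^ Suc (Suc k) \<le> real N powr (real (k + 3) - 1 / 2)"
            unfolding pw by (intro mono) simp
          moreover have "real N powr (real (k + 3) - 3 / 2) \<le> \<bar>t\<bar>" using 3 by simp
          ultimately have "norm (osc_sum {N..<N+L} t) \<le> real N powr (1 - c3)" using elim L t order_trans by blast
          then show ?thesis using mono[of "1 - c3" "1 - c"] c by linarith
        qed
      qed
    qed
  qed (use c in auto)
qed

section \<open>Representations as products\<close>

lemma card_divisors_mult_le:
  fixes a b :: nat
  assumes "a > 0" "b > 0"
  shows "card {d. d dvd a * b} \<le> card {d. d dvd a} * card {d. d dvd b}"
proof -
  have fin: "finite {d. d dvd a}" "finite {d. d dvd b}" using assms by auto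
  have "{d. d dvd a * b} \<subseteq> (\<lambda>(x, y). x * y) ` ({d. d dvd a} \<times> {d. d dvd b})"
  proof
    fix d assume "d \<in> {d. d dvd a * b}"
    then obtain x y where "d = x * y" "x dvd a" "y dvd b"
      using division_decomp[of d a b] by blast
    then show "d \<in> (\<lambda>(x, y). x * y) ` ({d. d dvd a} \<times> {d. d dvd b})" by force
  qed
  then have "card {d. d dvd a * b} \<le> card ((\<lambda>(x, y). x * y) ` ({d. d dvd a} \<times> {d. d dvd b}))"
    using fin by (intro card_mono) auto
  also have "\<dots> \<le> card ({d. d dvd a} \<times> {d. d dvd b})"
    using fin by (intro card_image_le) auto
  finally show ?thesis by (simp add: card_cartesian_product)
qed

text \<open>
  Each prime power \<open>p ^ a\<close> exactly dividing \<open>n\<close> contributes \<open>a + 1\<close> divisors. For primes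
  with \<open>p powr \<eta> \<ge> 2\<close> this is at most \<open>(p ^ a) powr \<eta>\<close>, and each of the boundedly many
  smaller primes costs only a constant factor.
\<close>
lemma divisor_bound:
  fixes \<eta> :: real
  assumes \<eta>: "\<eta> > 0"
  shows "\<exists>C\<ge>1. \<forall>n::nat. n > 0 \<longrightarrow> real (card {d. d dvd n}) \<le> C * real n powr \<eta>"
proof -
  define C0 where "C0 = max 1 (1 / (\<eta> * ln 2))"
  define K :: nat where "K = nat \<lceil>2 powr (1 / \<eta>)\<rceil>"
  define small where "small = (\<lambda>n. {p::nat. prime p \<and> p dvd n \<and> p < K})"
  have C01: "C0 \<ge> 1" by (simp add: C0_def)
  have "real (card {d. d dvd n}) \<le> C0 ^ card (small n) * real n powr \<eta>" if "n > 0" for n :: nat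
    using that
  proof (induction n rule: less_induct)
    case (less n)
    show ?case
    proof (cases "n = 1")
      case True
      have "small 1 = {}" by (auto simp: small_def)
      moreover have "{d::nat. d dvd 1} = {1}" by auto
      ultimately show ?thesis using True by simp
    next
      case False
      then obtain p where p: "prime p" "p dvd n" using prime_factor_nat by blast
      define a where "a = multiplicity p n"
      have p2: "p \<ge> 2" using p prime_ge_2_nat by blast
      obtain m where m: "n = p ^ a * m" "\<not> p dvd m"
        using multiplicity_decompose'[of n p] less.prems p unfolding a_def by (metis not_prime_unit gr_implies_not0)
      have a0: "a > 0" using m p by (metis gr0I mult_1 power_0)
      have m0: "m > 0" using m less.prems by (metis gr0I mult_0_right less_irrefl)
      have "p ^ a > 1" using p2 a0 by (intro one_less_power) auto
      then have mn: "m < n" using m m0 by simp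
      have IH: "real (card {d. d dvd m}) \<le> C0 ^ card (small m) * real m powr \<eta>"
        using less.IH[OF mn m0] .
      have "card {d. d dvd p ^ a} = a + 1"
      proof -
        have "{d. d dvd p ^ a} = (\<lambda>i. p ^ i) ` {0..a}"
          using p(1) divides_primepow_nat[of p _ a] by auto
        moreover have "inj_on (\<lambda>i. p ^ i) {0..a}"
          using p2 by (auto simp: inj_on_def)
        ultimately show ?thesis by (simp add: card_image)
      qed
      then have c1: "real (card {d. d dvd n}) \<le> (a + 1) * real (card {d. d dvd m})"
      proof -
        have "card {d. d dvd n} \<le> (a + 1) * card {d. d dvd m}"
          using card_divisors_mult_le[of "p ^ a" m] m0 p2 \<open>card {d. d dvd p ^ a} = a + 1\<close> m(1) by simp
        then have "real (card {d. d dvd n}) \<le> real ((a + 1) * card {d. d dvd m})" by (rule of_nat_mono)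
        then show ?thesis by (simp add: algebra_simps)
      qed
      have fin: "finite (small k)" for k unfolding small_def by simp
      have key: "(a + 1) * C0 ^ card (small m) \<le> C0 ^ card (small n) * real (p ^ a) powr \<eta>"
      proof (cases "p < K")
        case True
        have "insert p (small m) \<subseteq> small n" using True p m by (auto simp: small_def)
        then have "card (insert p (small m)) \<le> card (small n)" by (intro card_mono fin)
        moreover have "p \<notin> small m" using m by (simp add: small_def)
        ultimately have "Suc (card (small m)) \<le> card (small n)"
          using fin by simp
        then have C: "C0 * C0 ^ card (small m) \<le> C0 ^ card (small n)"
          using power_increasing[OF _ C01, of "Suc (card (small m))" "card (small n)"] by simp
        have "real (a + 1) \<le> C0 * (1 + a * \<eta> * ln 2)"
        proof -
          have "1 / (\<eta> * ln 2) \<le> C0" by (simp add: C0_def)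
          then have "1 \<le> C0 * (\<eta> * ln 2)" using \<eta> by (simp add: field_simps)
          then have "real a * 1 \<le> a * (C0 * (\<eta> * ln 2))" by (intro mult_left_mono) auto
          then show ?thesis using C01 by (simp add: algebra_simps)
        qed
        also have "1 + a * \<eta> * ln 2 \<le> exp (a * \<eta> * ln 2)" by (rule exp_ge_add_one_self)
        also have "exp (a * \<eta> * ln 2) = (2 powr a) powr \<eta>" by (simp add: powr_def mult_ac)
        also have "\<dots> \<le> real (p ^ a) powr \<eta>"
          using p2 \<eta> by (intro powr_mono2) (auto simp: powr_realpow intro!: power_mono)
        finally have "real (a + 1) \<le> C0 * real (p ^ a) powr \<eta>" using C01 by simp
        then have "real (a + 1) * C0 ^ card (small m) \<le> C0 * real (p ^ a) powr \<eta> * C0 ^ card (small m)"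
          using C01 by (intro mult_right_mono) auto
        also have "\<dots> = C0 * C0 ^ card (small m) * real (p ^ a) powr \<eta>" by (simp add: mult_ac)
        also have "\<dots> \<le> C0 ^ card (small n) * real (p ^ a) powr \<eta>" using C by (rule mult_right_mono) simp
        finally show ?thesis .
      next
        case False
        have "small m \<subseteq> small n" using m by (auto simp: small_def)
        then have C: "C0 ^ card (small m) \<le> C0 ^ card (small n)"
          by (intro power_increasing card_mono fin C01)
        have "2 powr (1 / \<eta>) \<le> real p" using False unfolding K_def by linarith
        then have "(2 powr (1 / \<eta>)) powr \<eta> \<le> real p powr \<eta>" using \<eta> by (intro powr_mono2) auto
        then have "2 \<le> real p powr \<eta>" using \<eta> by (simp add: powr_powr)
        then have "2 ^ a \<le> (real p powr \<eta>) ^ a" by (intro power_mono) auto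
        also have "\<dots> = real (p ^ a) powr \<eta>"
          using p2 by (simp add: powr_power powr_realpow[symmetric] powr_powr mult.commute)
        finally have "2 ^ a \<le> real (p ^ a) powr \<eta>" .
        then have "real (a + 1) \<le> real (p ^ a) powr \<eta>"
        proof -
          have "a + 1 \<le> 2 ^ a" by (induction a) auto
          then have "real (a + 1) \<le> real (2 ^ a)" by (rule of_nat_mono)
          then show ?thesis using \<open>2 ^ a \<le> real (p ^ a) powr \<eta>\<close> by simp
        qed
        then have "real (a + 1) * C0 ^ card (small m) \<le> real (p ^ a) powr \<eta> * C0 ^ card (small n)"
          using C C01 by (intro mult_mono) auto
        then show ?thesis by (simp only: mult.commute)
      qed
      have "real (card {d. d dvd n}) \<le> (a + 1) * (C0 ^ card (small m) * real m powr \<eta>)"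
        using c1 IH by (meson mult_left_mono of_nat_0_le_iff order_trans)
      also have "\<dots> = ((a + 1) * C0 ^ card (small m)) * real m powr \<eta>" by simp
      also have "\<dots> \<le> (C0 ^ card (small n) * real (p ^ a) powr \<eta>) * real m powr \<eta>"
        using key by (rule mult_right_mono) simp
      also have "\<dots> = C0 ^ card (small n) * real n powr \<eta>"
        using m by (simp add: powr_mult mult.assoc)
      finally show ?thesis .
    qed
  qed
  moreover have "C0 ^ card (small n) \<le> C0 ^ K" for n
  proof -
    have "card (small n) \<le> card {..<K}" by (intro card_mono) (auto simp: small_def)
    then show ?thesis using C01 by (intro power_increasing) auto
  qed
  ultimately have "real (card {d. d dvd n}) \<le> C0 ^ K * real n powr \<eta>" if "n > 0" for n :: nat
    using that by (meson mult_right_mono order_trans powr_ge_zero)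
  then show ?thesis using C01 by (intro exI[of _ "C0 ^ K"]) (auto intro: one_le_power)
qed

definition words :: "'a set \<Rightarrow> nat \<Rightarrow> 'a list set" where
  "words A j = {xs. set xs \<subseteq> A \<and> length xs = j}"

text \<open>Number of ways to write \<open>m\<close> as an ordered product of \<open>j\<close> elements of \<open>A\<close>.\<close>
definition reps :: "nat set \<Rightarrow> nat \<Rightarrow> nat \<Rightarrow> nat" where
  "reps A j m = card {xs \<in> words A j. prod_list xs = m}"

definition prods :: "nat set \<Rightarrow> nat \<Rightarrow> nat set" where
  "prods A j = prod_list ` words A j"

lemma finite_words: "finite A \<Longrightarrow> finite (words A j)"
  unfolding words_def by (rule finite_lists_length_eq)

lemma finite_prods: "finite A \<Longrightarrow> finite (prods A j)"
  by (simp add: prods_def finite_words)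

lemma words_0: "words A 0 = {[]}"
  by (auto simp: words_def)

lemma sum_words_Suc:
  assumes "finite A"
  shows "(\<Sum>xs\<in>words A (Suc j). g xs) = (\<Sum>a\<in>A. \<Sum>xs\<in>words A j. g (a # xs))"
proof -
  have "words A (Suc j) = (\<lambda>(a, xs). a # xs) ` (A \<times> words A j)"
    unfolding words_def by (auto simp: length_Suc_conv image_iff)
  moreover have "inj_on (\<lambda>(a, xs). a # xs) (A \<times> words A j)" by (auto simp: inj_on_def)
  ultimately have "(\<Sum>xs\<in>words A (Suc j). g xs) = (\<Sum>(a, xs)\<in>A \<times> words A j. g (a # xs))"
    by (simp add: sum.reindex case_prod_unfold)
  then show ?thesis by (simp add: sum.cartesian_product)
qed

lemma sum_words_eq_sum_reps:
  fixes g :: "nat \<Rightarrow> 'b::{comm_ring_1}"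
  assumes "finite A"
  shows "(\<Sum>xs\<in>words A j. g (prod_list xs)) = (\<Sum>m\<in>prods A j. of_nat (reps A j m) * g m)"
proof -
  have "(\<Sum>xs\<in>words A j. g (prod_list xs))
    = (\<Sum>m\<in>prods A j. \<Sum>xs | xs \<in> words A j \<and> prod_list xs = m. g (prod_list xs))"
    unfolding prods_def by (rule sum.image_gen[OF finite_words[OF assms]])
  also have "\<dots> = (\<Sum>m\<in>prods A j. of_nat (reps A j m) * g m)"
    by (intro sum.cong refl) (simp add: reps_def)
  finally show ?thesis .
qed

lemma prod_list_pos: "set xs \<subseteq> A \<Longrightarrow> 0 \<notin> A \<Longrightarrow> 0 < prod_list (xs :: nat list)"
proof (induction xs)
  case (Cons a xs)
  then have "a \<noteq> 0" by (metis list.set_intros(1) subsetD)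
  then show ?case using Cons by simp
qed simp

lemma osc_sum_power_words:
  assumes "finite A" "0 \<notin> A"
  shows "osc_sum A t ^ j = (\<Sum>xs\<in>words A j. cis (t * ln (real (prod_list xs))))"
proof (induction j)
  case (Suc j)
  have "(\<Sum>xs\<in>words A (Suc j). cis (t * ln (real (prod_list xs))))
     = (\<Sum>a\<in>A. \<Sum>xs\<in>words A j. cis (t * ln (real a)) * cis (t * ln (real (prod_list xs))))"
    unfolding sum_words_Suc[OF assms(1)]
  proof (intro sum.cong refl)
    fix a xs assume a: "a \<in> A" "xs \<in> words A j"
    have "a \<noteq> 0" using a assms by metis
    moreover have "0 < prod_list xs" using a assms prod_list_pos[of xs A] by (simp add: words_def)
    ultimately have "0 < a" "0 < prod_list xs" by auto
    then show "cis (t * ln (real (prod_list (a # xs)))) = cis (t * ln (real a)) * cis (t * ln (real (prod_list xs)))"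
      by (simp add: cis_mult ln_mult algebra_simps)
  qed
  then show ?case
    by (simp add: Suc sum_distrib_left[symmetric]) (simp add: osc_sum_def sum_distrib_right)
qed (simp add: words_0)

lemma osc_sum_power:
  assumes "finite A" "0 \<notin> A"
  shows "osc_sum A t ^ j = (\<Sum>m\<in>prods A j. of_nat (reps A j m) * cis (t * ln (real m)))"
  unfolding osc_sum_power_words[OF assms] by (rule sum_words_eq_sum_reps[OF assms(1)])

lemma prods_bounds:
  assumes "m \<in> prods {a..b} j"
  shows "a ^ j \<le> m" "m \<le> b ^ j"
proof -
  have "a ^ length xs \<le> prod_list xs \<and> prod_list xs \<le> b ^ length xs" if "set xs \<subseteq> {a..b}" for xs
    using that by (induction xs) (auto intro!: mult_le_mono)
  then show "a ^ j \<le> m" "m \<le> b ^ j" using assms by (auto simp: prods_def words_def)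
qed

lemma reps_le_divisors:
  assumes "m > 0"
  shows "reps A j m \<le> card {d. d dvd m} ^ j"
proof -
  have fin: "finite {d. d dvd m}" using assms by simp
  have "{xs \<in> words A j. prod_list xs = m} \<subseteq> {xs. set xs \<subseteq> {d. d dvd m} \<and> length xs = j}"
    by (auto simp: words_def intro: prod_list_dvd)
  then have "reps A j m \<le> card {xs. set xs \<subseteq> {d. d dvd m} \<and> length xs = j}"
    unfolding reps_def by (intro card_mono finite_lists_length_eq fin)
  also have "\<dots> = card {d. d dvd m} ^ j" by (rule card_lists_length_eq[OF fin])
  finally show ?thesis .
qed

text \<open>
  The relative length \<open>1 / k\<close> keeps products of at most \<open>k\<close> elements within a factor \<open>3\<close> of each other.
\<close>
definition block :: "nat \<Rightarrow> nat \<Rightarrow> nat set" where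
  "block k N = {N..N + N div k}"

lemma finite_block [simp]: "finite (block k N)"
  by (simp add: block_def)

lemma block_upper_power:
  assumes "k \<ge> 1" "j \<le> k"
  shows "(N + N div k) ^ j \<le> 3 * N ^ j"
proof -
  have "real (N + N div k) \<le> real N * (1 + 1 / k)"
  proof -
    have "real (N div k) \<le> real N / k" by (rule of_nat_div_le_of_nat)
    then show ?thesis by (simp add: algebra_simps)
  qed
  also have "\<dots> \<le> real N * exp (1 / k)"
    by (intro mult_left_mono exp_ge_add_one_self) auto
  finally have "real (N + N div k) ^ j \<le> (real N * exp (1 / k)) ^ j"
    by (intro power_mono) auto
  also have "\<dots> = real N ^ j * exp (j / k)"
    by (simp add: power_mult_distrib exp_of_nat_mult[symmetric])
  also have "\<dots> \<le> real N ^ j * exp 1"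
    using assms by (intro mult_left_mono) auto
  also have "\<dots> \<le> real N ^ j * 3"
    using exp_le by (intro mult_left_mono) auto
  finally have "real ((N + N div k) ^ j) \<le> real (3 * N ^ j)" by simp
  then show ?thesis by (simp only: of_nat_le_iff)
qed

lemma prods_block:
  assumes "k \<ge> 1" "j \<le> k"
  shows "prods (block k N) j \<subseteq> {N ^ j..3 * N ^ j}"
  using prods_bounds[of _ N "N + N div k" j] block_upper_power[OF assms, of N]
  unfolding block_def by fastforce

text \<open>
  The factors of a representation of \<open>m\<close> are divisors of \<open>m\<close>, so that \<open>divisor_bound\<close> with an exponent
  of order \<open>\<kappa> / k ^ 2\<close> applies.
\<close>
lemma reps_block_bound:
  assumes k: "k \<ge> 1" and \<kappa>: "\<kappa> > 0"
  shows "eventually (\<lambda>N. \<forall>j\<le>k. \<forall>m\<in>prods (block k N) j. real (reps (block k N) j m) \<le> real N powr \<kappa>) sequentially"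
proof -
  define \<eta> where "\<eta> = \<kappa> / (2 * real k ^ 2)"
  have \<eta>: "\<eta> > 0" using k \<kappa> by (simp add: \<eta>_def)
  obtain C where C: "C \<ge> 1" "\<And>n::nat. n > 0 \<Longrightarrow> real (card {d. d dvd n}) \<le> C * real n powr \<eta>"
    using divisor_bound[OF \<eta>] by blast
  define E where "E = (C * 3 powr \<eta>) ^ k"
  have "eventually (\<lambda>N::nat. E \<le> real N powr (\<kappa> / 2)) sequentially"
    using \<kappa> by (intro eventually_powr_ge) auto
  then show ?thesis using eventually_ge_at_top[of 1]
  proof eventually_elim
    case (elim N)
    show ?case
    proof (intro allI impI ballI)
      fix j m assume j: "j \<le> k" and m: "m \<in> prods (block k N) j"
      have N: "real N \<ge> 1" using elim by simp
      have mb: "N ^ j \<le> m" "m \<le> 3 * N ^ j" using prods_block[OF k j, of N] m by auto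
      have m0: "m > 0" using mb elim by (metis One_nat_def Suc_le_eq less_le_trans zero_less_power)
      have "real m \<le> 3 * real N ^ k"
      proof -
        have "real m \<le> 3 * real N ^ j" using mb(2) by (metis of_nat_le_iff of_nat_mult of_nat_numeral of_nat_power)
        also have "\<dots> \<le> 3 * real N ^ k" using N j by (intro mult_left_mono power_increasing) auto
        finally show ?thesis .
      qed
      then have "real m powr \<eta> \<le> (3 * real N ^ k) powr \<eta>" using \<eta> by (intro powr_mono2) auto
      also have "\<dots> = 3 powr \<eta> * real N powr (k * \<eta>)"
        using N by (simp add: powr_mult powr_realpow[symmetric] powr_powr)
      finally have "C * real m powr \<eta> \<le> C * (3 powr \<eta> * real N powr (k * \<eta>))"
        using C by (intro mult_left_mono) auto
      then have d: "real (card {d. d dvd m}) \<le> C * 3 powr \<eta> * real N powr (k * \<eta>)"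
        using C(2)[OF m0] by (simp add: mult.assoc)
      have "real (reps (block k N) j m) \<le> real (card {d. d dvd m}) ^ j"
        using reps_le_divisors[OF m0, of "block k N" j] by (metis of_nat_le_iff of_nat_power)
      also have "\<dots> \<le> real (card {d. d dvd m}) ^ k"
      proof (rule power_increasing[OF j])
        have "card {d. d dvd m} \<ge> card {m}" using m0 by (intro card_mono) auto
        then show "1 \<le> real (card {d. d dvd m})" by simp
      qed
      also have "\<dots> \<le> (C * 3 powr \<eta> * real N powr (k * \<eta>)) ^ k"
        using d by (intro power_mono) auto
      also have "\<dots> = E * real N powr (k * \<eta> * k)"
        using N by (simp add: E_def power_mult_distrib powr_power mult_ac)
      also have "k * \<eta> * k = \<kappa> / 2" using k by (simp add: \<eta>_def power2_eq_square)
      also have "E * real N powr (\<kappa> / 2) \<le> real N powr (\<kappa> / 2) * real N powr (\<kappa> / 2)"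
        using elim by (intro mult_right_mono) auto
      also have "\<dots> = real N powr \<kappa>" by (simp add: powr_add[symmetric])
      finally show "real (reps (block k N) j m) \<le> real N powr \<kappa>" .
    qed
  qed
qed

section \<open>The Fejer kernel and the mean value estimate\<close>

text \<open>
  A difference \<open>t\<close> arises from \<open>J - \<bar>t\<bar>\<close> pairs.
\<close>
lemma sum_differences:
  fixes g :: "int \<Rightarrow> complex"
  shows "(\<Sum>a<J. \<Sum>b<J. g (int a - int b)) = (\<Sum>t\<in>{- int J..int J}. of_int (int J - \<bar>t\<bar>) * g t)"
proof (induction J)
  case (Suc J)
  have up: "(\<Sum>b<J. g (int J - int b)) = (\<Sum>t\<in>{1..int J}. g t)"
    by (rule sum.reindex_bij_witness[of _ "\<lambda>t. nat (int J - t)" "\<lambda>b. int J - int b"]) auto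
  have dn: "(\<Sum>a<J. g (int a - int J)) = (\<Sum>t\<in>{- int J..-1}. g t)"
    by (rule sum.reindex_bij_witness[of _ "\<lambda>t. nat (int J + t)" "\<lambda>b. int b - int J"]) auto
  have split: "{- int J..int J} = insert 0 ({- int J..-1} \<union> {1..int J})" by auto
  have "(\<Sum>a<Suc J. \<Sum>b<Suc J. g (int a - int b))
     = (\<Sum>a<J. \<Sum>b<J. g (int a - int b)) + ((\<Sum>t\<in>{- int J..-1}. g t) + (\<Sum>t\<in>{1..int J}. g t) + g 0)"
    by (simp add: sum.distrib up dn add_ac)
  also have "(\<Sum>t\<in>{- int J..-1}. g t) + (\<Sum>t\<in>{1..int J}. g t) + g 0 = (\<Sum>t\<in>{- int J..int J}. g t)"
    unfolding split by (subst sum.insert, simp, simp, subst sum.union_disjoint) auto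
  finally have "(\<Sum>a<Suc J. \<Sum>b<Suc J. g (int a - int b))
     = (\<Sum>t\<in>{- int J..int J}. of_int (int (Suc J) - \<bar>t\<bar>) * g t)"
    unfolding Suc by (simp add: sum.distrib[symmetric] algebra_simps)
  also have "\<dots> = (\<Sum>t\<in>{- int (Suc J)..int (Suc J)}. of_int (int (Suc J) - \<bar>t\<bar>) * g t)"
  proof (rule sum.mono_neutral_left)
    show "\<forall>i\<in>{- int (Suc J)..int (Suc J)} - {- int J..int J}. of_int (int (Suc J) - \<bar>i\<bar>) * g i = 0"
    proof
      fix i assume "i \<in> {- int (Suc J)..int (Suc J)} - {- int J..int J}"
      then have "int (Suc J) - \<bar>i\<bar> = 0" by auto
      then show "of_int (int (Suc J) - \<bar>i\<bar>) * g i = 0" by simp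
    qed
  qed auto
  finally show ?case .
qed simp

definition fejer :: "nat \<Rightarrow> real \<Rightarrow> real" where
  "fejer J v = (norm (\<Sum>j<J. cis (real j * v)))\<^sup>2 / J"

definition fejer_weight :: "nat \<Rightarrow> int \<Rightarrow> real" where
  "fejer_weight J t = max 0 (1 - \<bar>t\<bar> / J)"

text \<open>
  The range of \<open>t\<close> may be larger than the support of the weights, which allows kernels of
  different degrees to be compared term by term.
\<close>
lemma fejer_fourier:
  fixes v :: real
  assumes J: "J \<ge> 1" "J \<le> T"
  shows "complex_of_real (fejer J v) = (\<Sum>t\<in>{- int T..int T}. complex_of_real (fejer_weight J t) * cis (t * v))"
proof -
  have "complex_of_real (fejer J v) = (\<Sum>j<J. cis (real j * v)) * cnj (\<Sum>j<J. cis (real j * v)) / J"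
    unfolding fejer_def by (simp add: complex_norm_square del: of_real_power)
  also have "(\<Sum>j<J. cis (real j * v)) * cnj (\<Sum>j<J. cis (real j * v))
     = (\<Sum>a<J. \<Sum>b<J. (\<lambda>t. cis (of_int t * v)) (int a - int b))"
    by (simp add: sum_product cis_cnj cis_mult algebra_simps)
  also have "\<dots> = (\<Sum>t\<in>{- int J..int J}. of_int (int J - \<bar>t\<bar>) * cis (t * v))"
    by (rule sum_differences)
  also have "\<dots> / J = (\<Sum>t\<in>{- int J..int J}. complex_of_real (fejer_weight J t) * cis (t * v))"
    unfolding sum_divide_distrib
  proof (intro sum.cong refl)
    fix t assume "t \<in> {- int J..int J}"
    then have "\<bar>real_of_int t\<bar> \<le> real J" by auto
    then have "fejer_weight J t = 1 - \<bar>t\<bar> / J" using J by (simp add: fejer_weight_def)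
    also have "\<dots> = (int J - \<bar>t\<bar>) / J" using J by (simp add: diff_divide_distrib)
    finally have "fejer_weight J t = real_of_int (int J - \<bar>t\<bar>) / real J" by simp
    then have "complex_of_real (fejer_weight J t) = of_int (int J - \<bar>t\<bar>) / of_nat J"
      by (simp only: of_real_divide of_real_of_int_eq of_real_of_nat_eq)
    then show "of_int (int J - \<bar>t\<bar>) * cis (t * v) / J = complex_of_real (fejer_weight J t) * cis (t * v)"
      by simp
  qed
  also have "\<dots> = (\<Sum>t\<in>{- int T..int T}. complex_of_real (fejer_weight J t) * cis (t * v))"
  proof (rule sum.mono_neutral_left)
    show "\<forall>t\<in>{- int T..int T} - {- int J..int J}. complex_of_real (fejer_weight J t) * cis (t * v) = 0"
    proof
      fix t assume "t \<in> {- int T..int T} - {- int J..int J}"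
      then have "real J \<le> \<bar>real_of_int t\<bar>" by auto
      then show "complex_of_real (fejer_weight J t) * cis (t * v) = 0"
        using J by (simp add: fejer_weight_def)
    qed
  qed (use J in auto)
  finally show ?thesis .
qed

lemma fejer_nonneg: "0 \<le> fejer J v"
  by (simp add: fejer_def)

lemma fejer_even: "fejer J (- v) = fejer J v"
proof -
  have "(\<Sum>j<J. cis (real j * (- v))) = cnj (\<Sum>j<J. cis (real j * v))" by (simp add: cis_cnj)
  then show ?thesis unfolding fejer_def by (metis complex_mod_cnj)
qed

lemma fejer_le: "fejer J v \<le> J"
proof -
  have "norm (\<Sum>j<J. cis (real j * v)) \<le> (\<Sum>j<J. 1)" by (intro sum_norm_le) auto
  then have "(norm (\<Sum>j<J. cis (real j * v)))\<^sup>2 \<le> (real J)\<^sup>2" by (intro power_mono) auto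
  then have "fejer J v \<le> (real J)\<^sup>2 / J" unfolding fejer_def by (rule divide_right_mono) simp
  then show ?thesis by (cases "J = 0") (auto simp: power2_eq_square)
qed

lemma fejer_decay:
  assumes v: "v \<noteq> 0" "\<bar>v\<bar> \<le> pi"
  shows "fejer J v \<le> 16 / (J * v\<^sup>2)"
proof -
  let ?S = "\<Sum>j<J. cis (real j * v)"
  have "(cis v - 1) * ?S = cis (real J * v) - 1"
    by (induction J) (simp_all add: algebra_simps cis_mult)
  then have "norm (cis v - 1) * norm ?S = norm (cis (real J * v) - 1)" by (metis norm_mult)
  also have "\<dots> \<le> 2" using norm_triangle_ineq4[of "cis (real J * v)" 1] by simp
  finally have 1: "norm (cis v - 1) * norm ?S \<le> 2" .
  have "\<bar>v\<bar> / 2 \<le> norm (cis v - 1)"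
  proof -
    have "\<bar>v\<bar> / pi \<le> \<bar>sin (v / 2)\<bar>"
    proof (cases "v \<ge> 0")
      case True
      have "2 / pi * (v / 2) \<le> sin (v / 2)" using True v by (intro sin_ge_two_over_pi) auto
      then show ?thesis using True by simp
    next
      case False
      have "2 / pi * (- v / 2) \<le> sin (- v / 2)" using False v by (intro sin_ge_two_over_pi) auto
      then show ?thesis using False by simp
    qed
    moreover have "\<bar>v\<bar> / 4 \<le> \<bar>v\<bar> / pi" using pi_less_4 by (intro divide_left_mono) auto
    ultimately have 2: "\<bar>v\<bar> / 4 \<le> \<bar>sin (v / 2)\<bar>" by linarith
    have "cis v - 1 = Complex (- 2 * (sin (v / 2))\<^sup>2) (2 * sin (v / 2) * cos (v / 2))"
      using cos_double_sin[of "v / 2"] sin_double[of "v / 2"] by (simp add: complex_eq_iff)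
    moreover have "(- 2 * s\<^sup>2)\<^sup>2 + (2 * s * c)\<^sup>2 = (2 * s)\<^sup>2 * (s\<^sup>2 + c\<^sup>2)" for s c :: real
      by (simp add: power2_eq_square algebra_simps)
    ultimately have "(norm (cis v - 1))\<^sup>2 = (2 * sin (v / 2))\<^sup>2 * ((sin (v / 2))\<^sup>2 + (cos (v / 2))\<^sup>2)"
      unfolding cmod_power2 by (simp only: complex.sel)
    then have "(norm (cis v - 1))\<^sup>2 = (2 * \<bar>sin (v / 2)\<bar>)\<^sup>2" by simp
    then have "norm (cis v - 1) = 2 * \<bar>sin (v / 2)\<bar>" by (rule power2_eq_imp_eq) auto
    then show ?thesis using 2 by linarith
  qed
  then have "\<bar>v\<bar> / 2 * norm ?S \<le> 2" using 1 by (meson mult_right_mono norm_ge_zero order_trans)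
  then have "norm ?S \<le> 4 / \<bar>v\<bar>" using v by (simp add: field_simps)
  then have "(norm ?S)\<^sup>2 \<le> (4 / \<bar>v\<bar>)\<^sup>2" by (intro power_mono) auto
  also have "\<dots> = 16 / v\<^sup>2" by (simp add: power_divide)
  finally have "fejer J v \<le> (16 / v\<^sup>2) / J" unfolding fejer_def by (rule divide_right_mono) simp
  then show ?thesis by (simp add: mult.commute)
qed

lemma fejer_lower:
  assumes "\<bar>v\<bar> \<le> 1 / J" "J \<ge> 1"
  shows "J / 4 \<le> fejer J v"
proof -
  have "1 / 2 \<le> cos (real j * v)" if "j < J" for j
  proof -
    have "\<bar>real j * v\<bar> \<le> real J * (1 / J)" unfolding abs_mult using assms that by (intro mult_mono) auto
    then have a: "\<bar>real j * v\<bar> \<le> 1" using assms by simp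
    have "(real j * v)\<^sup>2 \<le> 1" using a by (simp add: abs_square_le_1)
    moreover have "1 - (real j * v)\<^sup>2 / 2 \<le> cos (real j * v)"
    proof -
      have "\<bar>2 * sin (real j * v / 2)\<bar> \<le> \<bar>real j * v\<bar>" using abs_sin_x_le_abs_x[of "real j * v / 2"] by simp
      then have "(2 * sin (real j * v / 2))\<^sup>2 \<le> (real j * v)\<^sup>2" by (simp only: abs_le_square_iff)
      then show ?thesis using cos_double_sin[of "real j * v / 2"] by (simp add: power_mult_distrib)
    qed
    ultimately show ?thesis by simp
  qed
  then have "(\<Sum>j<J. 1 / 2) \<le> (\<Sum>j<J. cos (real j * v))" by (intro sum_mono) auto
  also have "\<dots> = Re (\<Sum>j<J. cis (real j * v))" by simp
  also have "\<dots> \<le> norm (\<Sum>j<J. cis (real j * v))" by (rule complex_Re_le_cmod)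
  finally have "J / 2 \<le> norm (\<Sum>j<J. cis (real j * v))" by simp
  then have "(J / 2)\<^sup>2 \<le> (norm (\<Sum>j<J. cis (real j * v)))\<^sup>2" by (intro power_mono) auto
  then have "(J / 2)\<^sup>2 / J \<le> fejer J v" unfolding fejer_def by (rule divide_right_mono) simp
  then show ?thesis using assms by (simp add: power2_eq_square)
qed

lemma fejer_weight_bounds:
  "0 \<le> fejer_weight J t" "fejer_weight J t \<le> 1"
  by (auto simp: fejer_weight_def)

lemma fejer_weight_half: "J \<ge> 1 \<Longrightarrow> \<bar>t\<bar> \<le> int J \<Longrightarrow> 1 / 2 \<le> fejer_weight (2 * J) t"
  by (simp add: fejer_weight_def field_simps)

text \<open>
  Each term is at most \<open>(1 / \<delta>) * (1 / (p - \<delta> / 2) - 1 / (p + \<delta> / 2))\<close>, and these differences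
  belong to disjoint intervals.
\<close>
lemma sum_inverse_squares_one_sided:
  fixes P :: "real set"
  assumes "finite P" "0 < \<delta>" "\<delta> \<le> \<Delta>"
    and "\<And>p. p \<in> P \<Longrightarrow> \<Delta> \<le> p" and "\<And>p q. p \<in> P \<Longrightarrow> q \<in> P \<Longrightarrow> p < q \<Longrightarrow> \<delta> \<le> q - p"
    and "\<And>p. p \<in> P \<Longrightarrow> p \<le> B" and "\<Delta> - \<delta> \<le> B"
  shows "(\<Sum>p\<in>P. 1 / p\<^sup>2) \<le> (1 / \<delta>) * (2 / \<Delta> - 1 / (B + \<delta> / 2))"
  using assms
proof (induction P arbitrary: B rule: finite_linorder_max_induct)
  case empty
  have "1 / (B + \<delta> / 2) \<le> 1 / (\<Delta> / 2)" using empty by (intro divide_left_mono mult_pos_pos) auto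
  then show ?case using empty by (simp add: mult_nonneg_nonneg)
next
  case (insert b A)
  have b: "b \<ge> \<Delta>" using insert.prems by auto
  have IH: "(\<Sum>p\<in>A. 1 / p\<^sup>2) \<le> (1 / \<delta>) * (2 / \<Delta> - 1 / (b - \<delta> + \<delta> / 2))"
  proof (rule insert.IH)
    show "p \<le> b - \<delta>" if "p \<in> A" for p
      using insert.prems(4)[of p b] insert.hyps that by auto
  qed (use insert.prems b in auto)
  have "1 / b\<^sup>2 \<le> 1 / (b\<^sup>2 - \<delta>\<^sup>2 / 4)"
  proof -
    have "\<delta> \<le> b" using b insert.prems by linarith
    then have "\<delta>\<^sup>2 \<le> b\<^sup>2" using insert.prems by (intro power_mono) auto
    moreover have "0 < b\<^sup>2" using \<open>\<delta> \<le> b\<close> \<open>0 < \<delta>\<close> by simp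
    ultimately have "0 < b\<^sup>2 - \<delta>\<^sup>2 / 4" by linarith
    then show ?thesis using \<open>0 < b\<^sup>2\<close> by (intro divide_left_mono mult_pos_pos) auto
  qed
  also have "\<dots> = (1 / \<delta>) * (1 / (b - \<delta> / 2) - 1 / (b + \<delta> / 2))"
  proof -
    have ne: "b - \<delta> / 2 \<noteq> 0" "b + \<delta> / 2 \<noteq> 0" "\<delta> \<noteq> 0"
      using \<open>0 < \<delta>\<close> \<open>\<delta> \<le> \<Delta>\<close> b by linarith+
    have "1 / (b - \<delta> / 2) - 1 / (b + \<delta> / 2) = \<delta> / ((b - \<delta> / 2) * (b + \<delta> / 2))"
      using ne(1,2) by (simp add: diff_frac_eq)
    also have "(b - \<delta> / 2) * (b + \<delta> / 2) = b\<^sup>2 - \<delta>\<^sup>2 / 4" by (simp add: power2_eq_square algebra_simps)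
    finally show ?thesis using ne by simp
  qed
  finally have "1 / b\<^sup>2 \<le> (1 / \<delta>) * (1 / (b - \<delta> / 2) - 1 / (b + \<delta> / 2))" .
  moreover have "(\<Sum>p\<in>insert b A. 1 / p\<^sup>2) = 1 / b\<^sup>2 + (\<Sum>p\<in>A. 1 / p\<^sup>2)"
    using insert.hyps by (subst sum.insert) auto
  moreover have "b - \<delta> + \<delta> / 2 = b - \<delta> / 2" by simp
  ultimately have "(\<Sum>p\<in>insert b A. 1 / p\<^sup>2) \<le> (1 / \<delta>) * (2 / \<Delta> - 1 / (b + \<delta> / 2))"
    using IH by (simp add: right_diff_distrib)
  also have "\<dots> \<le> (1 / \<delta>) * (2 / \<Delta> - 1 / (B + \<delta> / 2))"
  proof -
    have "b \<le> B" using insert.prems by auto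
    moreover have "0 < b + \<delta> / 2" using \<open>0 < \<delta>\<close> \<open>\<delta> \<le> \<Delta>\<close> b by linarith
    ultimately have "1 / (B + \<delta> / 2) \<le> 1 / (b + \<delta> / 2)"
      by (intro divide_left_mono mult_pos_pos) auto
    then show ?thesis using insert.prems by (intro mult_left_mono) auto
  qed
  finally show ?case .
qed

lemma sum_inverse_squares_separated:
  fixes lam :: "'a \<Rightarrow> real"
  assumes fin: "finite I" and \<delta>: "0 < \<delta>" "\<delta> \<le> \<Delta>"
    and far: "\<And>i. i \<in> I \<Longrightarrow> \<Delta> \<le> \<bar>lam i - u\<bar>"
    and sep: "\<And>i j. i \<in> I \<Longrightarrow> j \<in> I \<Longrightarrow> i \<noteq> j \<Longrightarrow> \<delta> \<le> \<bar>lam i - lam j\<bar>"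
  shows "(\<Sum>i\<in>I. 1 / (lam i - u)\<^sup>2) \<le> 4 / (\<delta> * \<Delta>)"
proof -
  have side: "(\<Sum>i\<in>K. 1 / (lam i - u)\<^sup>2) \<le> 2 / (\<delta> * \<Delta>)"
    if K: "K \<subseteq> I" and s: "s = 1 \<or> s = -1" and pos: "\<And>i. i \<in> K \<Longrightarrow> 0 < s * (lam i - u)" for K and s :: real
  proof -
    define g where "g = (\<lambda>i. s * (lam i - u))"
    have finK: "finite K" using K fin finite_subset by blast
    have dist: "\<bar>g i - g j\<bar> = \<bar>lam i - lam j\<bar>" for i j using s by (auto simp: g_def)
    have ss: "\<delta> \<le> \<bar>g i - g j\<bar>" if "i \<in> K" "j \<in> K" "i \<noteq> j" for i j
      unfolding dist using sep[of i j] K that by auto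
    have inj: "inj_on g K" using ss \<delta> by (intro inj_onI) fastforce
    have gD: "\<Delta> \<le> g i" if "i \<in> K" for i
      using far[of i] pos[OF that] K that s by (auto simp: g_def)
    define B where "B = \<Delta> + (\<Sum>i\<in>K. g i)"
    have gB: "g i \<le> B" if "i \<in> K" for i
    proof -
      have "g i \<le> (\<Sum>i\<in>K. g i)" using gD \<delta> finK that by (intro member_le_sum) fastforce+
      then show ?thesis using \<delta> by (simp add: B_def)
    qed
    have B: "0 < B" using gD \<delta> unfolding B_def by (intro add_pos_nonneg sum_nonneg) fastforce+
    have BD: "\<Delta> - \<delta> \<le> B"
    proof -
      have "0 \<le> (\<Sum>i\<in>K. g i)" using gD \<delta> by (intro sum_nonneg) fastforce
      then show ?thesis using \<delta> by (simp add: B_def)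
    qed
    have "(\<Sum>i\<in>K. 1 / (lam i - u)\<^sup>2) = (\<Sum>i\<in>K. 1 / (g i)\<^sup>2)"
      using s by (intro sum.cong refl) (auto simp: g_def power2_commute)
    also have "\<dots> = (\<Sum>p\<in>g ` K. 1 / p\<^sup>2)" by (simp add: sum.reindex[OF inj])
    also have "\<dots> \<le> (1 / \<delta>) * (2 / \<Delta> - 1 / (B + \<delta> / 2))"
    proof (rule sum_inverse_squares_one_sided)
      fix p q assume "p \<in> g ` K" "q \<in> g ` K" "p < q"
      then obtain i j where "i \<in> K" "j \<in> K" "i \<noteq> j" "p = g i" "q = g j" by auto
      then show "\<delta> \<le> q - p" using ss[of i j] \<open>p < q\<close> by auto
    qed (use finK \<delta> gD gB BD in auto)
    also have "\<dots> \<le> (1 / \<delta>) * (2 / \<Delta>)" using \<delta> B by (intro mult_left_mono) auto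
    finally show ?thesis by simp
  qed
  let ?R = "{i\<in>I. 0 < lam i - u}" and ?L = "{i\<in>I. lam i - u < 0}"
  have "I = ?R \<union> ?L" using far \<delta> by fastforce
  moreover have "?R \<inter> ?L = {}" by auto
  moreover have "finite ?R" "finite ?L" using fin by auto
  ultimately have "(\<Sum>i\<in>I. 1 / (lam i - u)\<^sup>2) = (\<Sum>i\<in>?R. 1 / (lam i - u)\<^sup>2) + (\<Sum>i\<in>?L. 1 / (lam i - u)\<^sup>2)"
    using sum.union_disjoint[of ?R ?L "\<lambda>i. 1 / (lam i - u)\<^sup>2"] by metis
  also have "\<dots> \<le> 2 / (\<delta> * \<Delta>) + 2 / (\<delta> * \<Delta>)"
    by (intro add_mono side[of ?R 1] side[of ?L "-1"]) auto
  finally show ?thesis by (simp add: mult.commute)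
qed

text \<open>
  Apply \<open>2 * a i * a j \<le> (a i)\<^sup>2 + (a j)\<^sup>2\<close> to each term; by symmetry both parts are controlled by row sums.
\<close>
lemma symmetric_form_le_row_sums:
  fixes F :: "'a \<Rightarrow> 'a \<Rightarrow> real"
  assumes "\<And>i j. 0 \<le> F i j" "\<And>i j. F i j = F j i" "\<And>i. i \<in> I \<Longrightarrow> (\<Sum>j\<in>I. F i j) \<le> R"
  shows "(\<Sum>i\<in>I. \<Sum>j\<in>I. a i * a j * F i j) \<le> R * (\<Sum>i\<in>I. (a i)\<^sup>2)"
proof -
  have "(\<Sum>i\<in>I. \<Sum>j\<in>I. a i * a j * F i j) \<le> (\<Sum>i\<in>I. \<Sum>j\<in>I. ((a i)\<^sup>2 / 2 + (a j)\<^sup>2 / 2) * F i j)"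
  proof (intro sum_mono mult_right_mono assms)
    fix i j
    have "0 \<le> (a i - a j)\<^sup>2" by simp
    then show "a i * a j \<le> (a i)\<^sup>2 / 2 + (a j)\<^sup>2 / 2" by (simp add: power2_eq_square algebra_simps)
  qed
  also have "\<dots> = (\<Sum>i\<in>I. \<Sum>j\<in>I. (a i)\<^sup>2 / 2 * F i j) + (\<Sum>i\<in>I. \<Sum>j\<in>I. (a j)\<^sup>2 / 2 * F i j)"
    by (simp add: distrib_right sum.distrib)
  also have "(\<Sum>i\<in>I. \<Sum>j\<in>I. (a j)\<^sup>2 / 2 * F i j) = (\<Sum>j\<in>I. \<Sum>i\<in>I. (a j)\<^sup>2 / 2 * F j i)"
    by (subst sum.swap) (simp add: assms(2)[of _ _])
  also have "(\<Sum>i\<in>I. \<Sum>j\<in>I. (a i)\<^sup>2 / 2 * F i j) + (\<Sum>i\<in>I. \<Sum>j\<in>I. (a i)\<^sup>2 / 2 * F i j)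
     = (\<Sum>i\<in>I. (a i)\<^sup>2 * (\<Sum>j\<in>I. F i j))"
    unfolding sum.distrib[symmetric] sum_distrib_left by (intro sum.cong refl) simp
  also have "\<dots> \<le> (\<Sum>i\<in>I. (a i)\<^sup>2 * R)" by (intro sum_mono mult_left_mono assms) auto
  also have "\<dots> = R * (\<Sum>i\<in>I. (a i)\<^sup>2)" by (simp add: sum_distrib_left mult.commute)
  finally show ?thesis .
qed

text \<open>
  The mean value estimate for exponential polynomials with \<open>\<delta>\<close>-separated frequencies: majorise the
  range of \<open>t\<close> by Fejer weights; the resulting quadratic form has the nonnegative matrix
  \<open>fejer (lam i - lam j)\<close>, whose row sums are \<open>O(J)\<close>.
\<close>
lemma mean_value:
  fixes lam :: "'a \<Rightarrow> real" and c :: "'a \<Rightarrow> complex"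
  assumes fin: "finite I" and \<delta>: "0 < \<delta>" "1 \<le> J * \<delta>"
    and sep: "\<And>i j. i \<in> I \<Longrightarrow> j \<in> I \<Longrightarrow> i \<noteq> j \<Longrightarrow> \<delta> \<le> \<bar>lam i - lam j\<bar>"
    and range: "\<And>i j. i \<in> I \<Longrightarrow> j \<in> I \<Longrightarrow> \<bar>lam i - lam j\<bar> \<le> pi"
  shows "(\<Sum>t\<in>{- int J..int J}. (norm (\<Sum>i\<in>I. c i * cis (t * lam i)))\<^sup>2) \<le> 68 * real J * (\<Sum>i\<in>I. (norm (c i))\<^sup>2)"
proof -
  let ?S = "\<lambda>t. \<Sum>i\<in>I. c i * cis (real_of_int t * lam i)"
  define T where "T = 2 * J"
  let ?R = "{- int T..int T}"
  define F where "F = (\<lambda>i j. fejer T (lam i - lam j))"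
  have J: "J \<ge> 1" using \<delta> by (cases "J = 0") auto
  have row: "(\<Sum>j\<in>I. F i j) \<le> 34 * J" if i: "i \<in> I" for i
  proof -
    have "(\<Sum>j\<in>I. F i j) = F i i + (\<Sum>j\<in>I - {i}. F i j)" using fin i by (rule sum.remove)
    also have "F i i \<le> T" unfolding F_def by (rule fejer_le)
    also have "(\<Sum>j\<in>I - {i}. F i j) \<le> (\<Sum>j\<in>I - {i}. 16 / T * (1 / (lam j - lam i)\<^sup>2))"
    proof (rule sum_mono)
      fix j assume j: "j \<in> I - {i}"
      then have "lam i - lam j \<noteq> 0" using sep[of i j] i \<delta> by auto
      then have "F i j \<le> 16 / (T * (lam i - lam j)\<^sup>2)"
        unfolding F_def using range[of i j] i j by (intro fejer_decay) auto
      then show "F i j \<le> 16 / T * (1 / (lam j - lam i)\<^sup>2)" by (simp add: power2_commute)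
    qed
    also have "\<dots> = 16 / T * (\<Sum>j\<in>I - {i}. 1 / (lam j - lam i)\<^sup>2)" by (simp add: sum_distrib_left)
    also have "\<dots> \<le> 16 / T * (4 / (\<delta> * \<delta>))"
    proof (intro mult_left_mono sum_inverse_squares_separated)
      show "\<And>j. j \<in> I - {i} \<Longrightarrow> \<delta> \<le> \<bar>lam j - lam i\<bar>" using sep i by auto
      show "\<And>j k. j \<in> I - {i} \<Longrightarrow> k \<in> I - {i} \<Longrightarrow> j \<noteq> k \<Longrightarrow> \<delta> \<le> \<bar>lam j - lam k\<bar>" using sep by auto
    qed (use fin \<delta> in auto)
    also have "16 / T * (4 / (\<delta> * \<delta>)) = 32 / J * (1 / \<delta>)\<^sup>2" by (simp add: T_def power2_eq_square)
    also have "\<dots> \<le> 32 / J * (real J)\<^sup>2"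
      using \<delta> by (intro mult_left_mono power_mono) (auto simp: field_simps)
    also have "\<dots> = 32 * J" using J by (simp add: power2_eq_square)
    finally show ?thesis by (simp add: T_def)
  qed
  have "complex_of_real (\<Sum>t\<in>?R. fejer_weight T t * (norm (?S t))\<^sup>2)
     = (\<Sum>t\<in>?R. complex_of_real (fejer_weight T t) * (?S t * cnj (?S t)))"
    by (simp add: complex_norm_square del: of_real_power)
  also have "\<dots> = (\<Sum>t\<in>?R. \<Sum>i\<in>I. \<Sum>j\<in>I. c i * cnj (c j) * (complex_of_real (fejer_weight T t) * cis (t * (lam i - lam j))))"
  proof (intro sum.cong refl)
    fix t :: int
    have cd: "cis (x - y) = cis x * cis (- y)" for x y by (simp add: cis_mult)
    have "?S t * cnj (?S t) = (\<Sum>i\<in>I. \<Sum>j\<in>I. (c i * cis (t * lam i)) * cnj (c j * cis (t * lam j)))"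
      by (simp only: cnj_sum sum_product)
    then show "complex_of_real (fejer_weight T t) * (?S t * cnj (?S t))
      = (\<Sum>i\<in>I. \<Sum>j\<in>I. c i * cnj (c j) * (complex_of_real (fejer_weight T t) * cis (t * (lam i - lam j))))"
      by (simp only: sum_distrib_left right_diff_distrib cd complex_cnj_mult cis_cnj mult_ac)
  qed
  also have "\<dots> = (\<Sum>i\<in>I. \<Sum>j\<in>I. \<Sum>t\<in>?R. c i * cnj (c j) * (complex_of_real (fejer_weight T t) * cis (t * (lam i - lam j))))"
    by (subst sum.swap) (intro sum.cong refl sum.swap)
  also have "\<dots> = (\<Sum>i\<in>I. \<Sum>j\<in>I. c i * cnj (c j) * complex_of_real (F i j))"
    unfolding F_def sum_distrib_left[symmetric] using J by (subst fejer_fourier[of T T]) (auto simp: T_def)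
  finally have eq: "complex_of_real (\<Sum>t\<in>?R. fejer_weight T t * (norm (?S t))\<^sup>2)
     = (\<Sum>i\<in>I. \<Sum>j\<in>I. c i * cnj (c j) * complex_of_real (F i j))" .
  have "(\<Sum>t\<in>?R. fejer_weight T t * (norm (?S t))\<^sup>2) \<le> norm (complex_of_real (\<Sum>t\<in>?R. fejer_weight T t * (norm (?S t))\<^sup>2))"
    by (simp del: of_real_sum)
  also have "\<dots> \<le> (\<Sum>i\<in>I. \<Sum>j\<in>I. norm (c i) * norm (c j) * F i j)"
    unfolding eq by (intro sum_norm_le order_refl) (simp add: norm_mult F_def fejer_nonneg)
  also have "\<dots> \<le> 34 * J * (\<Sum>i\<in>I. (norm (c i))\<^sup>2)"
  proof (rule symmetric_form_le_row_sums)
    show "F i j = F j i" for i j unfolding F_def using fejer_even[of T "lam i - lam j"] by simp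
  qed (use row in \<open>auto simp: F_def fejer_nonneg\<close>)
  finally have upper: "(\<Sum>t\<in>?R. fejer_weight T t * (norm (?S t))\<^sup>2) \<le> 34 * J * (\<Sum>i\<in>I. (norm (c i))\<^sup>2)" .
  have "(\<Sum>t\<in>{- int J..int J}. (norm (?S t))\<^sup>2) = 2 * (\<Sum>t\<in>{- int J..int J}. 1 / 2 * (norm (?S t))\<^sup>2)"
    by (simp add: sum_distrib_left)
  also have "(\<Sum>t\<in>{- int J..int J}. 1 / 2 * (norm (?S t))\<^sup>2) \<le> (\<Sum>t\<in>{- int J..int J}. fejer_weight T t * (norm (?S t))\<^sup>2)"
    using J unfolding T_def by (intro sum_mono mult_right_mono fejer_weight_half) auto
  also have "\<dots> \<le> (\<Sum>t\<in>?R. fejer_weight T t * (norm (?S t))\<^sup>2)"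
    by (intro sum_mono2) (auto simp: T_def fejer_weight_bounds)
  also note upper
  finally show ?thesis by simp
qed

section \<open>Large values\<close>

text \<open>
  The numbers \<open>\<xi> i\<close> are the conjugate phases of the inner sums; with them the order of summation can be
  exchanged before Cauchy--Schwarz is applied in \<open>t\<close>. The coefficients \<open>b\<close> then enter only through
  their mean square.
\<close>
lemma sum_norms_duality:
  fixes K :: "'a \<Rightarrow> 'b \<Rightarrow> complex"
  obtains \<xi> where "\<And>i. norm (\<xi> i) \<le> 1"
    and "(\<Sum>i\<in>I. norm (\<Sum>t\<in>S. b t * K i t))\<^sup>2 \<le> (\<Sum>t\<in>S. (norm (b t))\<^sup>2) * (\<Sum>t\<in>S. (norm (\<Sum>i\<in>I. \<xi> i * K i t))\<^sup>2)"
proof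
  define \<xi> where "\<xi> = (\<lambda>i. cnj (sgn (\<Sum>t\<in>S. b t * K i t)))"
  show "norm (\<xi> i) \<le> 1" for i by (simp add: \<xi>_def norm_sgn)
  have key: "\<xi> i * (\<Sum>t\<in>S. b t * K i t) = of_real (norm (\<Sum>t\<in>S. b t * K i t))" for i
  proof -
    have "cnj (sgn w) * w = of_real (norm w)" for w :: complex
    proof (cases "w = 0")
      case False
      have "cnj (sgn w) * w = (w * cnj w) / of_real (norm w)"
        by (simp add: sgn_div_norm scaleR_conv_of_real divide_inverse mult_ac)
      also have "\<dots> = of_real ((norm w)\<^sup>2 / norm w)" by (simp add: complex_norm_square[symmetric])
      also have "(norm w)\<^sup>2 / norm w = norm w" using False by (simp add: power2_eq_square)
      finally show ?thesis .
    qed simp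
    then show ?thesis unfolding \<xi>_def .
  qed
  have "complex_of_real (\<Sum>i\<in>I. norm (\<Sum>t\<in>S. b t * K i t)) = (\<Sum>i\<in>I. \<xi> i * (\<Sum>t\<in>S. b t * K i t))"
    by (simp add: key)
  also have "\<dots> = (\<Sum>i\<in>I. \<Sum>t\<in>S. b t * (\<xi> i * K i t))"
    by (simp add: sum_distrib_left mult_ac)
  also have "\<dots> = (\<Sum>t\<in>S. \<Sum>i\<in>I. b t * (\<xi> i * K i t))" by (rule sum.swap)
  also have "\<dots> = (\<Sum>t\<in>S. b t * (\<Sum>i\<in>I. \<xi> i * K i t))" by (simp add: sum_distrib_left)
  finally have eq: "complex_of_real (\<Sum>i\<in>I. norm (\<Sum>t\<in>S. b t * K i t)) = (\<Sum>t\<in>S. b t * (\<Sum>i\<in>I. \<xi> i * K i t))" .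
  have "0 \<le> (\<Sum>i\<in>I. norm (\<Sum>t\<in>S. b t * K i t))" by (intro sum_nonneg) auto
  then have "(\<Sum>i\<in>I. norm (\<Sum>t\<in>S. b t * K i t)) = norm (\<Sum>t\<in>S. b t * (\<Sum>i\<in>I. \<xi> i * K i t))"
    unfolding eq[symmetric] norm_of_real by linarith
  then show "(\<Sum>i\<in>I. norm (\<Sum>t\<in>S. b t * K i t))\<^sup>2 \<le> (\<Sum>t\<in>S. (norm (b t))\<^sup>2) * (\<Sum>t\<in>S. (norm (\<Sum>i\<in>I. \<xi> i * K i t))\<^sup>2)"
    by (simp add: norm_sum_Cauchy_Schwarz)
qed

lemma sum_inverse_le_ln: "n \<ge> 1 \<Longrightarrow> (\<Sum>i\<in>{1..n}. 1 / real i) \<le> 1 + ln (real n)"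
proof (induction n rule: dec_induct)
  case (step n)
  have "ln (real n / real (Suc n)) \<le> real n / real (Suc n) - 1" using step by (intro ln_le_minus_one) auto
  also have "\<dots> = - (1 / real (Suc n))" by (simp add: field_simps)
  finally have "1 / real (Suc n) \<le> ln (real (Suc n)) - ln (real n)" using step by (simp add: ln_div)
  then show ?case using step by simp
qed simp

text \<open>
  Listing the values in decreasing order, the \<open>n\<close>-th is at most \<open>B / n\<close>.
\<close>
lemma sum_le_of_weak_type:
  fixes f :: "'a \<Rightarrow> real"
  assumes "finite S" "\<And>t. t \<in> S \<Longrightarrow> card {s \<in> S. f t \<le> f s} * f t \<le> B" "S \<noteq> {}" "B \<ge> 0"
  shows "sum f S \<le> B * (1 + ln (card S))"
proof -
  have "sum f S \<le> B * (\<Sum>i\<in>{1..card S}. 1 / real i)"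
    using assms(1,2)
  proof (induction "card S" arbitrary: S)
    case (Suc n)
    then have ne: "S \<noteq> {}" by auto
    obtain t where t: "t \<in> S" "\<And>s. s \<in> S \<Longrightarrow> f t \<le> f s"
      using ne Suc.prems(1) by (metis arg_min_if_finite(1) arg_min_least)
    have "{s \<in> S. f t \<le> f s} = S" using t by auto
    then have ft: "f t \<le> B / card S" using Suc.prems(2)[OF t(1)] ne Suc.prems(1)
      by (simp add: field_simps card_gt_0_iff)
    have cd: "card (S - {t}) = n" using Suc t by simp
    have "sum f (S - {t}) \<le> B * (\<Sum>i\<in>{1..card (S - {t})}. 1 / real i)"
    proof (rule Suc.hyps(1))
      show "n = card (S - {t})" using cd by simp
      show "finite (S - {t})" using Suc.prems by simp
      fix s assume s: "s \<in> S - {t}"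
      show "card {s' \<in> S - {t}. f s \<le> f s'} * f s \<le> B"
      proof (cases "f s \<ge> 0")
        case True
        have "card {s' \<in> S - {t}. f s \<le> f s'} \<le> card {s' \<in> S. f s \<le> f s'}"
          using Suc.prems by (intro card_mono) auto
        then have "card {s' \<in> S - {t}. f s \<le> f s'} * f s \<le> card {s' \<in> S. f s \<le> f s'} * f s"
          using True by (intro mult_right_mono) auto
        also have "\<dots> \<le> B" using Suc.prems s by auto
        finally show ?thesis .
      next
        case False
        then have "card {s' \<in> S - {t}. f s \<le> f s'} * f s \<le> 0" by (simp add: mult_nonneg_nonpos)
        then show ?thesis using \<open>B \<ge> 0\<close> by linarith
      qed
    qed
    moreover have "sum f S = f t + sum f (S - {t})" using Suc.prems t by (simp add: sum.remove)
    moreover have "card S = Suc n" using Suc by simp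
    ultimately show ?case using ft cd by (simp add: algebra_simps)
  qed (simp)
  also have "\<dots> \<le> B * (1 + ln (card S))"
  proof -
    have "card S \<ge> 1" using assms by (simp add: Suc_le_eq card_gt_0_iff)
    then show ?thesis using assms by (intro mult_left_mono sum_inverse_le_ln) auto
  qed
  finally show ?thesis .
qed

text \<open>
  The Halasz--Montgomery method: dualise the sum of the large values and insert the bound
  \<open>osc_sum_zeta_bound\<close> for the correlations.
\<close>
lemma halasz_montgomery:
  fixes S :: "int set" and r :: "nat \<Rightarrow> real" and T :: nat and V G :: real
  assumes M: "M \<ge> 1" and P: "P \<subseteq> {M..3 * M}" and T: "T \<ge> 1" "2 * T \<le> M ^ 2"
    and S: "S \<subseteq> {- int T..int T}"
    and V: "0 \<le> V" "\<And>t. t \<in> S \<Longrightarrow> V \<le> norm (\<Sum>m\<in>P. of_real (r m) * cis (t * ln (real m)))"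
    and G: "(\<Sum>m\<in>P. (r m)\<^sup>2) \<le> G"
    and large: "720 * G * sqrt T \<le> V\<^sup>2"
  shows "card S * V\<^sup>2 \<le> 1000 * G * M * (1 + ln (2 * T))"
proof (cases "S = {}")
  case True
  have "0 \<le> G" using G sum_nonneg[of P "\<lambda>m. (r m)\<^sup>2"] by fastforce
  moreover have "0 \<le> ln (2 * real T)" using T by simp
  ultimately show ?thesis using True by simp
next
  case False
  have finS: "finite S" using S finite_subset by blast
  have finP: "finite P" using P finite_subset by blast
  have cS: "card S > 0" using False finS by (simp add: card_gt_0_iff)
  have G0: "0 \<le> G" using G sum_nonneg[of P "\<lambda>m. (r m)\<^sup>2"] by fastforce
  define Z where "Z = (\<lambda>t. norm (osc_sum {M..3*M} (real_of_int t)))"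
  have lnT: "0 \<le> ln (2 * real T)" using T by simp
  have row: "(\<Sum>s\<in>S. Z (t - s)) \<le> 500 * M * (1 + ln (2 * T)) + 360 * card S * sqrt T" if t: "t \<in> S" for t
  proof -
    have Zb: "Z (t - s) \<le> 240 * M * (1 / \<bar>t - s\<bar>) + 360 * sqrt T" if s: "s \<in> S - {t}" for s
    proof -
      have "t \<in> {- int T..int T}" "s \<in> {- int T..int T}" "s \<noteq> t" using s t S by blast+
      then have b: "1 \<le> \<bar>t - s\<bar>" "\<bar>t - s\<bar> \<le> 2 * int T" by auto
      then have b': "1 \<le> \<bar>real_of_int (t - s)\<bar>" "\<bar>real_of_int (t - s)\<bar> \<le> 2 * real T" by linarith+
      have "2 * real T \<le> real M ^ 2" using T by (metis of_nat_le_iff of_nat_mult of_nat_numeral of_nat_power)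
      then have "Z (t - s) \<le> 240 * (M / \<bar>real_of_int (t - s)\<bar> + sqrt \<bar>real_of_int (t - s)\<bar>)"
        unfolding Z_def using M b' by (intro osc_sum_zeta_bound) linarith+
      also have "sqrt \<bar>real_of_int (t - s)\<bar> \<le> sqrt ((3 / 2)\<^sup>2 * T)"
        using b' by (intro real_sqrt_le_mono) (simp add: power2_eq_square)
      also have "\<dots> = 3 / 2 * sqrt T" by (simp add: real_sqrt_mult)
      finally show ?thesis by (simp add: algebra_simps)
    qed
    have "Z 0 \<le> card {M..3*M}" unfolding Z_def by (rule norm_osc_sum_le_card)
    also have "\<dots> \<le> 3 * M" using M by simp
    finally have Z0: "Z 0 \<le> 3 * M" by simp
    have inv: "(\<Sum>s\<in>S - {t}. 1 / \<bar>t - s\<bar>) \<le> 2 * (1 + ln (2 * T))"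
    proof -
      have "(\<Sum>s\<in>S - {t}. 1 / \<bar>t - s\<bar>) = (\<Sum>d\<in>(\<lambda>s. t - s) ` (S - {t}). 1 / \<bar>d\<bar>)"
        by (subst sum.reindex) (auto simp: inj_on_def)
      also have "\<dots> \<le> (\<Sum>d\<in>{- (2 * int T)..-1} \<union> {1..2 * int T}. 1 / \<bar>d\<bar>)"
      proof (rule sum_mono2)
        show "(\<lambda>s. t - s) ` (S - {t}) \<subseteq> {- (2 * int T)..-1} \<union> {1..2 * int T}"
        proof (rule image_subsetI)
          fix s assume s: "s \<in> S - {t}"
          then have "t \<in> {- int T..int T}" "s \<in> {- int T..int T}" "s \<noteq> t" using t S by blast+
          then show "t - s \<in> {- (2 * int T)..-1} \<union> {1..2 * int T}" by auto
        qed
      qed auto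
      also have "\<dots> = (\<Sum>d\<in>{- (2 * int T)..-1}. 1 / \<bar>d\<bar>) + (\<Sum>d\<in>{1..2 * int T}. 1 / \<bar>d\<bar>)"
        by (rule sum.union_disjoint) auto
      also have "(\<Sum>d\<in>{- (2 * int T)..-1}. 1 / \<bar>d\<bar>) = (\<Sum>i\<in>{1..2*T}. 1 / real i)"
        by (rule sum.reindex_bij_witness[of _ "\<lambda>i. - int i" "\<lambda>d. nat (- d)"]) auto
      also have "(\<Sum>d\<in>{1..2 * int T}. 1 / \<bar>d\<bar>) = (\<Sum>i\<in>{1..2*T}. 1 / real i)"
        by (rule sum.reindex_bij_witness[of _ "\<lambda>i. int i" "\<lambda>d. nat d"]) auto
      also have "(\<Sum>i\<in>{1..2*T}. 1 / real i) \<le> 1 + ln (real (2 * T))"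
        using T by (intro sum_inverse_le_ln) auto
      finally show ?thesis by simp
    qed
    have "(\<Sum>s\<in>S. Z (t - s)) = Z 0 + (\<Sum>s\<in>S - {t}. Z (t - s))"
      using sum.remove[OF finS t, of "\<lambda>s. Z (t - s)"] by simp
    also have "\<dots> \<le> 3 * M + (\<Sum>s\<in>S - {t}. 240 * M * (1 / \<bar>t - s\<bar>) + 360 * sqrt T)"
      by (intro add_mono Z0 sum_mono Zb)
    also have "\<dots> = 3 * M + 240 * M * (\<Sum>s\<in>S - {t}. 1 / \<bar>t - s\<bar>) + 360 * card (S - {t}) * sqrt T"
      by (simp add: sum.distrib sum_distrib_left)
    also have "\<dots> \<le> 3 * M + 240 * M * (2 * (1 + ln (2 * T))) + 360 * card S * sqrt T"
      using finS by (intro add_mono mult_left_mono mult_right_mono inv) (auto intro: card_mono)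
    also have "\<dots> \<le> 500 * M * (1 + ln (2 * T)) + 360 * card S * sqrt T"
      using lnT by (simp add: algebra_simps)
    finally show ?thesis .
  qed
  obtain \<xi> where \<xi>: "\<And>t. norm (\<xi> t) \<le> 1"
    "(\<Sum>t\<in>S. norm (\<Sum>m\<in>P. of_real (r m) * cis (real_of_int t * ln (real m))))\<^sup>2
      \<le> (\<Sum>m\<in>P. (norm (complex_of_real (r m)))\<^sup>2) * (\<Sum>m\<in>P. (norm (\<Sum>t\<in>S. \<xi> t * cis (real_of_int t * ln (real m))))\<^sup>2)"
    using sum_norms_duality[where I = S and S = P and b = "\<lambda>m. of_real (r m)"
      and K = "\<lambda>t m. cis (real_of_int t * ln (real m))"] by blast
  have "(\<Sum>t\<in>S. V) \<le> (\<Sum>t\<in>S. norm (\<Sum>m\<in>P. of_real (r m) * cis (real_of_int t * ln (real m))))"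
    using V by (intro sum_mono) auto
  then have "(card S * V)\<^sup>2 \<le> (\<Sum>t\<in>S. norm (\<Sum>m\<in>P. of_real (r m) * cis (real_of_int t * ln (real m))))\<^sup>2"
    using V by (intro power_mono) auto
  also note \<xi>(2)
  finally have dual: "(card S * V)\<^sup>2 \<le> (\<Sum>m\<in>P. (norm (complex_of_real (r m)))\<^sup>2)
     * (\<Sum>m\<in>P. (norm (\<Sum>t\<in>S. \<xi> t * cis (real_of_int t * ln (real m))))\<^sup>2)" .
  have "(\<Sum>m\<in>P. (norm (\<Sum>t\<in>S. \<xi> t * cis (real_of_int t * ln (real m))))\<^sup>2)
     \<le> (\<Sum>m\<in>{M..3*M}. (norm (\<Sum>t\<in>S. \<xi> t * cis (real_of_int t * ln (real m))))\<^sup>2)"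
    using P by (intro sum_mono2) auto
  also have "\<dots> \<le> norm (complex_of_real (\<Sum>m\<in>{M..3*M}. (norm (\<Sum>t\<in>S. \<xi> t * cis (real_of_int t * ln (real m))))\<^sup>2))"
    by (simp add: sum_nonneg del: of_real_sum)
  also have "\<dots> = norm (\<Sum>t\<in>S. \<Sum>s\<in>S. \<xi> t * cnj (\<xi> s) * osc_sum {M..3*M} (real_of_int (t - s)))"
    unfolding norm_sum_square_expand[OF finS] osc_sum_def sum_distrib_left
  proof (intro arg_cong[of _ _ norm] sum.cong refl)
    fix t s :: int and m :: nat
    have cd: "cis (x - y) = cis x * cis (- y)" for x y by (simp add: cis_mult)
    have e: "real_of_int (t - s) * ln (real m) = real_of_int t * ln (real m) - real_of_int s * ln (real m)"
      by (simp add: algebra_simps)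
    show "\<xi> t * cis (real_of_int t * ln (real m)) * cnj (\<xi> s * cis (real_of_int s * ln (real m)))
      = \<xi> t * cnj (\<xi> s) * cis (real_of_int (t - s) * ln (real m))"
      unfolding e cd by (simp add: cis_cnj)
  qed
  also have "\<dots> \<le> (\<Sum>t\<in>S. \<Sum>s\<in>S. Z (t - s))"
  proof (intro sum_norm_le)
    fix t s
    have "norm (\<xi> t * cnj (\<xi> s)) * Z (t - s) \<le> 1 * Z (t - s)"
      using \<xi>(1) by (intro mult_right_mono) (auto simp: norm_mult Z_def intro: mult_le_one)
    then show "norm (\<xi> t * cnj (\<xi> s) * osc_sum {M..3*M} (real_of_int (t - s))) \<le> Z (t - s)"
      by (simp add: norm_mult Z_def)
  qed
  also have "\<dots> \<le> (\<Sum>t\<in>S. 500 * M * (1 + ln (2 * T)) + 360 * card S * sqrt T)"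
    by (intro sum_mono row)
  finally have "(\<Sum>m\<in>P. (norm (\<Sum>t\<in>S. \<xi> t * cis (real_of_int t * ln (real m))))\<^sup>2)
     \<le> card S * (500 * M * (1 + ln (2 * T)) + 360 * card S * sqrt T)" by simp
  then have "(\<Sum>m\<in>P. (norm (complex_of_real (r m)))\<^sup>2) * (\<Sum>m\<in>P. (norm (\<Sum>t\<in>S. \<xi> t * cis (real_of_int t * ln (real m))))\<^sup>2)
     \<le> G * (card S * (500 * M * (1 + ln (2 * T)) + 360 * card S * sqrt T))"
    using G G0 by (intro mult_mono) (auto intro: sum_nonneg)
  with dual have "(card S * V)\<^sup>2 \<le> G * (card S * (500 * M * (1 + ln (2 * T)) + 360 * card S * sqrt T))"
    by (rule order_trans)
  then have "card S * (card S * V\<^sup>2) \<le> card S * (500 * G * M * (1 + ln (2 * T)) + card S * (720 * G * sqrt T) / 2)"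
    by (simp add: power2_eq_square algebra_simps)
  then have "card S * V\<^sup>2 \<le> 500 * G * M * (1 + ln (2 * T)) + card S * (720 * G * sqrt T) / 2"
    using cS by simp
  also have "card S * (720 * G * sqrt T) / 2 \<le> card S * V\<^sup>2 / 2"
    using large by (intro divide_right_mono mult_left_mono) auto
  finally show ?thesis by simp
qed

section \<open>Large values of the sums over a block\<close>
lemma block_eq_interval: "block k N = {N..<N + (N div k + 1)}"
  by (auto simp: block_def)

lemma card_block: "card (block k N) = N div k + 1"
  by (simp add: block_def)

lemma block_length_le: "(k::nat) \<ge> 2 \<Longrightarrow> (N::nat) \<ge> 2 \<Longrightarrow> N div k + 1 \<le> N"
proof -
  assume "k \<ge> 2" "N \<ge> 2"
  then have "N div k < N" by (intro div_less_dividend) auto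
  then show ?thesis by simp
qed

text \<open>
  All losses are measured by powers of \<open>N powr \<kappa>\<close>. The saving \<open>N powr (- 12 * \<kappa>)\<close> in the pointwise bound
  is large enough to compensate for those that occur in \<open>card_large_values\<close>.
\<close>
definition regular :: "nat \<Rightarrow> real \<Rightarrow> nat \<Rightarrow> bool" where
  "regular k \<kappa> N \<longleftrightarrow> N \<ge> 2
    \<and> (\<forall>j\<le>k. \<forall>m\<in>prods (block k N) j. real (reps (block k N) j m) \<le> real N powr \<kappa>)
    \<and> (\<forall>t::real. real N \<le> \<bar>t\<bar> \<longrightarrow> \<bar>t\<bar> \<le> real N ^ k \<longrightarrow> norm (osc_sum (block k N) t) \<le> real N powr (1 - 12 * \<kappa>))
    \<and> 10000 * (1 + ln (4 * real N ^ k)) \<le> real N powr \<kappa>"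

lemma eventually_regular:
  assumes k: "k \<ge> 2"
  shows "\<exists>\<kappa>>0. \<kappa> \<le> 1 / 12 \<and> eventually (regular k \<kappa>) sequentially"
proof -
  obtain c where c: "c > 0" "c \<le> 1" and ev: "eventually (\<lambda>N. \<forall>L t. L \<le> N \<longrightarrow> real N \<le> \<bar>t\<bar> \<longrightarrow>
     \<bar>t\<bar> \<le> real N ^ Suc (k - 1) \<longrightarrow> norm (osc_sum {N..<N+L} t) \<le> real N powr (1 - c)) sequentially"
    using osc_sum_weyl[of "k - 1"] by blast
  define \<kappa> where "\<kappa> = c / 12"
  have \<kappa>: "\<kappa> > 0" "\<kappa> \<le> 1 / 12" "c = 12 * \<kappa>" using c by (auto simp: \<kappa>_def)
  have "eventually (\<lambda>N::nat. 10000 * (1 + ln (4 * real N ^ k)) \<le> real N powr \<kappa>) sequentially"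
  proof -
    have "eventually (\<lambda>N::nat. 10000 * (1 + (ln 4 + real k * ln (real N))) \<le> real N powr \<kappa>) sequentially"
      using \<kappa>(1) by real_asymp
    then show ?thesis using eventually_ge_at_top[of 1]
      by eventually_elim (simp add: ln_mult ln_realpow)
  qed
  moreover have rb: "eventually (\<lambda>N. \<forall>j\<le>k. \<forall>m\<in>prods (block k N) j. real (reps (block k N) j m) \<le> real N powr \<kappa>) sequentially"
    using k \<kappa> by (intro reps_block_bound) auto
  ultimately have "eventually (regular k \<kappa>) sequentially"
    using ev eventually_ge_at_top[of 2]
  proof (eventually_elim)
    case (elim N)
    have "norm (osc_sum (block k N) t) \<le> real N powr (1 - 12 * \<kappa>)"
      if "real N \<le> \<bar>t\<bar>" "\<bar>t\<bar> \<le> real N ^ k" for t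
      unfolding block_eq_interval \<kappa>(3)[symmetric]
      using elim(3) that k block_length_le[OF k \<open>2 \<le> N\<close>] by auto
    then show ?case using elim k \<kappa> by (auto simp: regular_def)
  qed
  then show ?thesis using \<kappa> by blast
qed

locale regular_block =
  fixes k N :: nat and \<kappa> :: real
  assumes k: "k \<ge> 5" and \<kappa>: "0 < \<kappa>" "\<kappa> \<le> 1 / 12" and reg: "regular k \<kappa> N"
begin

abbreviation p :: "int \<Rightarrow> real" where
  "p t \<equiv> norm (osc_sum (block k N) (real_of_int t))"

lemma N2: "real N \<ge> 2" "N \<ge> 2"
  using reg by (auto simp: regular_def)

lemma powr_N_mono: "x \<le> y \<Longrightarrow> real N powr x \<le> real N powr y"
  using N2 by (intro powr_mono) auto

lemma zero_notin_block: "0 \<notin> block k N"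
  using N2 by (auto simp: block_def)

lemma p_le: "p t \<le> N"
proof -
  have "p t \<le> card (block k N)" by (rule norm_osc_sum_le_card)
  also have "\<dots> \<le> N" using block_length_le[of k N] k N2 by (simp add: card_block)
  finally show ?thesis by simp
qed

lemma p_weyl: "int N \<le> \<bar>t\<bar> \<Longrightarrow> \<bar>t\<bar> \<le> int (N ^ k) \<Longrightarrow> p t \<le> real N powr (1 - 12 * \<kappa>)"
proof -
  assume t: "int N \<le> \<bar>t\<bar>" "\<bar>t\<bar> \<le> int (N ^ k)"
  have "real N \<le> \<bar>real_of_int t\<bar>" using t(1) by linarith
  moreover have "\<bar>real_of_int t\<bar> \<le> real (N ^ k)" using t(2) by linarith
  ultimately show ?thesis using reg by (simp add: regular_def)
qed

lemma log_le: "10000 * (1 + ln (4 * real N ^ k)) \<le> real N powr \<kappa>"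
  using reg by (simp add: regular_def)

lemma ln_ge: "1 \<le> 1 + ln (4 * real N ^ k)"
proof -
  have "1 \<le> real N ^ k" using N2 by (intro one_le_power) auto
  then show ?thesis by simp
qed

lemma const_le: "10000 \<le> real N powr \<kappa>"
  using order_trans[OF _ log_le, of 10000] ln_ge by simp

lemma reps_squares:
  assumes "j \<le> k"
  shows "(\<Sum>m\<in>prods (block k N) j. (real (reps (block k N) j m))\<^sup>2) \<le> 3 * real N ^ j * real N powr (2 * \<kappa>)"
proof -
  have "(\<Sum>m\<in>prods (block k N) j. (real (reps (block k N) j m))\<^sup>2)
      \<le> (\<Sum>m\<in>prods (block k N) j. (real N powr \<kappa>)\<^sup>2)"
    using reg assms by (intro sum_mono power_mono) (auto simp: regular_def)
  also have "\<dots> = card (prods (block k N) j) * real N powr (2 * \<kappa>)"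
    using N2 by (simp add: powr_power mult.commute)
  also have "\<dots> \<le> (3 * real N ^ j) * real N powr (2 * \<kappa>)"
  proof (rule mult_right_mono)
    have "card (prods (block k N) j) \<le> card {N ^ j..3 * N ^ j}"
      using prods_block[of k j N] k assms by (intro card_mono) auto
    also have "\<dots> = 2 * N ^ j + 1" by simp
    also have "\<dots> \<le> 3 * N ^ j" using N2 by simp
    finally have "real (card (prods (block k N) j)) \<le> real (3 * N ^ j)" by (rule of_nat_mono)
    then show "real (card (prods (block k N) j)) \<le> 3 * real N ^ j" by simp
  qed simp
  finally show ?thesis .
qed

lemma osc_sum_power_block:
  "osc_sum (block k N) t ^ j = (\<Sum>m\<in>prods (block k N) j. of_real (real (reps (block k N) j m)) * cis (t * ln (real m)))"
  using osc_sum_power[OF finite_block zero_notin_block] by simp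

text \<open>
  \<open>halasz_montgomery\<close> is applied to the least power \<open>j\<close> for which the values of
  \<open>osc_sum (block k N) t ^ j\<close> are so large that the off-diagonal terms are negligible.
\<close>
lemma card_large_values:
  assumes T: "T \<ge> 1" "T \<le> N ^ (k - 2)" and \<sigma>: "0 \<le> \<sigma>" "\<sigma> \<le> 1 / 4"
  shows "card {t \<in> {- int T..int T}. real N powr (1 - \<sigma>) \<le> p t}
    \<le> real N powr (6 * \<kappa> + 2 * \<sigma>) * real T powr (\<sigma> / (1 - 2 * \<sigma>))"
proof -
  define \<tau> where "\<tau> = log N T"
  have T\<tau>: "real T = real N powr \<tau>" using T N2 by (simp add: \<tau>_def)
  have \<tau>: "0 \<le> \<tau>" "\<tau> \<le> k - 2"
  proof -
    show "0 \<le> \<tau>" using T N2 by (simp add: \<tau>_def)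
    have "real T \<le> real (N ^ (k - 2))" using T(2) by (rule of_nat_mono)
    also have "\<dots> = real N powr (k - 2)" using N2 k by (simp add: powr_realpow[symmetric] of_nat_diff)
    finally show "\<tau> \<le> k - 2" using N2 T by (simp add: \<tau>_def log_le_iff)
  qed
  \<comment> \<open>The condition \<open>j \<ge> y\<close> amounts to the inequality \<open>jpow\<close>, which makes the off-diagonal terms negligible.\<close>
  define y where "y = (3 * \<kappa> + \<tau> / 2) / (1 - 2 * \<sigma>)"
  have s2: "1 / 2 \<le> 1 - 2 * \<sigma>" using \<sigma> by simp
  have y0: "0 < y" using \<kappa> \<tau> s2 unfolding y_def by (intro divide_pos_pos) auto
  have "y \<le> (3 * \<kappa> + \<tau> / 2) / (1 / 2)"
    unfolding y_def using \<kappa> \<tau> s2 by (intro divide_left_mono mult_pos_pos) auto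
  then have yk: "y \<le> k - 3 / 2" using \<kappa> \<tau> k by (simp add: of_nat_diff)
  define j where "j = nat \<lceil>y\<rceil>"
  have j: "y \<le> j" "j \<le> y + 1" using y0 unfolding j_def by linarith+
  have jk: "j \<le> k" using j yk by linarith
  have ys: "y * (1 - 2 * \<sigma>) = 3 * \<kappa> + \<tau> / 2" using s2 by (simp add: y_def)
  define M where "M = N ^ j"
  have M1: "M \<ge> 1" using N2 by (simp add: M_def)
  have Mr: "real M = real N powr j" using N2 by (simp add: M_def powr_realpow)
  define V where "V = real N powr (j * (1 - \<sigma>))"
  have V2: "V\<^sup>2 = real M * real N powr (j * (1 - 2 * \<sigma>))"
    unfolding V_def Mr using N2 by (simp add: powr_power powr_add[symmetric] algebra_simps)
  have jpow: "real N powr (3 * \<kappa>) * sqrt T \<le> real N powr (j * (1 - 2 * \<sigma>))"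
  proof -
    have "sqrt T = real N powr (\<tau> / 2)" unfolding T\<tau> using N2 by (simp add: powr_half_sqrt[symmetric] powr_powr)
    then have "real N powr (3 * \<kappa>) * sqrt T = real N powr (y * (1 - 2 * \<sigma>))"
      unfolding ys by (simp add: powr_add)
    also have "\<dots> \<le> real N powr (j * (1 - 2 * \<sigma>))"
      using j s2 by (intro powr_N_mono mult_right_mono) auto
    finally show ?thesis .
  qed
  have M2: "2 * T \<le> M ^ 2"
  proof -
    have "2 * real T \<le> (real N powr (3 * \<kappa>))\<^sup>2 * real T"
    proof (rule mult_right_mono)
      have "2 \<le> real N powr \<kappa>" using const_le by simp
      also have "\<dots> \<le> real N powr (3 * \<kappa>)" using \<kappa> by (intro powr_N_mono) auto
      finally have "2 \<le> real N powr (3 * \<kappa>)" .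
      then have "2\<^sup>2 \<le> (real N powr (3 * \<kappa>))\<^sup>2" by (intro power_mono) auto
      then show "2 \<le> (real N powr (3 * \<kappa>))\<^sup>2" by simp
    qed simp
    also have "\<dots> = (real N powr (3 * \<kappa>) * sqrt T)\<^sup>2" by (simp add: power_mult_distrib)
    also have "\<dots> \<le> (real N powr (j * (1 - 2 * \<sigma>)))\<^sup>2" using jpow by (intro power_mono) auto
    also have "\<dots> \<le> (real N powr j)\<^sup>2"
      using \<sigma> by (intro power_mono powr_N_mono) (auto simp: mult_left_le)
    finally have "real (2 * T) \<le> real (M ^ 2)" by (simp add: Mr)
    then show ?thesis by (simp only: of_nat_le_iff)
  qed
  define S where "S = {t \<in> {- int T..int T}. real N powr (1 - \<sigma>) \<le> p t}"
  define G where "G = 3 * real M * real N powr (2 * \<kappa>)"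
  have lnT: "1 + ln (2 * real T) \<le> 1 + ln (4 * real N ^ k)"
  proof -
    have "N ^ (k - 2) \<le> N ^ k" using N2 by (intro power_increasing) auto
    then have "T \<le> N ^ k" using T by linarith
    then have "real T \<le> real (N ^ k)" by (rule of_nat_mono)
    then have "2 * real T \<le> 2 * real N ^ k" by simp
    also have "\<dots> \<le> 4 * real N ^ k" by simp
    finally have "2 * real T \<le> 4 * real N ^ k" .
    then have "ln (2 * real T) \<le> ln (4 * real N ^ k)" using T N2 by (subst ln_le_cancel_iff) auto
    then show ?thesis by simp
  qed
  have "card S * V\<^sup>2 \<le> 1000 * G * M * (1 + ln (2 * T))"
  proof (rule halasz_montgomery[OF M1 _ T(1) M2])
    show "prods (block k N) j \<subseteq> {M..3 * M}" unfolding M_def using k jk by (intro prods_block) auto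
    show "S \<subseteq> {- int T..int T}" by (auto simp: S_def)
    show "0 \<le> V" by (simp add: V_def)
    show "(\<Sum>m\<in>prods (block k N) j. (real (reps (block k N) j m))\<^sup>2) \<le> G"
      using reps_squares[OF jk] by (simp add: G_def M_def)
  next
    fix t assume "t \<in> S"
    then have "real N powr (1 - \<sigma>) \<le> p t" by (simp add: S_def)
    then have "(real N powr (1 - \<sigma>)) ^ j \<le> p t ^ j" by (intro power_mono) auto
    also have "(real N powr (1 - \<sigma>)) ^ j = V" using N2 by (simp add: V_def powr_power mult.commute)
    finally show "V \<le> norm (\<Sum>m\<in>prods (block k N) j. of_real (real (reps (block k N) j m)) * cis (real_of_int t * ln (real m)))"
      unfolding osc_sum_power_block[symmetric] by (simp add: norm_power)
  next
    have "720 * G * sqrt T = real M * (2160 * real N powr (2 * \<kappa>) * sqrt T)" by (simp add: G_def)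
    also have "\<dots> \<le> real M * (real N powr \<kappa> * real N powr (2 * \<kappa>) * sqrt T)"
      using const_le by (intro mult_left_mono mult_right_mono) auto
    also have "real N powr \<kappa> * real N powr (2 * \<kappa>) = real N powr (3 * \<kappa>)" by (simp add: powr_add[symmetric])
    also have "real M * (real N powr (3 * \<kappa>) * sqrt T) \<le> V\<^sup>2"
      unfolding V2 by (intro mult_left_mono jpow) auto
    finally show "720 * G * sqrt T \<le> V\<^sup>2" .
  qed
  also have "1000 * G * M * (1 + ln (2 * T)) = (real M)\<^sup>2 * real N powr (2 * \<kappa>) * (3000 * (1 + ln (2 * T)))"
    by (simp add: G_def power2_eq_square)
  also have "\<dots> \<le> (real M)\<^sup>2 * real N powr (2 * \<kappa>) * real N powr \<kappa>"
    using lnT log_le ln_ge by (intro mult_left_mono) auto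
  also have "\<dots> = (real M)\<^sup>2 * real N powr (3 * \<kappa>)" by (simp add: powr_add[symmetric])
  finally have "card S * V\<^sup>2 \<le> (real M)\<^sup>2 * real N powr (3 * \<kappa>)" .
  then have "card S \<le> (real M)\<^sup>2 * real N powr (3 * \<kappa>) / V\<^sup>2"
    using N2 by (simp add: V_def field_simps)
  also have "\<dots> = real M * real N powr (3 * \<kappa>) / real N powr (j * (1 - 2 * \<sigma>))"
    unfolding V2 using M1 by (simp add: power2_eq_square)
  also have "\<dots> = real N powr (3 * \<kappa> + 2 * \<sigma> * j)"
    unfolding Mr by (simp add: powr_add[symmetric] powr_diff[symmetric] algebra_simps)
  also have "\<dots> \<le> real N powr (6 * \<kappa> + 2 * \<sigma> + \<tau> * (\<sigma> / (1 - 2 * \<sigma>)))"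
  proof (rule powr_N_mono)
    have "2 * \<sigma> * j \<le> 2 * \<sigma> * (y + 1)" using j \<sigma> by (intro mult_left_mono) auto
    also have "2 * \<sigma> * y = 2 * \<sigma> / (1 - 2 * \<sigma>) * (3 * \<kappa>) + \<tau> * (\<sigma> / (1 - 2 * \<sigma>))"
    proof -
      have "y = 3 * \<kappa> * (1 / b) + \<tau> / 2 * (1 / b)" if "b = 1 - 2 * \<sigma>" for b
        unfolding y_def that[symmetric] by (simp add: add_divide_distrib)
      then have yeq: "y = 3 * \<kappa> * (1 / (1 - 2 * \<sigma>)) + \<tau> / 2 * (1 / (1 - 2 * \<sigma>))" by blast
      have "2 * \<sigma> * y = 2 * (\<sigma> * (1 / (1 - 2 * \<sigma>))) * (3 * \<kappa>) + \<tau> * (\<sigma> * (1 / (1 - 2 * \<sigma>)))"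
      proof -
        have "2 * \<sigma> * (3 * \<kappa> * z + \<tau> / 2 * z) = 2 * (\<sigma> * z) * (3 * \<kappa>) + \<tau> * (\<sigma> * z)" for z
          by (simp add: algebra_simps)
        then show ?thesis unfolding yeq by blast
      qed
      then show ?thesis by simp
    qed
    then have "2 * \<sigma> * (y + 1) = 2 * \<sigma> / (1 - 2 * \<sigma>) * (3 * \<kappa>) + \<tau> * (\<sigma> / (1 - 2 * \<sigma>)) + 2 * \<sigma>"
      by (simp add: algebra_simps)
    also have "2 * \<sigma> / (1 - 2 * \<sigma>) * (3 * \<kappa>) \<le> 1 * (3 * \<kappa>)"
      using \<sigma> s2 \<kappa> by (intro mult_right_mono) (auto simp: field_simps)
    finally show "3 * \<kappa> + 2 * \<sigma> * j \<le> 6 * \<kappa> + 2 * \<sigma> + \<tau> * (\<sigma> / (1 - 2 * \<sigma>))" by simp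
  qed
  also have "\<dots> = real N powr (6 * \<kappa> + 2 * \<sigma>) * real T powr (\<sigma> / (1 - 2 * \<sigma>))"
    unfolding T\<tau> by (simp add: powr_add powr_powr)
  finally show ?thesis by (simp add: S_def)
qed

text \<open>
  The exponent \<open>\<sigma>\<close> in \<open>p t = N powr (1 - \<sigma>)\<close>.
\<close>
definition excess :: "int \<Rightarrow> real" where
  "excess t = 1 - log N (p t)"

lemma p_eq_powr: "0 < p t \<Longrightarrow> p t = real N powr (1 - excess t)"
  using N2 by (simp add: excess_def)

text \<open>
  The condition on \<open>T\<close> is the one under which, by \<open>card_large_values\<close>, values as large as \<open>p t\<close> occur
  at most about \<open>N powr ((k - 2) * excess t)\<close> times.
\<close>
definition peaks :: "nat \<Rightarrow> int set" where
  "peaks T = {t \<in> {- int T..int T}. int N \<le> \<bar>t\<bar> \<and> real N powr (3 / 4) \<le> p t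
     \<and> real T \<le> real N powr ((real k - 4) * (1 - 2 * excess t))}"

lemma excess_bounds:
  assumes "real N powr (3 / 4) \<le> p t"
  shows "0 \<le> excess t" "excess t \<le> 1 / 4" "0 < p t"
proof -
  show pos: "0 < p t" using assms N2 by (smt (verit) powr_gt_zero)
  have "log N (p t) \<le> 1" using pos p_le[of t] N2 by (simp add: log_le_iff)
  then show "0 \<le> excess t" by (simp add: excess_def)
  have "3 / 4 \<le> log N (p t)" using le_log_iff[of "real N" "p t" "3 / 4"] pos assms N2 by linarith
  then show "excess t \<le> 1 / 4" by (simp add: excess_def)
qed

lemma card_values_above:
  assumes T: "T \<ge> 1" "T \<le> N ^ (k - 2)" and S: "S \<subseteq> {- int T..int T}" and t: "real N powr (3 / 4) \<le> p t"
    and a: "a > 0"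
  shows "card {s \<in> S. p t ^ a \<le> p s ^ a}
    \<le> real N powr (6 * \<kappa> + 2 * excess t) * real T powr (excess t / (1 - 2 * excess t))"
proof -
  note e = excess_bounds[OF t]
  have "{s \<in> S. p t ^ a \<le> p s ^ a} \<subseteq> {s \<in> {- int T..int T}. real N powr (1 - excess t) \<le> p s}"
  proof
    fix s assume s: "s \<in> {s \<in> S. p t ^ a \<le> p s ^ a}"
    then have "p t \<le> p s" using a power_mono_iff[of "p t" "p s" a] by simp
    then show "s \<in> {s \<in> {- int T..int T}. real N powr (1 - excess t) \<le> p s}"
      using s S p_eq_powr[OF e(3)] by auto
  qed
  moreover have "finite {s \<in> {- int T..int T}. real N powr (1 - excess t) \<le> p s}"
    by (rule finite_subset[of _ "{- int T..int T}"]) auto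
  ultimately have "card {s \<in> S. p t ^ a \<le> p s ^ a} \<le> card {s \<in> {- int T..int T}. real N powr (1 - excess t) \<le> p s}"
    by (intro card_mono)
  then have "real (card {s \<in> S. p t ^ a \<le> p s ^ a})
     \<le> real (card {s \<in> {- int T..int T}. real N powr (1 - excess t) \<le> p s})" by (rule of_nat_mono)
  then show ?thesis using card_large_values[OF T e(1,2)] by (rule order_trans)
qed

lemma log_card_le:
  assumes T: "T \<ge> 1" "T \<le> N ^ k" and S: "S \<subseteq> {- int T..int T}" "S \<noteq> {}"
  shows "1 + ln (card S) \<le> real N powr \<kappa>" "0 \<le> 1 + ln (card S)"
proof -
  have fin: "finite S" using S finite_subset by blast
  have c0: "card S > 0" using fin S by (simp add: card_gt_0_iff)
  then show "0 \<le> 1 + ln (card S)" by (simp add: add_nonneg_nonneg)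
  have "card S \<le> card {- int T..int T}" using S by (intro card_mono) auto
  also have "\<dots> = 2 * T + 1" by simp
  also have "\<dots> \<le> 4 * N ^ k" using T by simp
  finally have "real (card S) \<le> real (4 * N ^ k)" by (rule of_nat_mono)
  then have "ln (card S) \<le> ln (4 * real N ^ k)" using c0 N2 by (subst ln_le_cancel_iff) auto
  then show "1 + ln (card S) \<le> real N powr \<kappa>" using log_le ln_ge by (simp add: algebra_simps)
qed

lemma T_le_power: "T \<le> N ^ (k - 2) \<Longrightarrow> T \<le> N ^ k"
proof -
  assume "T \<le> N ^ (k - 2)"
  also have "\<dots> \<le> N ^ k" using N2 by (intro power_increasing) auto
  finally show ?thesis .
qed

text \<open>
  A value \<open>N powr (1 - \<sigma>)\<close> contributes \<open>N powr (k * (1 - \<sigma>))\<close> and occurs at most about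
  \<open>N powr ((k - 2) * \<sigma>)\<close> times. The product saves \<open>N powr (2 * \<sigma>)\<close>, and \<open>\<sigma> \<ge> 12 * \<kappa>\<close> by Weyl's bound.
\<close>
lemma sum_peaks:
  assumes T: "T \<ge> 1" "T \<le> N ^ (k - 2)"
  shows "(\<Sum>t\<in>peaks T. p t ^ k) \<le> real N powr (k - 17 * \<kappa>)"
proof (cases "peaks T = {}")
  case False
  have sub: "peaks T \<subseteq> {- int T..int T}" by (auto simp: peaks_def)
  have fin: "finite (peaks T)" using sub finite_subset by blast
  have "card {s \<in> peaks T. p t ^ k \<le> p s ^ k} * p t ^ k \<le> real N powr (k - 18 * \<kappa>)"
    if t: "t \<in> peaks T" for t
  proof -
    have t': "int N \<le> \<bar>t\<bar>" "\<bar>t\<bar> \<le> int T" "real N powr (3 / 4) \<le> p t"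
      "real T \<le> real N powr ((real k - 4) * (1 - 2 * excess t))"
      using t by (auto simp: peaks_def)
    note e = excess_bounds[OF t'(3)]
    define \<sigma> where "\<sigma> = excess t"
    have \<sigma>: "0 \<le> \<sigma>" "\<sigma> \<le> 1 / 4" using e by (auto simp: \<sigma>_def)
    have "p t \<le> real N powr (1 - 12 * \<kappa>)"
      using t' T_le_power[OF T(2)] by (intro p_weyl) linarith+
    then have "real N powr (1 - \<sigma>) \<le> real N powr (1 - 12 * \<kappa>)"
      using p_eq_powr[OF e(3)] by (simp add: \<sigma>_def)
    then have \<sigma>c: "12 * \<kappa> \<le> \<sigma>" using N2 by simp
    have "real T powr (\<sigma> / (1 - 2 * \<sigma>)) \<le> (real N powr ((real k - 4) * (1 - 2 * \<sigma>))) powr (\<sigma> / (1 - 2 * \<sigma>))"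
      using t'(4) \<sigma> by (intro powr_mono2) (auto simp: \<sigma>_def)
    also have "\<dots> = real N powr ((real k - 4) * \<sigma>)" using \<sigma> by (simp add: powr_powr)
    finally have Tp: "real T powr (\<sigma> / (1 - 2 * \<sigma>)) \<le> real N powr ((real k - 4) * \<sigma>)" .
    have "card {s \<in> peaks T. p t ^ k \<le> p s ^ k} * p t ^ k
       \<le> (real N powr (6 * \<kappa> + 2 * \<sigma>) * real T powr (\<sigma> / (1 - 2 * \<sigma>))) * p t ^ k"
      using card_values_above[OF T sub t'(3), of k] k by (intro mult_right_mono) (auto simp: \<sigma>_def)
    also have "\<dots> \<le> (real N powr (6 * \<kappa> + 2 * \<sigma>) * real N powr ((real k - 4) * \<sigma>)) * p t ^ k"
      by (intro mult_right_mono mult_left_mono Tp) auto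
    also have "\<dots> = real N powr (k + 6 * \<kappa> - 2 * \<sigma>)"
    proof -
      have "p t ^ k = real N powr (k * (1 - \<sigma>))"
        using p_eq_powr[OF e(3)] N2 by (simp add: \<sigma>_def powr_power mult.commute)
      then show ?thesis by (simp add: powr_add[symmetric] algebra_simps)
    qed
    also have "\<dots> \<le> real N powr (k - 18 * \<kappa>)" using \<sigma>c by (intro powr_N_mono) simp
    finally show ?thesis .
  qed
  then have "(\<Sum>t\<in>peaks T. p t ^ k) \<le> real N powr (k - 18 * \<kappa>) * (1 + ln (card (peaks T)))"
    using fin False by (intro sum_le_of_weak_type) auto
  also have "\<dots> \<le> real N powr (k - 18 * \<kappa>) * real N powr \<kappa>"
    using log_card_le[OF T(1) T_le_power[OF T(2)] sub False] by (intro mult_left_mono) auto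
  also have "\<dots> = real N powr (k - 17 * \<kappa>)" by (simp add: powr_add[symmetric])
  finally show ?thesis .
qed simp

text \<open>
  The mean value estimate is applied to the power \<open>j\<close> with \<open>N ^ j \<le> T < N ^ (j + 1)\<close>, for which its two
  terms balance; the remaining factors are bounded pointwise.
\<close>
lemma sum_small_values:
  assumes T: "T \<ge> 1" "T \<le> N ^ (k - 2)"
    and S: "S \<subseteq> {- int T..int T}" "\<And>t. t \<in> S \<Longrightarrow> p t \<le> real N powr (3 / 4)"
  shows "(\<Sum>t\<in>S. p t ^ (2 * k)) \<le> real N powr (3 * k / 2 + 1) * sqrt T"
proof -
  define j where "j = nat \<lfloor>log N T\<rfloor>"
  have lT: "0 \<le> log N T" using T N2 by simp
  have j: "j \<le> log N T" "log N T < j + 1" using lT unfolding j_def by linarith+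
  have Tlog: "real T = real N powr (log N T)" using T N2 by simp
  have jT: "real N powr j \<le> T" "T \<le> real N powr (j + 1)"
    using powr_N_mono[of "real j" "log N T"] powr_N_mono[of "log N T" "j + 1"] j Tlog by simp_all
  have jk: "j \<le> k"
  proof -
    have "real T \<le> real (N ^ k)" using T_le_power[OF T(2)] by (rule of_nat_mono)
    then have "log N T \<le> k" using T N2 by (simp add: log_le_iff powr_realpow)
    then show ?thesis using j by linarith
  qed
  have Nj: "N ^ j \<le> T"
  proof -
    have "real (N ^ j) \<le> real T" using jT N2 by (simp add: powr_realpow)
    then show ?thesis by (simp only: of_nat_le_iff)
  qed
  let ?r = "\<lambda>m. complex_of_real (real (reps (block k N) j m))"
  have "(\<Sum>t\<in>{- int (3 * T)..int (3 * T)}. (norm (\<Sum>m\<in>prods (block k N) j. ?r m * cis (t * ln (real m))))\<^sup>2)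
     \<le> 68 * real (3 * T) * (\<Sum>m\<in>prods (block k N) j. (norm (?r m))\<^sup>2)"
  proof (rule mean_value[where \<delta> = "1 / (3 * real T)"])
    show "finite (prods (block k N) j)" by (intro finite_prods finite_block)
    show "0 < 1 / (3 * real T)" "1 \<le> real (3 * T) * (1 / (3 * real T))" using T by auto
  next
    fix m m' assume m: "m \<in> prods (block k N) j" "m' \<in> prods (block k N) j"
    have sub: "prods (block k N) j \<subseteq> {N ^ j..3 * N ^ j}" using k jk by (intro prods_block) auto
    have mb: "N ^ j \<le> m" "m \<le> 3 * N ^ j" "N ^ j \<le> m'" "m' \<le> 3 * N ^ j" using m sub by auto
    have N1: "1 \<le> N ^ j" using N2 by (intro one_le_power) auto
    have m0: "1 \<le> m" "1 \<le> m'" using mb N1 by linarith+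
    have gap: "1 / (3 * real T) \<le> ln a - ln b" if "b < a" "1 \<le> b" "a \<le> 3 * N ^ j" for a b :: nat
    proof -
      have "ln (real b / real a) \<le> real b / real a - 1" using that by (intro ln_le_minus_one) auto
      also have "\<dots> = - ((real a - real b) / real a)" using that by (simp add: diff_divide_distrib)
      also have "\<dots> \<le> - (1 / real a)" using that by (simp add: divide_right_mono)
      also have "\<dots> \<le> - (1 / (3 * real T))"
      proof -
        have "a \<le> 3 * T" using that Nj by linarith
        then have "real a \<le> 3 * real T" by linarith
        then have "1 / (3 * real T) \<le> 1 / real a" using that by (intro divide_left_mono mult_pos_pos) auto
        then show ?thesis by simp
      qed
      finally show ?thesis using that by (simp add: ln_div)
    qed
    show "\<bar>ln (real m) - ln (real m')\<bar> \<le> pi"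
    proof -
      have "ln (real a) - ln (real b) \<le> pi" if "a \<le> 3 * b" "1 \<le> b" "1 \<le> a" for a b :: nat
      proof -
        have "ln (real a) \<le> ln (real (3 * b))" using that by (subst ln_le_cancel_iff) auto
        also have "\<dots> = ln 3 + ln (real b)" using that by (simp add: ln_mult)
        finally show ?thesis using ln_le_minus_one[of "3::real"] pi_ge_two by simp
      qed
      from this[of m m'] this[of m' m] show ?thesis using mb m0 by linarith
    qed
    assume "m \<noteq> m'"
    then consider "m < m'" | "m' < m" by linarith
    then show "1 / (3 * real T) \<le> \<bar>ln (real m) - ln (real m')\<bar>"
      using gap[of m m'] gap[of m' m] mb m0 by cases auto
  qed
  also have "\<dots> = 204 * real T * (\<Sum>m\<in>prods (block k N) j. (real (reps (block k N) j m))\<^sup>2)" by simp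
  also have "\<dots> \<le> 204 * real T * (3 * real N ^ j * real N powr (2 * \<kappa>))"
    by (intro mult_left_mono reps_squares jk) auto
  also have "real N ^ j = real N powr j" using N2 by (simp add: powr_realpow)
  finally have mv: "(\<Sum>t\<in>{- int (3 * T)..int (3 * T)}. p t ^ (2 * j)) \<le> 612 * real T * (real N powr j * real N powr (2 * \<kappa>))"
    unfolding osc_sum_power_block[symmetric] by (simp add: norm_power power_mult[symmetric] mult.commute)
  have "(\<Sum>t\<in>S. p t ^ (2 * k)) \<le> (\<Sum>t\<in>S. real N powr (3 / 2 * (k - j)) * p t ^ (2 * j))"
  proof (rule sum_mono)
    fix t assume t: "t \<in> S"
    have "p t ^ (2 * k) = p t ^ (2 * (k - j)) * p t ^ (2 * j)"
      using jk by (simp add: power_add[symmetric] add_mult_distrib2[symmetric])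
    also have "\<dots> \<le> (real N powr (3 / 4)) ^ (2 * (k - j)) * p t ^ (2 * j)"
      using S(2)[OF t] by (intro mult_right_mono power_mono) auto
    also have "(real N powr (3 / 4)) ^ (2 * (k - j)) = real N powr (3 / 2 * (k - j))"
      using N2 by (simp add: powr_power)
    finally show "p t ^ (2 * k) \<le> real N powr (3 / 2 * (k - j)) * p t ^ (2 * j)" .
  qed
  also have "\<dots> = real N powr (3 / 2 * (k - j)) * (\<Sum>t\<in>S. p t ^ (2 * j))" by (simp add: sum_distrib_left)
  also have "(\<Sum>t\<in>S. p t ^ (2 * j)) \<le> (\<Sum>t\<in>{- int (3 * T)..int (3 * T)}. p t ^ (2 * j))"
    using S by (intro sum_mono2) force+
  also note mv
  also have "612 * real T * (real N powr j * real N powr (2 * \<kappa>)) \<le> real N powr \<kappa> * real T * (real N powr j * real N powr (2 * \<kappa>))"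
    using const_le by (intro mult_right_mono) auto
  also have "real N powr (3 / 2 * (k - j)) * (real N powr \<kappa> * real T * (real N powr j * real N powr (2 * \<kappa>)))
      = real N powr (3 * k / 2 - j / 2 + 3 * \<kappa>) * (sqrt T * sqrt T)"
    using jk by (simp add: powr_add[symmetric] of_nat_diff algebra_simps diff_divide_distrib)
  also have "\<dots> \<le> real N powr (3 * k / 2 - j / 2 + 3 * \<kappa>) * (real N powr (j / 2 + 1 / 2) * sqrt T)"
  proof (intro mult_left_mono mult_right_mono)
    have "sqrt T \<le> sqrt (real N powr (j + 1))" using jT by simp
    then show "sqrt T \<le> real N powr (j / 2 + 1 / 2)"
      using N2 by (simp add: powr_half_sqrt[symmetric] powr_powr add_divide_distrib add.commute)
  qed auto
  also have "\<dots> = real N powr (3 * k / 2 + 3 * \<kappa> + 1 / 2) * sqrt T"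
    by (simp add: powr_add[symmetric] algebra_simps)
  also have "\<dots> \<le> real N powr (3 * k / 2 + 1) * sqrt T"
    using \<kappa> by (intro mult_right_mono powr_N_mono) auto
  finally show ?thesis by (simp add: mult_left_mono)
qed

text \<open>
  The lower bound on \<open>T\<close> turns the estimate of \<open>card_large_values\<close> into one that is uniform in
  \<open>excess t\<close>: the exponent of \<open>T\<close> falls short of \<open>1 / 2\<close> by \<open>(1 - 4 * \<sigma>) / (2 * (1 - 2 * \<sigma>))\<close>, and this part
  of \<open>T\<close> is at least \<open>N powr ((k - 4) * (1 - 4 * \<sigma>) / 2)\<close>.
\<close>
lemma sum_moderate_values:
  assumes T: "T \<ge> 1" "T \<le> N ^ (k - 2)"
    and S: "S \<subseteq> {- int T..int T}" "\<And>t. t \<in> S \<Longrightarrow> real N powr (3 / 4) \<le> p t"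
      "\<And>t. t \<in> S \<Longrightarrow> real N powr ((real k - 4) * (1 - 2 * excess t)) \<le> T"
  shows "(\<Sum>t\<in>S. p t ^ (2 * k)) \<le> real N powr (3 * k / 2 + 3) * sqrt T"
proof (cases "S = {}")
  case False
  have fin: "finite S" using S finite_subset by blast
  define \<tau> where "\<tau> = log N T"
  have T\<tau>: "real T = real N powr \<tau>" using T N2 by (simp add: \<tau>_def)
  let ?B = "real N powr (3 * k / 2 + \<tau> / 2 + 5 / 2)"
  have "card {s \<in> S. p t ^ (2 * k) \<le> p s ^ (2 * k)} * p t ^ (2 * k) \<le> ?B" if t: "t \<in> S" for t
  proof -
    note e = excess_bounds[OF S(2)[OF t]]
    define \<sigma> where "\<sigma> = excess t"
    have \<sigma>: "0 \<le> \<sigma>" "\<sigma> \<le> 1 / 4" using e by (auto simp: \<sigma>_def)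
    have "real N powr ((real k - 4) * (1 - 2 * \<sigma>)) \<le> real N powr \<tau>" using S(3)[OF t] T\<tau> by (simp add: \<sigma>_def)
    then have \<tau>: "(real k - 4) * (1 - 2 * \<sigma>) \<le> \<tau>" using N2 by simp
    have "card {s \<in> S. p t ^ (2 * k) \<le> p s ^ (2 * k)} * p t ^ (2 * k)
       \<le> (real N powr (6 * \<kappa> + 2 * \<sigma>) * real T powr (\<sigma> / (1 - 2 * \<sigma>))) * p t ^ (2 * k)"
      using card_values_above[OF T S(1) S(2)[OF t], of "2 * k"] k by (intro mult_right_mono) (auto simp: \<sigma>_def)
    also have "\<dots> = real N powr (6 * \<kappa> + 2 * \<sigma> + \<tau> * (\<sigma> / (1 - 2 * \<sigma>)) + 2 * k * (1 - \<sigma>))"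
    proof -
      have "p t ^ (2 * k) = real N powr (2 * k * (1 - \<sigma>))"
        using p_eq_powr[OF e(3)] N2 by (simp add: \<sigma>_def powr_power mult.commute)
      then show ?thesis unfolding T\<tau> by (simp add: powr_add powr_powr)
    qed
    also have "\<dots> \<le> ?B"
    proof (rule powr_N_mono)
      have pos: "0 < 1 - 2 * \<sigma>" using \<sigma> by simp
      have "(real k - 4) * (1 - 2 * \<sigma>) * ((1 - 4 * \<sigma>) / (2 * (1 - 2 * \<sigma>))) \<le> \<tau> * ((1 - 4 * \<sigma>) / (2 * (1 - 2 * \<sigma>)))"
        using \<sigma> \<tau> by (intro mult_right_mono) auto
      also have "\<tau> * ((1 - 4 * \<sigma>) / (2 * (1 - 2 * \<sigma>))) = \<tau> / 2 - \<tau> * (\<sigma> / (1 - 2 * \<sigma>))"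
        using pos by (simp add: field_simps)
      also have "(real k - 4) * (1 - 2 * \<sigma>) * ((1 - 4 * \<sigma>) / (2 * (1 - 2 * \<sigma>))) = (real k - 4) * (1 - 4 * \<sigma>) / 2"
        using pos by (simp add: field_simps)
      finally have "(real k - 4) * (1 - 4 * \<sigma>) / 2 \<le> \<tau> / 2 - \<tau> * (\<sigma> / (1 - 2 * \<sigma>))" using k by (simp add: of_nat_diff)
      moreover have "(real k - 4) * (1 - 4 * \<sigma>) / 2 = k / 2 - 2 * (k * \<sigma>) - 2 + 8 * \<sigma>"
        by (simp add: algebra_simps diff_divide_distrib add_divide_distrib)
      moreover have "2 * k * (1 - \<sigma>) = 2 * k - 2 * (k * \<sigma>)" by (simp add: algebra_simps)
      ultimately show "6 * \<kappa> + 2 * \<sigma> + \<tau> * (\<sigma> / (1 - 2 * \<sigma>)) + 2 * k * (1 - \<sigma>) \<le> 3 * k / 2 + \<tau> / 2 + 5 / 2"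
        using \<kappa> \<sigma> by linarith
    qed
    finally show ?thesis .
  qed
  then have "(\<Sum>t\<in>S. p t ^ (2 * k)) \<le> ?B * (1 + ln (card S))"
    using fin False by (intro sum_le_of_weak_type) auto
  also have "\<dots> \<le> ?B * real N powr \<kappa>"
    using log_card_le[OF T(1) T_le_power[OF T(2)] S(1) False] by (intro mult_left_mono) auto
  also have "\<dots> = real N powr (3 * k / 2 + 5 / 2 + \<kappa>) * real N powr (\<tau> / 2)"
    by (simp add: powr_add[symmetric] algebra_simps)
  also have "real N powr (\<tau> / 2) = sqrt T"
    unfolding T\<tau> using N2 by (simp add: powr_half_sqrt[symmetric] powr_powr)
  also have "real N powr (3 * k / 2 + 5 / 2 + \<kappa>) * sqrt T \<le> real N powr (3 * k / 2 + 3) * sqrt T"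
    using \<kappa> by (intro mult_right_mono powr_N_mono) auto
  finally show ?thesis .
qed simp

lemma sum_off_peaks:
  assumes T: "T \<ge> 1" "T \<le> N ^ (k - 2)"
  shows "(\<Sum>t\<in>{t \<in> {- int T..int T}. int N \<le> \<bar>t\<bar>} - peaks T. p t ^ (2 * k)) \<le> real N powr (3 * k / 2 + 4) * sqrt T"
proof -
  let ?U = "{t \<in> {- int T..int T}. int N \<le> \<bar>t\<bar>} - peaks T"
  let ?A = "{t \<in> ?U. p t \<le> real N powr (3 / 4)}" and ?B = "{t \<in> ?U. \<not> p t \<le> real N powr (3 / 4)}"
  have "(\<Sum>t\<in>?U. p t ^ (2 * k)) = (\<Sum>t\<in>?A \<union> ?B. p t ^ (2 * k))" by (rule sum.cong) auto
  also have "\<dots> = (\<Sum>t\<in>?A. p t ^ (2 * k)) + (\<Sum>t\<in>?B. p t ^ (2 * k))"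
    by (rule sum.union_disjoint; (rule finite_subset[of _ "{- int T..int T}"])?) auto
  also have "\<dots> \<le> real N powr (3 * k / 2 + 1) * sqrt T + real N powr (3 * k / 2 + 3) * sqrt T"
    by (intro add_mono sum_small_values[OF T] sum_moderate_values[OF T]) (auto simp: peaks_def)
  also have "\<dots> \<le> real N powr (3 * k / 2 + 3) * sqrt T + real N powr (3 * k / 2 + 3) * sqrt T"
    by (intro add_mono mult_right_mono powr_N_mono) auto
  also have "\<dots> = 2 * real N powr (3 * k / 2 + 3) * sqrt T" by simp
  also have "\<dots> \<le> real N * real N powr (3 * k / 2 + 3) * sqrt T"
    using N2 by (intro mult_right_mono) auto
  also have "real N * real N powr (3 * k / 2 + 3) = real N powr (3 * k / 2 + 4)"
    using N2 by (simp add: powr_mult_base add.commute)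
  finally show ?thesis .
qed

end

section \<open>Counting long intervals without products\<close>

text \<open>The logarithm of the point around which the products of \<open>k\<close> elements of the block are centred.\<close>
definition centre :: "nat \<Rightarrow> nat \<Rightarrow> real" where
  "centre k N = k * ln N + 1 / 2"

text \<open>A lower bound, up to the factor \<open>N ^ k\<close>, for the smoothed number of products near the centre.\<close>
definition mass :: "nat \<Rightarrow> real" where
  "mass k = (1 / (8 * real k)) ^ (k - 1) / 4"

text \<open>
  The first lower bound makes the kernel narrow enough for \<open>smoothed_count_lower\<close>, the second makes the low
  frequencies negligible in \<open>off_peak_frequencies_large\<close>.
\<close>
definition base_degree :: "nat \<Rightarrow> nat" where
  "base_degree k = nat \<lceil>max (8 * real k) (16 * 40 ^ k / mass k)\<rceil>"

lemma mass_bounds: "k \<ge> 1 \<Longrightarrow> 0 < mass k" "k \<ge> 1 \<Longrightarrow> mass k \<le> 1"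
proof -
  assume k: "k \<ge> 1"
  show "0 < mass k" using k by (simp add: mass_def)
  have "(1 / (8 * real k)) ^ (k - 1) \<le> 1" using k by (intro power_le_one) auto
  then show "mass k \<le> 1" by (simp add: mass_def)
qed

lemma base_degree_bounds:
  assumes "k \<ge> 1"
  shows "8 * real k \<le> base_degree k" "16 * 40 ^ k / mass k \<le> base_degree k" "base_degree k \<ge> 1"
proof -
  have "max (8 * real k) (16 * 40 ^ k / mass k) \<le> base_degree k"
    unfolding base_degree_def by (rule of_nat_ceiling)
  then show a: "8 * real k \<le> base_degree k" "16 * 40 ^ k / mass k \<le> base_degree k" by auto
  have "0 < real (base_degree k)" using a(1) assms by linarith
  then show "base_degree k \<ge> 1" by simp
qed

context regular_block
begin

abbreviation r :: "nat \<Rightarrow> real" where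
  "r m \<equiv> real (reps (block k N) k m)"

text \<open>
  The kernel of degree \<open>J\<close> counts the words whose product is within a factor of about \<open>exp (1 / J)\<close> of \<open>exp u\<close>.
\<close>
definition smoothed_count :: "nat \<Rightarrow> real \<Rightarrow> real" where
  "smoothed_count J u = (\<Sum>xs\<in>words (block k N) k. fejer J (u - ln (real (prod_list xs))))"

lemma smoothed_count_reps:
  "smoothed_count J u = (\<Sum>m\<in>prods (block k N) k. r m * fejer J (u - ln (real m)))"
  unfolding smoothed_count_def
  by (rule sum_words_eq_sum_reps[OF finite_block, where g = "\<lambda>m. fejer J (u - ln (real m))"])

lemma smoothed_count_fourier:
  fixes u :: real
  assumes "J \<ge> 1" "J \<le> T"
  shows "complex_of_real (smoothed_count J u)
    = (\<Sum>t\<in>{- int T..int T}. complex_of_real (fejer_weight J t) * cis (t * u) * cnj (osc_sum (block k N) t ^ k))"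
proof -
  have cd: "cis (x - y) = cis x * cis (- y)" for x y by (simp add: cis_mult)
  have "complex_of_real (smoothed_count J u)
    = (\<Sum>xs\<in>words (block k N) k. \<Sum>t\<in>{- int T..int T}. complex_of_real (fejer_weight J t) * cis (t * (u - ln (real (prod_list xs)))))"
    unfolding smoothed_count_def of_real_sum by (intro sum.cong refl fejer_fourier assms)
  also have "\<dots> = (\<Sum>t\<in>{- int T..int T}. \<Sum>xs\<in>words (block k N) k. complex_of_real (fejer_weight J t) * cis (t * (u - ln (real (prod_list xs)))))"
    by (rule sum.swap)
  also have "\<dots> = (\<Sum>t\<in>{- int T..int T}. complex_of_real (fejer_weight J t) * cis (t * u) * cnj (osc_sum (block k N) t ^ k))"
  proof (intro sum.cong refl)
    fix t :: int
    show "(\<Sum>xs\<in>words (block k N) k. complex_of_real (fejer_weight J t) * cis (t * (u - ln (real (prod_list xs)))))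
      = complex_of_real (fejer_weight J t) * cis (t * u) * cnj (osc_sum (block k N) t ^ k)"
      unfolding osc_sum_power_words[OF finite_block zero_notin_block] cnj_sum cis_cnj right_diff_distrib cd
        sum_distrib_left by (simp add: mult.assoc)
  qed
  finally show ?thesis .
qed

text \<open>
  The interval of the logarithms of the block contains \<open>[ln N, ln N + 3 / (4 * k)]\<close>, and integers
  are dense in it at every scale above \<open>1 / N\<close>.
\<close>
lemma card_block_near:
  fixes a s :: real
  assumes a: "ln N \<le> a - s" "a + s \<le> ln N + 3 / (4 * k)" and s: "1 \<le> s * N" and N: "8 * k \<le> N"
  shows "s * N \<le> card {n \<in> block k N. \<bar>ln (real n) - a\<bar> \<le> s}"
proof -
  have s0: "0 < s"
  proof (rule ccontr)
    assume "\<not> 0 < s"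
    then have "s * N \<le> 0" by (intro mult_nonpos_nonneg) auto
    then show False using s by linarith
  qed
  define L where "L = \<lceil>exp (a - s)\<rceil>"
  define R where "R = \<lfloor>exp (a + s)\<rfloor>"
  have "exp (ln (real N)) \<le> exp (a - s)" using a(1) by simp
  then have NL: "real N \<le> exp (a - s)" using N2 by simp
  have "0 < exp (a - s)" by simp
  then have L0: "0 < L" unfolding L_def by linarith
  have kr: "real k \<ge> 5" using k by simp
  have up: "exp (a + s) \<le> N + N div k"
  proof -
    define z where "z = 3 / (4 * real k)"
    have z: "0 \<le> z" "z \<le> 1" using kr by (auto simp: z_def field_simps)
    have "exp (a + s) \<le> exp (ln N + z)" using a(2) by (simp add: z_def)
    also have "\<dots> = N * exp z" using N2 by (simp add: exp_add)
    also have "\<dots> \<le> N * (1 + z + z\<^sup>2)" using z by (intro mult_left_mono exp_bound) auto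
    also have "\<dots> \<le> N + (N / k - 1)"
    proof -
      have "z\<^sup>2 \<le> z * (3 / 20)" unfolding power2_eq_square using z kr
        by (intro mult_left_mono) (auto simp: z_def field_simps)
      then have "z + z\<^sup>2 \<le> z * (23 / 20)" by simp
      also have "\<dots> = 69 / 80 * (1 / k)" by (simp add: z_def)
      also have "\<dots> \<le> 7 / 8 * (1 / k)" by (intro mult_right_mono) auto
      finally have "N * (z + z\<^sup>2) \<le> N * (7 / 8 * (1 / k))" by (intro mult_left_mono) auto
      also have "\<dots> = N / k - N / (8 * k)" using kr by (simp add: field_simps)
      finally have "N * (z + z\<^sup>2) \<le> N / k - N / (8 * k)" .
      moreover have "1 \<le> N / (8 * real k)"
      proof -
        have "real (8 * k) \<le> real N" using N by (rule of_nat_mono)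
        then show ?thesis using kr by (simp add: field_simps)
      qed
      ultimately have "N * (z + z\<^sup>2) \<le> N / k - 1" by linarith
      then show ?thesis by (simp add: algebra_simps)
    qed
    also have "N / k - 1 \<le> N div k"
    proof -
      have "N = k * (N div k) + N mod k" by (rule mult_div_mod_eq[symmetric])
      moreover have "N mod k < k" using k by simp
      moreover have "k * (N div k + 1) = k * (N div k) + k" by simp
      ultimately have "N \<le> k * (N div k + 1)" by linarith
      then have "real N \<le> real (k * (N div k + 1))" by (rule of_nat_mono)
      then have "real N \<le> k * (real (N div k) + 1)" by (simp add: algebra_simps)
      then have "real N / k \<le> real (N div k) + 1" using kr by (simp add: field_simps)
      then show ?thesis by simp
    qed
    finally show ?thesis by simp
  qed
  have "{nat L..nat R} \<subseteq> {n \<in> block k N. \<bar>ln (real n) - a\<bar> \<le> s}"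
  proof
    fix n assume n: "n \<in> {nat L..nat R}"
    have n1: "exp (a - s) \<le> n" using n L0 unfolding L_def by (simp add: nat_le_iff) linarith
    have R0: "0 < R" using n L0 by auto
    then have n2: "n \<le> exp (a + s)" using n unfolding R_def by (simp add: le_nat_iff) linarith
    have n0: "0 < real n" using n1 \<open>0 < exp (a - s)\<close> by linarith
    have "a - s \<le> ln n" using n1 n0 by (simp add: ln_ge_iff)
    moreover have "ln n \<le> a + s" using n2 n0 by (metis exp_gt_zero ln_exp ln_le_cancel_iff)
    moreover have "N \<le> n"
    proof -
      have "real N \<le> real n" using NL n1 by linarith
      then show ?thesis by simp
    qed
    moreover have "n \<le> N + N div k"
    proof -
      have "real n \<le> real (N + N div k)" using up n2 by simp
      then show ?thesis by (simp only: of_nat_le_iff)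
    qed
    ultimately show "n \<in> {n \<in> block k N. \<bar>ln (real n) - a\<bar> \<le> s}" by (auto simp: block_def)
  qed
  then have "card {nat L..nat R} \<le> card {n \<in> block k N. \<bar>ln (real n) - a\<bar> \<le> s}"
    by (intro card_mono) auto
  then have "real (card {nat L..nat R}) \<le> card {n \<in> block k N. \<bar>ln (real n) - a\<bar> \<le> s}" by (rule of_nat_mono)
  moreover have "s * N \<le> card {nat L..nat R}"
  proof -
    have "2 * s * N \<le> exp (a - s) * (2 * s)" using NL s0 by (simp add: mult.commute mult_left_mono)
    also have "\<dots> \<le> exp (a - s) * (exp (2 * s) - 1)"
    proof (rule mult_left_mono)
      show "2 * s \<le> exp (2 * s) - 1" using exp_ge_add_one_self[of "2 * s"] by linarith
    qed simp
    also have "\<dots> = exp (a + s) - exp (a - s)" by (simp add: right_diff_distrib exp_add[symmetric])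
    finally have "2 * s * N \<le> exp (a + s) - exp (a - s)" .
    moreover have "real_of_int R > exp (a + s) - 1" "real_of_int L < exp (a - s) + 1"
      unfolding R_def L_def by linarith+
    moreover have "real (card {nat L..nat R}) \<ge> real_of_int (R - L + 1)" using L0 by auto
    ultimately show ?thesis using s by simp
  qed
  ultimately show ?thesis by linarith
qed

text \<open>
  One factor is chosen freely among those that keep the remaining problem centred, which is a positive proportion
  of the block, and only the last factor has to be adjusted to the precision \<open>s\<close>.
\<close>
lemma card_words_near:
  fixes s u :: real
  assumes s: "0 < s" "s \<le> 1 / (8 * k)" "1 \<le> s * N" and N: "8 * k \<le> N"
    and j: "j \<ge> 1" and u: "\<bar>u - j * (ln N + 1 / (2 * k))\<bar> \<le> 1 / (8 * k)"
  shows "(1 / (8 * k) * N) ^ (j - 1) * (s * N)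
    \<le> (\<Sum>xs\<in>words (block k N) j. if \<bar>ln (real (prod_list xs)) - u\<bar> \<le> s then 1 else 0)"
  using j u
proof (induction j arbitrary: u rule: dec_induct)
  case base
  have b: "1 / (8 * real k) > 0" "3 / (4 * real k) = 6 * (1 / (8 * real k))" "1 / (2 * real k) = 4 * (1 / (8 * real k))"
    using k by auto
  have "(\<Sum>xs\<in>words (block k N) 1. if \<bar>ln (real (prod_list xs)) - u\<bar> \<le> s then 1 else 0)
    = (\<Sum>n\<in>block k N. if \<bar>ln (real n) - u\<bar> \<le> s then 1 else 0 :: real)"
    unfolding One_nat_def sum_words_Suc[OF finite_block] words_0 by simp
  also have "\<dots> = card {n \<in> block k N. \<bar>ln (real n) - u\<bar> \<le> s}"
    by (simp add: sum.If_cases Int_def)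
  finally have eq: "(\<Sum>xs\<in>words (block k N) 1. if \<bar>ln (real (prod_list xs)) - u\<bar> \<le> s then 1 else 0)
    = real (card {n \<in> block k N. \<bar>ln (real n) - u\<bar> \<le> s})" .
  have "s * N \<le> card {n \<in> block k N. \<bar>ln (real n) - u\<bar> \<le> s}"
  proof (rule card_block_near[OF _ _ s(3) N])
    have "\<bar>u - (ln N + 1 / (2 * real k))\<bar> \<le> 1 / (8 * real k)" using base by simp
    then show "ln N \<le> u - s" "u + s \<le> ln N + 3 / (4 * k)" using s b unfolding abs_le_iff by linarith+
  qed
  then show ?case unfolding eq by simp
next
  case (step j)
  define w where "w = 1 / (8 * real k)"
  define \<nu> where "\<nu> = ln N + 1 / (2 * k)"
  have b: "w > 0" "3 / (4 * real k) = 6 * w" "1 / (2 * real k) = 4 * w" using k by (auto simp: w_def)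
  have wN: "1 \<le> w * N" using N k by (simp add: w_def field_simps)
  define a where "a = u - j * \<nu>"
  have av: "\<bar>a - \<nu>\<bar> \<le> w"
  proof -
    have "u - real (Suc j) * \<nu> = a - \<nu>" by (simp add: a_def algebra_simps)
    then show ?thesis using step.prems by (simp add: \<nu>_def w_def)
  qed
  let ?n = "{n \<in> block k N. \<bar>ln (real n) - a\<bar> \<le> w}"
  let ?c = "\<lambda>j u. (\<Sum>xs\<in>words (block k N) j. if \<bar>ln (real (prod_list xs)) - u\<bar> \<le> s then 1 else 0 :: real)"
  have cn: "w * N \<le> card ?n"
  proof (rule card_block_near[OF _ _ wN N])
    show "ln N \<le> a - w" "a + w \<le> ln N + 3 / (4 * k)" using av b by (simp_all add: \<nu>_def abs_le_iff)
  qed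
  have "(w * N) ^ j * (s * N) = w * N * ((w * N) ^ (j - 1) * (s * N))"
    using step.hyps by (cases j) auto
  also have "\<dots> \<le> card ?n * ((w * N) ^ (j - 1) * (s * N))"
    using cn s b by (intro mult_right_mono) auto
  also have "\<dots> = (\<Sum>n\<in>?n. (w * N) ^ (j - 1) * (s * N))" by simp
  also have "\<dots> \<le> (\<Sum>n\<in>?n. ?c j (u - ln n))"
  proof (rule sum_mono)
    fix n assume "n \<in> ?n"
    then have "\<bar>(u - ln n) - j * (ln N + 1 / (2 * k))\<bar> \<le> 1 / (8 * k)"
      by (auto simp: a_def \<nu>_def w_def)
    from step.IH[OF this] show "(w * N) ^ (j - 1) * (s * N) \<le> ?c j (u - ln n)" by (simp add: w_def)
  qed
  also have "\<dots> \<le> (\<Sum>n\<in>block k N. ?c j (u - ln n))"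
    by (intro sum_mono2 sum_nonneg) auto
  also have "\<dots> = ?c (Suc j) u"
    unfolding sum_words_Suc[OF finite_block]
  proof (intro sum.cong refl)
    fix n xs assume "n \<in> block k N" "xs \<in> words (block k N) j"
    then have "0 < n" "0 < prod_list xs"
      using zero_notin_block prod_list_pos[of xs "block k N"] by (auto simp: words_def intro!: gr0I)
    then have "ln (real (prod_list (n # xs))) - u = ln (real (prod_list xs)) - (u - ln n)" by (simp add: ln_mult)
    then show "(if \<bar>ln (real (prod_list xs)) - (u - ln (real n))\<bar> \<le> s then 1 else 0 :: real)
      = (if \<bar>ln (real (prod_list (n # xs))) - u\<bar> \<le> s then 1 else 0)" by (simp only:)
  qed
  finally show ?case by (simp add: w_def)
qed

lemma smoothed_count_lower:
  assumes u: "\<bar>u - centre k N\<bar> \<le> 1 / (8 * k)" and N: "base_degree k \<le> N"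
  shows "mass k * real N ^ k \<le> smoothed_count (base_degree k) u"
proof -
  define J where "J = base_degree k"
  have J: "8 * real k \<le> J" "J \<ge> 1" using base_degree_bounds[of k] k by (auto simp: J_def)
  have N': "real J \<le> N" using N by (simp add: J_def)
  have kN: "8 * k \<le> N" using J(1) N' by linarith
  define s where "s = 1 / real J"
  let ?W = "words (block k N) k"
  have s: "0 < s" "s \<le> 1 / (8 * k)" "1 \<le> s * N"
    using J N' k by (auto simp: s_def field_simps)
  have c: "centre k N = k * (ln N + 1 / (2 * k))" using k by (simp add: centre_def algebra_simps)
  have "mass k * real N ^ k = J / 4 * ((1 / (8 * k) * N) ^ (k - 1) * (s * N))"
  proof -
    have "(1 / (8 * real k) * N) ^ (k - 1) * (s * N) = (1 / (8 * real k)) ^ (k - 1) * s * (real N ^ (k - 1) * real N)"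
      by (simp only: power_mult_distrib mult_ac)
    also have "real N ^ (k - 1) * real N = real N ^ k" using k power_minus_mult[of k "real N"] by simp
    finally show ?thesis using J by (simp add: mass_def s_def)
  qed
  also have "\<dots> \<le> J / 4 * (\<Sum>xs\<in>?W. if \<bar>ln (real (prod_list xs)) - u\<bar> \<le> s then 1 else 0)"
    using card_words_near[OF s kN, of k u] u k unfolding c by (intro mult_left_mono) auto
  also have "\<dots> = (\<Sum>xs\<in>?W. J / 4 * (if \<bar>ln (real (prod_list xs)) - u\<bar> \<le> s then 1 else 0))"
    by (rule sum_distrib_left)
  also have "\<dots> \<le> (\<Sum>xs\<in>?W. fejer J (u - ln (real (prod_list xs))))"
  proof (rule sum_mono)
    fix xs
    show "J / 4 * (if \<bar>ln (real (prod_list xs)) - u\<bar> \<le> s then 1 else 0) \<le> fejer J (u - ln (real (prod_list xs)))"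
      using fejer_lower[of "u - ln (real (prod_list xs))" J] J fejer_nonneg[of J]
      by (auto simp: s_def abs_minus_commute)
  qed
  finally show ?thesis by (simp add: smoothed_count_def J_def)
qed

lemma ln_diff_ge:
  fixes x y B :: real
  assumes "0 < x" "x < y" "y \<le> B"
  shows "(y - x) / B \<le> ln y - ln x"
proof -
  have "ln (x / y) \<le> x / y - 1" using assms by (intro ln_le_minus_one) auto
  then have "1 - x / y \<le> ln y - ln x" using assms by (simp add: ln_div)
  moreover have "1 - x / y = (y - x) / y" using assms by (simp add: diff_divide_distrib)
  moreover have "(y - x) / B \<le> (y - x) / y" using assms by (intro divide_left_mono mult_pos_pos) auto
  ultimately show ?thesis by linarith
qed

lemma prods_range:
  assumes "m \<in> prods (block k N) k"
  shows "1 \<le> m" "real N ^ k \<le> m" "m \<le> 3 * real N ^ k"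
proof -
  have m: "N ^ k \<le> m" "m \<le> 3 * N ^ k" using prods_block[of k k N] k assms by auto
  have "real (N ^ k) \<le> real m" using m(1) by (rule of_nat_mono)
  then show "real N ^ k \<le> m" by simp
  have "real m \<le> real (3 * N ^ k)" using m(2) by (rule of_nat_mono)
  then show "m \<le> 3 * real N ^ k" by simp
  have "1 \<le> N ^ k" using N2 by (intro one_le_power) auto
  then show "1 \<le> m" using m by linarith
qed

text \<open>
  Only the tail of the kernel contributes. Its sum is controlled by the distance to the nearest
  product, because the logarithms of distinct products differ by at least \<open>1 / (3 * N ^ k)\<close>.
\<close>
lemma smoothed_count_upper:
  assumes H: "2 \<le> H" and J: "J \<ge> 1" and u: "\<bar>u - centre k N\<bar> \<le> 1 / (8 * k)"
    and far: "\<And>m. m \<in> prods (block k N) k \<Longrightarrow> H / (6 * real N ^ k) \<le> \<bar>ln (real m) - u\<bar>"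
  shows "smoothed_count J u \<le> 1152 * real N powr (2 * k + \<kappa>) / (J * H)"
proof -
  let ?P = "prods (block k N) k"
  define X where "X = real N ^ k"
  have X: "X \<ge> 1" unfolding X_def using N2 by (intro one_le_power) auto
  have pi2: "\<bar>u - ln (real m)\<bar> \<le> pi" if "m \<in> ?P" for m
  proof -
    note m = prods_range[OF that]
    have "1 / (8 * real k) \<le> 1 / 2" using k by (simp add: field_simps)
    then have u': "k * ln N \<le> u" "u \<le> k * ln N + 1" using u unfolding centre_def abs_le_iff by linarith+
    have m': "0 < real m" "X \<le> m" "m \<le> 3 * X" using m by (auto simp: X_def)
    have "ln X \<le> ln m" using m' X by (subst ln_le_cancel_iff) auto
    moreover have "ln m \<le> ln (3 * X)" using m' X by (subst ln_le_cancel_iff) auto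
    moreover have "ln (3 * X) = ln 3 + ln X" using X by (simp add: ln_mult)
    moreover have "ln X = k * ln N" using N2 by (simp add: X_def ln_realpow)
    moreover have "ln (3::real) \<le> 2" using ln_le_minus_one[of "3::real"] by simp
    ultimately show ?thesis using u' pi_ge_two by linarith
  qed
  have "smoothed_count J u \<le> (\<Sum>m\<in>?P. real N powr \<kappa> * (16 / J * (1 / (ln (real m) - u)\<^sup>2)))"
    unfolding smoothed_count_reps
  proof (rule sum_mono)
    fix m assume m: "m \<in> ?P"
    have "0 < H / (6 * real N ^ k)" using H X N2 by (intro divide_pos_pos mult_pos_pos) auto
    then have ne: "u - ln (real m) \<noteq> 0" using far[OF m] by auto
    have "r m * fejer J (u - ln (real m)) \<le> real N powr \<kappa> * fejer J (u - ln (real m))"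
      using reg m by (intro mult_right_mono fejer_nonneg) (auto simp: regular_def)
    also have "\<dots> \<le> real N powr \<kappa> * (16 / (J * (u - ln (real m))\<^sup>2))"
      by (intro mult_left_mono fejer_decay ne pi2 m) auto
    finally show "r m * fejer J (u - ln (real m)) \<le> real N powr \<kappa> * (16 / J * (1 / (ln (real m) - u)\<^sup>2))"
      by (simp add: power2_commute)
  qed
  also have "\<dots> = real N powr \<kappa> * (16 / J * (\<Sum>m\<in>?P. 1 / (ln (real m) - u)\<^sup>2))"
    by (simp add: sum_distrib_left)
  finally have 1: "smoothed_count J u \<le> real N powr \<kappa> * (16 / J * (\<Sum>m\<in>?P. 1 / (ln (real m) - u)\<^sup>2))" .
  have "(\<Sum>m\<in>?P. 1 / (ln (real m) - u)\<^sup>2) \<le> 4 / (1 / (3 * X) * (H / (6 * X)))"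
  proof (rule sum_inverse_squares_separated)
    show "finite ?P" by (intro finite_prods finite_block)
    show "0 < 1 / (3 * X)" using X by simp
    show "1 / (3 * X) \<le> H / (6 * X)" using X H by (simp add: field_simps)
    show "H / (6 * X) \<le> \<bar>ln (real m) - u\<bar>" if "m \<in> ?P" for m using far[OF that] by (simp add: X_def)
  next
    fix m m' assume m: "m \<in> ?P" "m' \<in> ?P" "m \<noteq> m'"
    note b = prods_range[OF m(1)] prods_range[OF m(2)]
    have "1 / (3 * X) \<le> ln (real b) - ln (real a)" if "a < b" "1 \<le> a" "real b \<le> 3 * X" for a b :: nat
    proof -
      have "1 / (3 * X) \<le> (real b - real a) / (3 * X)" using that X by (intro divide_right_mono) auto
      also have "\<dots> \<le> ln (real b) - ln (real a)" using that by (intro ln_diff_ge) auto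
      finally show ?thesis .
    qed
    from this[of m m'] this[of m' m] show "1 / (3 * X) \<le> \<bar>ln (real m) - ln (real m')\<bar>"
      using m(3) b by (cases "m < m'") (auto simp: X_def)
  qed
  also have "4 / (1 / (3 * X) * (H / (6 * X))) = 72 * X\<^sup>2 / H" using X H by (simp add: field_simps power2_eq_square)
  finally have "real N powr \<kappa> * (16 / J * (\<Sum>m\<in>?P. 1 / (ln (real m) - u)\<^sup>2)) \<le> real N powr \<kappa> * (16 / J * (72 * X\<^sup>2 / H))"
    by (intro mult_left_mono) auto
  also have "\<dots> = 1152 * (X\<^sup>2 * real N powr \<kappa>) / (J * H)" by simp
  also have "X\<^sup>2 * real N powr \<kappa> = real N powr (2 * k + \<kappa>)"
  proof -
    have "real N powr (2 * k + \<kappa>) = real N powr (real k + real k + \<kappa>)" by simp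
    also have "\<dots> = real N powr real k * real N powr real k * real N powr \<kappa>" by (simp only: powr_add)
    finally show ?thesis using N2 by (simp add: X_def powr_realpow power2_eq_square)
  qed
  finally show ?thesis using 1 by linarith
qed

end

text \<open>
  After dualising, \<open>mean_value\<close> applies with the points of \<open>U\<close> in the role of the frequencies.
\<close>
lemma card_le_of_duality:
  fixes U :: "real set" and b :: "int \<Rightarrow> complex" and J :: nat and V \<delta> :: real
  assumes fin: "finite U" and V: "0 < V"
    and S: "S \<subseteq> {- int J..int J}"
    and large: "\<And>u. u \<in> U \<Longrightarrow> V \<le> norm (\<Sum>t\<in>S. b t * cis (real_of_int t * u))"
    and \<delta>: "0 < \<delta>" "1 \<le> J * \<delta>"
    and sep: "\<And>u v. u \<in> U \<Longrightarrow> v \<in> U \<Longrightarrow> u \<noteq> v \<Longrightarrow> \<delta> \<le> \<bar>u - v\<bar>"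
    and range: "\<And>u v. u \<in> U \<Longrightarrow> v \<in> U \<Longrightarrow> \<bar>u - v\<bar> \<le> pi"
  shows "card U * V\<^sup>2 \<le> 68 * real J * (\<Sum>t\<in>S. (norm (b t))\<^sup>2)"
proof (cases "U = {}")
  case True
  then show ?thesis by (simp add: sum_nonneg)
next
  case False
  then have cU: "0 < card U" using fin by (simp add: card_gt_0_iff)
  obtain \<xi> where \<xi>: "\<And>u. norm (\<xi> u) \<le> 1"
    "(\<Sum>u\<in>U. norm (\<Sum>t\<in>S. b t * cis (real_of_int t * u)))\<^sup>2
       \<le> (\<Sum>t\<in>S. (norm (b t))\<^sup>2) * (\<Sum>t\<in>S. (norm (\<Sum>u\<in>U. \<xi> u * cis (real_of_int t * u)))\<^sup>2)"
    using sum_norms_duality[where I = U and S = S and b = b and K = "\<lambda>u t. cis (real_of_int t * u)"] by blast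
  have "(\<Sum>u\<in>U. V) \<le> (\<Sum>u\<in>U. norm (\<Sum>t\<in>S. b t * cis (real_of_int t * u)))"
    using large by (intro sum_mono) auto
  then have "(card U * V)\<^sup>2 \<le> (\<Sum>u\<in>U. norm (\<Sum>t\<in>S. b t * cis (real_of_int t * u)))\<^sup>2"
    using V by (intro power_mono) auto
  also note \<xi>(2)
  finally have 1: "(card U * V)\<^sup>2 \<le> (\<Sum>t\<in>S. (norm (b t))\<^sup>2) * (\<Sum>t\<in>S. (norm (\<Sum>u\<in>U. \<xi> u * cis (real_of_int t * u)))\<^sup>2)" .
  have "(\<Sum>t\<in>S. (norm (\<Sum>u\<in>U. \<xi> u * cis (real_of_int t * u)))\<^sup>2)
     \<le> (\<Sum>t\<in>{- int J..int J}. (norm (\<Sum>u\<in>U. \<xi> u * cis (real_of_int t * u)))\<^sup>2)"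
    using S by (intro sum_mono2) auto
  also have "\<dots> \<le> 68 * real J * (\<Sum>u\<in>U. (norm (\<xi> u))\<^sup>2)"
    by (rule mean_value[OF fin \<delta> sep range])
  also have "\<dots> \<le> 68 * real J * (\<Sum>u\<in>U. 1)"
    using \<xi>(1) by (intro mult_left_mono sum_mono) (auto simp: power_le_one)
  finally have "(\<Sum>t\<in>S. (norm (\<Sum>u\<in>U. \<xi> u * cis (real_of_int t * u)))\<^sup>2) \<le> 68 * real J * card U" by simp
  then have "(\<Sum>t\<in>S. (norm (b t))\<^sup>2) * (\<Sum>t\<in>S. (norm (\<Sum>u\<in>U. \<xi> u * cis (real_of_int t * u)))\<^sup>2)
     \<le> (\<Sum>t\<in>S. (norm (b t))\<^sup>2) * (68 * real J * card U)"
    by (intro mult_left_mono sum_nonneg) auto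
  with 1 have "(card U * V)\<^sup>2 \<le> (\<Sum>t\<in>S. (norm (b t))\<^sup>2) * (68 * real J * card U)" by (rule order_trans)
  then have "card U * (card U * V\<^sup>2) \<le> card U * (68 * real J * (\<Sum>t\<in>S. (norm (b t))\<^sup>2))"
    by (simp add: power2_eq_square mult_ac)
  then show ?thesis using cU by simp
qed

context regular_block
begin

text \<open>
  The weights differ by at most \<open>\<bar>t\<bar> / J0\<close>, and \<open>p t\<close> is at most \<open>40 * N / \<bar>t\<bar>\<close>, so that the sum over \<open>t\<close>
  converges and the factor \<open>1 / J0\<close> is gained.
\<close>
lemma sum_low_frequencies:
  assumes J: "J0 \<ge> 1" "J0 \<le> J"
  shows "(\<Sum>t\<in>{t \<in> {- int J..int J}. \<bar>t\<bar> < int N}. \<bar>fejer_weight J t - fejer_weight J0 t\<bar> * p t ^ k)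
    \<le> 4 * (40 * real N) ^ k / J0"
proof -
  let ?S = "{t \<in> {- int J..int J}. \<bar>t\<bar> < int N}"
  have fin: "finite ?S" by (rule finite_subset[of _ "{- int J..int J}"]) auto
  have "(\<Sum>t\<in>?S. \<bar>fejer_weight J t - fejer_weight J0 t\<bar> * p t ^ k)
     = (\<Sum>t\<in>?S - {0}. \<bar>fejer_weight J t - fejer_weight J0 t\<bar> * p t ^ k)"
    using fin by (intro sum.mono_neutral_right) (auto simp: fejer_weight_def)
  also have "\<dots> \<le> (\<Sum>t\<in>?S - {0}. (40 * real N) ^ k / J0 * (1 / (real_of_int t - 0)\<^sup>2))"
  proof (rule sum_mono)
    fix t assume t: "t \<in> ?S - {0}"
    then have t1: "1 \<le> \<bar>t\<bar>" "\<bar>t\<bar> \<le> int N" by auto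
    define x where "x = \<bar>real_of_int t\<bar>"
    have x: "1 \<le> x" "x \<le> N" using t1 unfolding x_def by linarith+
    have w: "\<bar>fejer_weight J t - fejer_weight J0 t\<bar> \<le> x / J0"
    proof -
      have "x / J \<le> x / J0" using J x by (intro divide_left_mono) auto
      moreover have "0 \<le> x / J" using x by simp
      ultimately show ?thesis unfolding fejer_weight_def x_def[symmetric] by (auto simp: abs_le_iff)
    qed
    have "p t \<le> 40 * real N / x"
      unfolding block_eq_interval x_def
      using x N2 block_length_le[of k N] k by (intro osc_sum_first_derivative) (auto simp: x_def)
    then have "p t ^ k \<le> (40 * real N / x) ^ k" by (intro power_mono) auto
    then have "\<bar>fejer_weight J t - fejer_weight J0 t\<bar> * p t ^ k \<le> x / J0 * (40 * real N / x) ^ k"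
      using w x by (intro mult_mono) auto
    also have "\<dots> = (40 * real N) ^ k / J0 * (x / x ^ k)" by (simp add: power_divide)
    also have "x / x ^ k \<le> 1 / x\<^sup>2"
    proof -
      have "x ^ 3 \<le> x ^ k" using x k by (intro power_increasing) auto
      then have "x / x ^ k \<le> x / x ^ 3" using x by (intro divide_left_mono mult_pos_pos) auto
      also have "\<dots> = 1 / x\<^sup>2" using x by (simp add: power2_eq_square power3_eq_cube)
      finally show ?thesis .
    qed
    then have "(40 * real N) ^ k / J0 * (x / x ^ k) \<le> (40 * real N) ^ k / J0 * (1 / x\<^sup>2)"
      by (intro mult_left_mono) auto
    also have "x\<^sup>2 = (real_of_int t - 0)\<^sup>2" by (simp add: x_def)
    finally show "\<bar>fejer_weight J t - fejer_weight J0 t\<bar> * p t ^ k \<le> (40 * real N) ^ k / J0 * (1 / (real_of_int t - 0)\<^sup>2)" .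
  qed
  also have "\<dots> = (40 * real N) ^ k / J0 * (\<Sum>t\<in>?S - {0}. 1 / (real_of_int t - 0)\<^sup>2)"
    by (rule sum_distrib_left[symmetric])
  also have "\<dots> \<le> (40 * real N) ^ k / J0 * (4 / (1 * 1))"
  proof (intro mult_left_mono sum_inverse_squares_separated)
    show "finite (?S - {0})" using fin by simp
    show "1 \<le> \<bar>real_of_int t - 0\<bar>" if "t \<in> ?S - {0}" for t
    proof -
      have "1 \<le> \<bar>t\<bar>" using that by auto
      then show ?thesis by linarith
    qed
    show "1 \<le> \<bar>real_of_int t - real_of_int s\<bar>" if "t \<noteq> s" for t s
    proof -
      have "1 \<le> \<bar>t - s\<bar>" using that by auto
      then show ?thesis by linarith
    qed
  qed auto
  finally show ?thesis by (simp add: mult.commute)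
qed

text \<open>
  At a point far from all products the smoothed count at scale \<open>1 / J\<close> is much smaller than the one at
  constant scale, so frequencies between the two scales must be responsible. Low frequencies and
  peaks contribute too little, whence the remaining ones are large.
\<close>
lemma off_peak_frequencies_large:
  fixes u :: real
  assumes J: "base_degree k \<le> J" "J \<le> N ^ (k - 2)" and N: "base_degree k \<le> N"
    and u: "\<bar>u - centre k N\<bar> \<le> 1 / (8 * k)"
    and peak_small: "real N powr (k - 17 * \<kappa>) \<le> mass k / 4 * real N ^ k"
    and count_small: "smoothed_count J u \<le> mass k / 4 * real N ^ k"
  shows "mass k / 4 * real N ^ k \<le> norm (\<Sum>t\<in>{t \<in> {- int J..int J}. int N \<le> \<bar>t\<bar>} - peaks J.
    complex_of_real (fejer_weight J t - fejer_weight (base_degree k) t) * cnj (osc_sum (block k N) t ^ k) * cis (t * u))"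
proof -
  define J0 where "J0 = base_degree k"
  have J0: "J0 \<ge> 1" "J0 \<le> J" "16 * 40 ^ k / mass k \<le> J0"
    using base_degree_bounds[of k] k J by (auto simp: J0_def)
  define c where "c = mass k / 4 * real N ^ k"
  have mk: "0 < mass k" using mass_bounds[of k] k by simp
  define f where "f = (\<lambda>t::int. complex_of_real (fejer_weight J t - fejer_weight J0 t) * cnj (osc_sum (block k N) t ^ k) * cis (t * u))"
  let ?All = "{- int J..int J}"
  let ?Lo = "{t \<in> ?All. \<bar>t\<bar> < int N}" and ?Hi = "{t \<in> ?All. int N \<le> \<bar>t\<bar>}"
  have fin: "finite ?Lo" "finite ?Hi" by (rule finite_subset[of _ ?All]; auto)+
  have nf: "norm (f t) = \<bar>fejer_weight J t - fejer_weight J0 t\<bar> * p t ^ k" for t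
    by (simp add: f_def norm_mult norm_power del: of_real_diff)
  have "complex_of_real (smoothed_count J u - smoothed_count J0 u) = (\<Sum>t\<in>?All. f t)"
    unfolding of_real_diff f_def using J0 J
    by (subst (1 2) smoothed_count_fourier[where T = J]) (auto simp: sum_subtractf[symmetric] algebra_simps)
  also have "\<dots> = (\<Sum>t\<in>?Lo \<union> ?Hi. f t)" by (rule sum.cong) auto
  also have "\<dots> = (\<Sum>t\<in>?Lo. f t) + (\<Sum>t\<in>?Hi. f t)"
    by (rule sum.union_disjoint[OF fin]) auto
  also have "(\<Sum>t\<in>?Hi. f t) = (\<Sum>t\<in>?Hi - peaks J. f t) + (\<Sum>t\<in>peaks J. f t)"
    by (rule sum.subset_diff[OF _ fin(2)]) (auto simp: peaks_def)
  finally have eq: "complex_of_real (smoothed_count J u - smoothed_count J0 u)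
     = (\<Sum>t\<in>?Lo. f t) + ((\<Sum>t\<in>?Hi - peaks J. f t) + (\<Sum>t\<in>peaks J. f t))" .
  have lo: "norm (\<Sum>t\<in>?Lo. f t) \<le> c"
  proof -
    have "norm (\<Sum>t\<in>?Lo. f t) \<le> (\<Sum>t\<in>?Lo. \<bar>fejer_weight J t - fejer_weight J0 t\<bar> * p t ^ k)"
      by (intro sum_norm_le) (simp add: nf)
    also have "\<dots> \<le> 4 * (40 * real N) ^ k / J0" by (rule sum_low_frequencies[OF J0(1,2)])
    also have "\<dots> = 4 * 40 ^ k / J0 * real N ^ k" by (simp add: power_mult_distrib)
    also have "4 * 40 ^ k / J0 \<le> mass k / 4" using J0 mk by (simp add: field_simps)
    finally show ?thesis by (simp add: c_def mult_right_mono)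
  qed
  have pk: "norm (\<Sum>t\<in>peaks J. f t) \<le> c"
  proof -
    have "norm (\<Sum>t\<in>peaks J. f t) \<le> (\<Sum>t\<in>peaks J. p t ^ k)"
    proof (intro sum_norm_le)
      fix t
      have "\<bar>fejer_weight J t - fejer_weight J0 t\<bar> \<le> 1"
        using fejer_weight_bounds[of J t] fejer_weight_bounds[of J0 t] by linarith
      then show "norm (f t) \<le> p t ^ k" unfolding nf by (intro mult_left_le_one_le) auto
    qed
    also have "\<dots> \<le> real N powr (k - 17 * \<kappa>)" using J J0 by (intro sum_peaks) auto
    also have "\<dots> \<le> c" using peak_small by (simp add: c_def)
    finally show ?thesis .
  qed
  have "4 * c \<le> smoothed_count J0 u"
    using smoothed_count_lower[OF u N] by (simp add: c_def J0_def)
  moreover have "smoothed_count J u \<le> c" using count_small by (simp only: c_def)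
  ultimately have "3 * c \<le> \<bar>smoothed_count J u - smoothed_count J0 u\<bar>" by linarith
  also have "\<dots> = norm (complex_of_real (smoothed_count J u - smoothed_count J0 u))" by (simp only: norm_of_real)
  also have "\<dots> \<le> norm (\<Sum>t\<in>?Lo. f t) + (norm (\<Sum>t\<in>?Hi - peaks J. f t) + norm (\<Sum>t\<in>peaks J. f t))"
    unfolding eq by (intro order_trans[OF norm_triangle_ineq] add_left_mono norm_triangle_ineq)
  finally have "c \<le> norm (\<Sum>t\<in>?Hi - peaks J. f t)" using lo pk by linarith
  then show ?thesis by (simp only: c_def f_def J0_def of_int_eq_id id_apply)
qed

text \<open>
  Here \<open>U\<close> consists of logarithms of the middle points of intervals of length \<open>H\<close> without products. The
  degree \<open>J\<close> is chosen just large enough for \<open>smoothed_count J u\<close> to be at most a quarter of the main term.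
\<close>
lemma card_isolated_points:
  assumes N: "base_degree k \<le> N" "9216 / mass k \<le> N" "4 / mass k \<le> real N powr (17 * \<kappa>)"
      "1088 / (mass k)\<^sup>2 * (9216 / mass k) powr (3 / 2) \<le> real N powr (1 / 2)"
    and H: "real N ^ 4 \<le> H" "H \<le> real N ^ (k - 1)"
    and fin: "finite U"
    and u: "\<And>u. u \<in> U \<Longrightarrow> \<bar>u - centre k N\<bar> \<le> 1 / (8 * k)"
    and far: "\<And>u m. u \<in> U \<Longrightarrow> m \<in> prods (block k N) k \<Longrightarrow> H / (6 * real N ^ k) \<le> \<bar>ln (real m) - u\<bar>"
    and sep: "\<And>u v. u \<in> U \<Longrightarrow> v \<in> U \<Longrightarrow> u \<noteq> v \<Longrightarrow> H / (3 * real N ^ k) \<le> \<bar>u - v\<bar>"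
  shows "card U \<le> real N ^ (k + 5) / H powr (3 / 2)"
proof -
  have mk: "0 < mass k" "mass k \<le> 1" using mass_bounds[of k] k by auto
  define X where "X = real N ^ k"
  have X: "X \<ge> 1" unfolding X_def using N2 by (intro one_le_power) auto
  have N1: "1 \<le> real N" using N2 by simp
  have "1 \<le> real N ^ 4" using N1 by (rule one_le_power)
  then have H0: "0 < H" "1 \<le> H" using H by linarith+
  have "2 ^ 4 \<le> real N ^ 4" using N2 by (intro power_mono) auto
  then have H2: "2 \<le> H" using H by simp
  have XH: "real N * H \<le> X"
  proof -
    have "real N * H \<le> real N * real N ^ (k - 1)" using H N1 by (intro mult_left_mono) auto
    also have "\<dots> = X" using k by (simp add: X_def power_eq_if)
    finally show ?thesis .
  qed
  define y where "y = 4608 / mass k * (X * real N powr \<kappa>) / H"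
  have N\<kappa>: "1 \<le> real N powr \<kappa>" using const_le by simp
  have y: "4608 * (X / H) \<le> y"
  proof -
    have "4608 * 1 * (X * 1) / H \<le> y"
      unfolding y_def using mk N\<kappa> X H0
      by (intro divide_right_mono mult_mono) (auto simp: field_simps)
    then show ?thesis by simp
  qed
  have XHN: "real N \<le> X / H" using XH H0 by (simp add: field_simps)
  have y1: "real N \<le> y" "1 \<le> y" using y XHN N1 by linarith+
  define J where "J = nat \<lceil>y\<rceil>"
  have J: "y \<le> J" "J \<le> 2 * y" using y1 unfolding J_def by linarith+
  have JN: "base_degree k \<le> J" using N(1) y1 J by linarith
  have J1: "J \<ge> 1" using base_degree_bounds[of k] k JN by linarith
  have Jk: "J \<le> N ^ (k - 2)"
  proof -
    have "real J \<le> 9216 / mass k * (X * real N powr \<kappa>) / H" using J by (simp add: y_def)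
    also have "\<dots> \<le> real N * (X * real N powr 1) / real N ^ 4"
      using N(2) H H0 X mk \<kappa> N1 by (intro frac_le mult_mono powr_N_mono) auto
    also have "\<dots> = real N ^ (k - 2)"
    proof -
      have "k = (k - 2) + 2" using k by simp
      then have "X = real N ^ (k - 2) * real N ^ 2" unfolding X_def by (metis power_add)
      then show ?thesis using N1 by (simp add: power2_eq_square power4_eq_xxxx)
    qed
    finally have "real J \<le> real (N ^ (k - 2))" by simp
    then show ?thesis by (simp only: of_nat_le_iff)
  qed
  define S where "S = {t \<in> {- int J..int J}. int N \<le> \<bar>t\<bar>} - peaks J"
  define b where "b = (\<lambda>t::int. complex_of_real (fejer_weight J t - fejer_weight (base_degree k) t) * cnj (osc_sum (block k N) t ^ k))"
  have peak: "real N powr (k - 17 * \<kappa>) \<le> mass k / 4 * real N ^ k"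
  proof -
    have "real N powr (k - 17 * \<kappa>) = real N ^ k / real N powr (17 * \<kappa>)"
      using N1 by (simp add: powr_diff powr_realpow)
    also have "\<dots> \<le> real N ^ k / (4 / mass k)"
      using N(3) mk N1 by (intro divide_left_mono mult_pos_pos) auto
    finally show ?thesis by (simp add: mult.commute)
  qed
  have count: "smoothed_count J u \<le> mass k / 4 * real N ^ k" if "u \<in> U" for u
  proof -
    have "smoothed_count J u \<le> 1152 * real N powr (2 * k + \<kappa>) / (J * H)"
      using J1 H2 u[OF that] far[OF that] by (intro smoothed_count_upper) auto
    also have "\<dots> \<le> 1152 * real N powr (2 * k + \<kappa>) / (y * H)"
      using J y1 H0 by (intro divide_left_mono mult_right_mono mult_pos_pos) auto
    also have "y * H = 4608 / mass k * (X * real N powr \<kappa>)" using H0 by (simp add: y_def)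
    also have "real N powr (2 * k + \<kappa>) = X * (X * real N powr \<kappa>)"
    proof -
      have "real N powr (2 * k + \<kappa>) = real N powr (real k + real k + \<kappa>)" by simp
      also have "\<dots> = real N powr real k * real N powr real k * real N powr \<kappa>" by (simp only: powr_add)
      finally show ?thesis using N1 by (simp add: X_def powr_realpow)
    qed
    also have "1152 * (X * (X * real N powr \<kappa>)) / (4608 / mass k * (X * real N powr \<kappa>)) = mass k / 4 * X"
      using X N\<kappa> mk N2 by (simp add: field_simps)
    finally show ?thesis by (simp add: X_def)
  qed
  have "card U * (mass k / 4 * X)\<^sup>2 \<le> 68 * real J * (\<Sum>t\<in>S. (norm (b t))\<^sup>2)"
  proof (rule card_le_of_duality[OF fin])
    show "0 < mass k / 4 * X" using mk X by simp
    show "S \<subseteq> {- int J..int J}" by (auto simp: S_def)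
    show "mass k / 4 * X \<le> norm (\<Sum>t\<in>S. b t * cis (real_of_int t * v))" if "v \<in> U" for v
      using off_peak_frequencies_large[OF JN Jk N(1) u[OF that] peak count[OF that]]
      unfolding S_def b_def X_def .
    show "0 < H / (3 * X)" using H0 X by simp
    have "4608 * (X / H) * (H / (3 * X)) \<le> real J * (H / (3 * X))"
      using y J X H0 by (intro mult_right_mono) auto
    moreover have "4608 * (X / H) * (H / (3 * X)) = 1536" using X H0 by (simp add: field_simps)
    ultimately show "1 \<le> real J * (H / (3 * X))" by linarith
    show "H / (3 * X) \<le> \<bar>v - v'\<bar>" if "v \<in> U" "v' \<in> U" "v \<noteq> v'" for v v'
      using sep[OF that] by (simp add: X_def)
    show "\<bar>v - v'\<bar> \<le> pi" if "v \<in> U" "v' \<in> U" for v v'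
    proof -
      have "1 / (8 * real k) \<le> 1" using k by (simp add: field_simps)
      then show ?thesis using u[OF that(1)] u[OF that(2)] pi_ge_two by linarith
    qed
  qed
  also have "(\<Sum>t\<in>S. (norm (b t))\<^sup>2) \<le> (\<Sum>t\<in>S. p t ^ (2 * k))"
  proof (rule sum_mono)
    fix t
    have "\<bar>fejer_weight J t - fejer_weight (base_degree k) t\<bar> \<le> 1"
      using fejer_weight_bounds[of J t] fejer_weight_bounds[of "base_degree k" t] by linarith
    then have "norm (b t) \<le> p t ^ k"
      unfolding b_def norm_mult norm_of_real complex_mod_cnj norm_power by (intro mult_left_le_one_le) auto
    then have "(norm (b t))\<^sup>2 \<le> (p t ^ k)\<^sup>2" by (intro power_mono) auto
    then show "(norm (b t))\<^sup>2 \<le> p t ^ (2 * k)" by (simp add: power_mult[symmetric] mult.commute)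
  qed
  also have "\<dots> \<le> real N powr (3 * k / 2 + 4) * sqrt J"
    unfolding S_def by (rule sum_off_peaks[OF J1 Jk])
  finally have "card U * (mass k / 4 * X)\<^sup>2 \<le> 68 * real J * (real N powr (3 * k / 2 + 4) * sqrt J)"
    by (simp add: mult_left_mono)
  also have "\<dots> = 68 * real N powr (3 * k / 2 + 4) * real J powr (3 / 2)"
    using J1 by (simp add: powr_half_sqrt[symmetric] powr_mult_base)
  also have "\<dots> \<le> 68 * real N powr (3 * k / 2 + 4) * (9216 / mass k * (X * real N powr \<kappa>) / H) powr (3 / 2)"
    using J by (intro mult_left_mono powr_mono2) (auto simp: y_def)
  also have "(9216 / mass k * (X * real N powr \<kappa>) / H) powr (3 / 2)
     = (9216 / mass k) powr (3 / 2) * real N powr (3 * k / 2 + 3 * \<kappa> / 2) / H powr (3 / 2)"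
  proof -
    have "X * real N powr \<kappa> = real N powr (k + \<kappa>)" using N1 by (simp add: X_def powr_add powr_realpow)
    then show ?thesis using mk H0 N1 by (simp add: powr_mult powr_divide powr_powr algebra_simps add_divide_distrib)
  qed
  finally have "card U * (mass k / 4 * X)\<^sup>2 \<le> 68 * real N powr (3 * k / 2 + 4)
     * ((9216 / mass k) powr (3 / 2) * real N powr (3 * k / 2 + 3 * \<kappa> / 2) / H powr (3 / 2))" .
  also have "\<dots> = (68 * (9216 / mass k) powr (3 / 2)) * (real N powr (4 + 3 * \<kappa> / 2) * real N powr (3 * k)) / H powr (3 / 2)"
  proof -
    have "real N powr (3 * k / 2 + 4) * real N powr (3 * k / 2 + 3 * \<kappa> / 2) = real N powr (4 + 3 * \<kappa> / 2) * real N powr (3 * k)"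
      by (simp add: powr_add[symmetric] algebra_simps)
    then show ?thesis by (simp add: mult_ac)
  qed
  also have "real N powr (3 * k) = X\<^sup>2 * X"
    using N1 by (simp add: X_def powr_realpow[symmetric] powr_powr powr_power powr_add[symmetric])
  finally have "card U * (mass k / 4 * X)\<^sup>2 \<le> (68 * (9216 / mass k) powr (3 / 2)) * (real N powr (4 + 3 * \<kappa> / 2) * (X\<^sup>2 * X)) / H powr (3 / 2)" .
  then have "card U \<le> (68 * (9216 / mass k) powr (3 / 2)) * (real N powr (4 + 3 * \<kappa> / 2) * (X\<^sup>2 * X)) / H powr (3 / 2) / (mass k / 4 * X)\<^sup>2"
  proof -
    have pos: "0 < (mass k / 4 * X)\<^sup>2" using mk X by simp
    assume "card U * (mass k / 4 * X)\<^sup>2 \<le> (68 * (9216 / mass k) powr (3 / 2)) * (real N powr (4 + 3 * \<kappa> / 2) * (X\<^sup>2 * X)) / H powr (3 / 2)"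
    then show ?thesis unfolding pos_le_divide_eq[OF pos] .
  qed
  also have "\<dots> = (1088 / (mass k)\<^sup>2 * (9216 / mass k) powr (3 / 2)) * (real N powr (4 + 3 * \<kappa> / 2) * X) / H powr (3 / 2)"
    using mk X H0 by (simp add: power_mult_distrib power_divide field_simps)
  also have "\<dots> \<le> real N powr (1 / 2) * (real N powr (4 + 3 * \<kappa> / 2) * X) / H powr (3 / 2)"
    using N(4) X by (intro divide_right_mono mult_right_mono) auto
  also have "\<dots> \<le> real N ^ (k + 5) / H powr (3 / 2)"
  proof (rule divide_right_mono)
    have "real N powr (1 / 2) * (real N powr (4 + 3 * \<kappa> / 2) * X) = real N powr (9 / 2 + 3 * \<kappa> / 2) * X"
      by (simp add: powr_add[symmetric] mult.assoc[symmetric])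
    also have "\<dots> \<le> real N powr 5 * X" using \<kappa> X by (intro mult_right_mono powr_N_mono) auto
    also have "\<dots> = real N ^ (k + 5)" using N1 by (simp add: X_def power_add powr_numeral)
    finally show "real N powr (1 / 2) * (real N powr (4 + 3 * \<kappa> / 2) * X) \<le> real N ^ (k + 5)" .
  qed simp
  finally show ?thesis .
qed

end

section \<open>Gaps between smooth numbers\<close>

lemma smooth_1: "smooth Y 1"
  by (auto simp: smooth_def)

lemma smooth_mult: "smooth Y a \<Longrightarrow> smooth Y b \<Longrightarrow> smooth Y (a * b)"
  by (auto simp: smooth_def prime_dvd_mult_iff)

lemma smooth_of_le: "0 < n \<Longrightarrow> real n \<le> Y \<Longrightarrow> smooth Y n"
  unfolding smooth_def by (meson dvd_imp_le of_nat_le_iff order_trans)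

lemma smooth_prods:
  assumes "\<And>n. n \<in> A \<Longrightarrow> 0 < n \<and> real n \<le> Y" "m \<in> prods A j"
  shows "smooth Y m"
proof -
  have "smooth Y (prod_list xs)" if "set xs \<subseteq> A" for xs
    using that by (induction xs) (use assms(1) in \<open>auto intro: smooth_mult smooth_of_le smooth_1[unfolded One_nat_def]\<close>)
  then show ?thesis using assms(2) by (auto simp: prods_def words_def)
qed

definition smooth_gap :: "real \<Rightarrow> nat \<Rightarrow> real" where
  "smooth_gap Y n = real (smooth_seq Y (n + 1)) - real (smooth_seq Y n)"

lemma smooth_seq_less: "Y \<ge> 2 \<Longrightarrow> m < n \<Longrightarrow> smooth_seq Y m < smooth_seq Y n"
  using strict_mono_smooth_seq[of Y] by (rule strict_monoD)

lemma smooth_seq_Suc_le: "Y \<ge> 2 \<Longrightarrow> m < n \<Longrightarrow> smooth_seq Y (m + 1) \<le> smooth_seq Y n"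
  using strict_mono_smooth_seq[of Y] by (simp add: strict_mono_less_eq Suc_le_eq)

lemma smooth_seq_smooth: "Y \<ge> 2 \<Longrightarrow> smooth Y (smooth_seq Y n)"
  using range_smooth_seq[of Y] by auto

lemma smooth_gap_pos: "Y \<ge> 2 \<Longrightarrow> 0 < smooth_gap Y n"
  using smooth_seq_less[of Y n "n + 1"] by (simp add: smooth_gap_def)

lemma smooth_outside_gap:
  assumes Y: "Y \<ge> 2" and m: "smooth Y m"
  shows "m \<le> smooth_seq Y n \<or> smooth_seq Y (n + 1) \<le> m"
proof -
  obtain i where i: "m = smooth_seq Y i" using range_smooth_seq[OF Y] m by auto
  show ?thesis
    using smooth_seq_less[OF Y, of i n] smooth_seq_Suc_le[OF Y, of n i] i by (cases i n rule: linorder_cases) auto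
qed

text \<open>
  Twice a smooth number is smooth.
\<close>
lemma smooth_gap_le: "Y \<ge> 2 \<Longrightarrow> smooth_gap Y n \<le> smooth_seq Y n"
proof -
  assume Y: "Y \<ge> 2"
  have s: "smooth Y (smooth_seq Y n)" by (rule smooth_seq_smooth[OF Y])
  then have "0 < smooth_seq Y n" by (simp add: smooth_def)
  moreover have "smooth Y (2 * smooth_seq Y n)"
    using Y by (intro smooth_mult[OF _ s] smooth_of_le) auto
  then have "2 * smooth_seq Y n \<le> smooth_seq Y n \<or> smooth_seq Y (n + 1) \<le> 2 * smooth_seq Y n"
    by (rule smooth_outside_gap[OF Y])
  ultimately have "smooth_seq Y (n + 1) \<le> 2 * smooth_seq Y n" by linarith
  then show ?thesis unfolding smooth_gap_def by linarith
qed

lemma card_smooth_seq_le: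
  assumes Y: "Y \<ge> 2" and K: "0 \<le> K" and I: "\<And>n. n \<in> I \<Longrightarrow> real (smooth_seq Y n) \<le> K"
  shows "finite I" "real (card I) \<le> K"
proof -
  have inj: "inj_on (smooth_seq Y) I"
    using strict_mono_smooth_seq[OF Y] strict_mono_imp_inj_on inj_on_subset by blast
  have sub: "smooth_seq Y ` I \<subseteq> {1..nat \<lfloor>K\<rfloor>}"
  proof (rule image_subsetI)
    fix n assume "n \<in> I"
    then have "smooth_seq Y n \<le> nat \<lfloor>K\<rfloor>" using I by (simp add: le_nat_floor)
    moreover have "0 < smooth_seq Y n" using smooth_seq_smooth[OF Y, of n] by (simp add: smooth_def)
    ultimately show "smooth_seq Y n \<in> {1..nat \<lfloor>K\<rfloor>}" by simp
  qed
  show "finite I" using inj sub by (meson finite_atLeastAtMost finite_imageD finite_subset)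
  have "card I = card (smooth_seq Y ` I)" by (simp add: card_image[OF inj])
  also have "\<dots> \<le> card {1..nat \<lfloor>K\<rfloor>}" using sub by (intro card_mono) auto
  finally have "real (card I) \<le> real (nat \<lfloor>K\<rfloor>)" by simp
  also have "\<dots> \<le> K" using K by simp
  finally show "real (card I) \<le> K" .
qed

text \<open>The further conditions on \<open>N\<close> absorb the constants depending on \<open>k\<close> into small powers of \<open>N\<close>.\<close>
locale large_regular_block = regular_block +
  assumes k14: "k \<ge> 14" and N_base: "base_degree k \<le> N" and N_large: "9216 / mass k \<le> N"
    "4 / mass k \<le> real N powr (17 * \<kappa>)"
    "1088 / (mass k)\<^sup>2 * (9216 / mass k) powr (3 / 2) \<le> real N powr (1 / 2)"
    and N_square: "8 * k * (k + 1) \<le> N"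
begin

text \<open>
  For varying \<open>N\<close> these sets are consecutive, and each of them is so short that its elements are close to the centre
  of the products of \<open>k\<close> elements of \<open>block k N\<close>.
\<close>
definition level :: "real \<Rightarrow> nat set" where
  "level Y = {n. real N ^ k * exp (1 / 2) \<le> smooth_seq Y n \<and> smooth_seq Y n < real (N + 1) ^ k * exp (1 / 2)}"

lemma level_ln:
  assumes n: "n \<in> level Y" and H: "0 \<le> H" "H \<le> real N ^ (k - 1)"
  shows "\<bar>ln (smooth_seq Y n + H / 2) - centre k N\<bar> \<le> 1 / (8 * k)"
    and "smooth_seq Y n + H / 2 \<le> 3 * real N ^ k"
proof -
  define a where "a = real (smooth_seq Y n)"
  define X where "X = real N ^ k"
  have X: "X \<ge> 1" unfolding X_def using N2 by (intro one_le_power) auto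
  have a: "X * exp (1 / 2) \<le> a" "a < real (N + 1) ^ k * exp (1 / 2)"
    using n by (auto simp: level_def a_def X_def)
  have "X * 1 \<le> X * exp (1 / 2)" using X by (intro mult_left_mono) auto
  then have aX: "X \<le> a" using a by linarith
  have a0: "0 < a" using aX X by linarith
  have lnX: "ln X = k * ln N" using N2 by (simp add: X_def ln_realpow)
  have "ln (X * exp (1 / 2)) \<le> ln a" using a X a0 by (subst ln_le_cancel_iff) auto
  then have lo: "centre k N \<le> ln a" using X lnX by (simp add: ln_mult centre_def)
  have "ln a \<le> ln (real (N + 1) ^ k * exp (1 / 2))" using a a0 by (subst ln_le_cancel_iff) auto
  also have "\<dots> = k * ln (N + 1) + 1 / 2" by (simp add: ln_mult ln_realpow)
  also have "ln (N + 1) \<le> ln N + 1 / N"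
  proof -
    have "ln (real (N + 1) / N) \<le> real (N + 1) / N - 1" using N2 by (intro ln_le_minus_one) auto
    also have "\<dots> = 1 / N" using N2 by (simp add: field_simps)
    finally show ?thesis using N2 by (simp add: ln_div)
  qed
  then have "k * ln (N + 1) + 1 / 2 \<le> k * (ln N + 1 / N) + 1 / 2" by (intro add_right_mono mult_left_mono) auto
  finally have hi: "ln a \<le> centre k N + k / N" by (simp add: centre_def algebra_simps)
  have Ha: "H / (2 * a) \<le> 1 / N"
  proof -
    have "H / (2 * a) \<le> real N ^ (k - 1) / X" using H aX X a0 by (intro frac_le) auto
    also have "X = real N ^ (k - 1) * real N" using k power_minus_mult[of k "real N"] by (simp add: X_def)
    also have "real N ^ (k - 1) / (real N ^ (k - 1) * real N) = 1 / N" using N2 by simp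
    finally show ?thesis .
  qed
  have split: "ln (a + H / 2) = ln a + ln (1 + H / (2 * a))"
  proof -
    have "a + H / 2 = a * (1 + H / (2 * a))" using a0 by (simp add: field_simps)
    moreover have "0 < 1 + H / (2 * a)" using a0 H by (intro add_pos_nonneg) auto
    ultimately show ?thesis using a0 ln_mult[of a "1 + H / (2 * a)"] by simp
  qed
  have l2: "0 \<le> ln (1 + H / (2 * a))" "ln (1 + H / (2 * a)) \<le> 1 / N"
    using H a0 Ha ln_add_one_self_le_self[of "H / (2 * a)"] by (auto intro: order_trans)
  have kN: "k / N + 1 / N \<le> 1 / (8 * real k)"
  proof -
    have "real (8 * k * (k + 1)) \<le> real N" using N_square by (rule of_nat_mono)
    then have "8 * real k * (real k + 1) \<le> real N" by (simp add: algebra_simps)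
    then have "(real k + 1) * (8 * real k) \<le> 1 * real N" by (simp add: mult_ac)
    then have "(real k + 1) / N \<le> 1 / (8 * real k)" using k N2 by (simp add: pos_divide_le_eq pos_le_divide_eq)
    then show ?thesis by (simp add: add_divide_distrib)
  qed
  have bd: "centre k N \<le> ln (a + H / 2)" "ln (a + H / 2) \<le> centre k N + 1 / (8 * real k)"
    using lo hi l2 kN split by linarith+
  then show "\<bar>ln (smooth_seq Y n + H / 2) - centre k N\<bar> \<le> 1 / (8 * k)"
    by (simp add: a_def abs_le_iff)
  have "1 / (8 * real k) \<le> 1 / 2" using k by (simp add: field_simps)
  then have "ln (a + H / 2) \<le> ln X + 1" using bd lnX by (simp add: centre_def)
  then have "exp (ln (a + H / 2)) \<le> exp (ln X + 1)" by simp
  also have "\<dots> = X * exp 1" using X by (simp add: exp_add)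
  also have "\<dots> \<le> X * 3" using exp_le X by (intro mult_left_mono) auto
  finally show "smooth_seq Y n + H / 2 \<le> 3 * real N ^ k"
    using a0 H by (simp add: a_def X_def add_pos_nonneg mult.commute)
qed

text \<open>
  Products of elements of the block are smooth, hence a gap of length at least \<open>H\<close> following
  \<open>smooth_seq Y n\<close> contains no product within \<open>H / 2\<close> of \<open>smooth_seq Y n + H / 2\<close>.
\<close>
lemma card_level_gaps:
  assumes Y: "2 * real N \<le> Y" and H: "real N ^ 4 \<le> H" "H \<le> real N ^ (k - 1)"
  shows "card {n \<in> level Y. H \<le> smooth_gap Y n} \<le> real N ^ (k + 5) / H powr (3 / 2)"
proof -
  have Y2: "Y \<ge> 2" using Y N2 by linarith
  have H0: "0 < H" using H N2 by (smt (verit) zero_less_power)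
  let ?a = "\<lambda>n. real (smooth_seq Y n)"
  define G where "G = {n \<in> level Y. H \<le> smooth_gap Y n}"
  define f where "f = (\<lambda>n. ln (?a n + H / 2))"
  have H': "0 \<le> H" "H \<le> real N ^ (k - 1)" using H H0 by auto
  have top: "?a n + H / 2 \<le> 3 * real N ^ k" if "n \<in> G" for n
    using level_ln(2)[OF _ H'] that by (simp add: G_def)
  have a0: "0 < ?a n" for n using smooth_seq_smooth[OF Y2, of n] by (simp add: smooth_def)
  have finG: "finite G"
  proof (rule card_smooth_seq_le[OF Y2])
    show "?a n \<le> 3 * real N ^ k" if "n \<in> G" for n using top[OF that] H0 by linarith
  qed simp
  have sep: "H / (3 * real N ^ k) \<le> f n' - f n" if "n \<in> G" "n' \<in> G" "n < n'" for n n'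
  proof -
    have "smooth_seq Y (n + 1) \<le> smooth_seq Y n'" by (rule smooth_seq_Suc_le[OF Y2 that(3)])
    then have "H \<le> ?a n' - ?a n" using that by (simp add: G_def smooth_gap_def)
    then have "H / (3 * real N ^ k) \<le> ((?a n' + H / 2) - (?a n + H / 2)) / (3 * real N ^ k)"
      by (intro divide_right_mono) auto
    also have "\<dots> \<le> f n' - f n"
      unfolding f_def using a0[of n] H0 \<open>H \<le> ?a n' - ?a n\<close> top[OF that(2)] by (intro ln_diff_ge) auto
    finally show ?thesis .
  qed
  have pos: "0 < H / (3 * real N ^ k)" using H0 N2 by simp
  have sep': "H / (3 * real N ^ k) \<le> \<bar>f n - f n'\<bar>" if "n \<in> G" "n' \<in> G" "n \<noteq> n'" for n n'
    using sep[of n n'] sep[of n' n] that by (cases n n' rule: linorder_cases) auto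
  have inj: "inj_on f G" using sep' pos by (intro inj_onI) fastforce
  have "card (f ` G) \<le> real N ^ (k + 5) / H powr (3 / 2)"
  proof (rule card_isolated_points[OF N_base N_large H])
    show "finite (f ` G)" using finG by simp
    show "\<bar>u - centre k N\<bar> \<le> 1 / (8 * k)" if "u \<in> f ` G" for u
      using that level_ln(1)[OF _ H'] by (auto simp: G_def f_def)
    show "H / (3 * real N ^ k) \<le> \<bar>u - v\<bar>" if "u \<in> f ` G" "v \<in> f ` G" "u \<noteq> v" for u v
      using that sep' by auto
  next
    fix u m assume u: "u \<in> f ` G" and m: "m \<in> prods (block k N) k"
    obtain n where n: "n \<in> G" "u = f n" using u by auto
    have "smooth Y m"
    proof (rule smooth_prods[OF _ m])
      fix i assume i: "i \<in> block k N"
      then have "N \<le> i" "i \<le> N + N div k" by (auto simp: block_def)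
      then have "N \<le> i" "i \<le> 2 * N" using div_le_dividend[of N k] by linarith+
      moreover have "real i \<le> 2 * real N" using \<open>i \<le> 2 * N\<close> by linarith
      ultimately show "0 < i \<and> real i \<le> Y" using N2 Y by auto
    qed
    then have "m \<le> smooth_seq Y n \<or> smooth_seq Y (n + 1) \<le> m" by (rule smooth_outside_gap[OF Y2])
    moreover have "?a n + H \<le> real (smooth_seq Y (n + 1))" using n by (simp add: G_def smooth_gap_def)
    ultimately consider "real m + H / 2 \<le> ?a n + H / 2" | "?a n + H / 2 + H / 2 \<le> real m" by fastforce
    then show "H / (6 * real N ^ k) \<le> \<bar>ln (real m) - u\<bar>"
    proof cases
      case 1
      have "H / (6 * real N ^ k) \<le> ((?a n + H / 2) - real m) / (3 * real N ^ k)"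
        using 1 N2 by (simp add: field_simps)
      also have "\<dots> \<le> ln (?a n + H / 2) - ln (real m)"
        using 1 H0 prods_range(1)[OF m] top[OF n(1)] by (intro ln_diff_ge) auto
      finally show ?thesis by (simp add: n(2) f_def)
    next
      case 2
      have "H / (6 * real N ^ k) \<le> (real m - (?a n + H / 2)) / (3 * real N ^ k)"
        using 2 N2 by (simp add: field_simps)
      also have "\<dots> \<le> ln (real m) - ln (?a n + H / 2)"
        using 2 H0 a0[of n] prods_range(3)[OF m] by (intro ln_diff_ge) auto
      finally show ?thesis by (simp add: n(2) f_def)
    qed
  qed
  then have "card G \<le> real N ^ (k + 5) / H powr (3 / 2)" by (simp only: card_image[OF inj])
  then show ?thesis unfolding G_def .
qed

text \<open>
  No gap exceeds \<open>N ^ (k - 1)\<close>, since the bound for their number would be less than one; gaps below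
  \<open>N ^ 4\<close> are estimated trivially.
\<close>
lemma sum_level_gaps:
  assumes Y: "2 * real N \<le> Y"
  shows "finite (level Y)" "(\<Sum>n\<in>level Y. smooth_gap Y n powr (3 / 2)) \<le> 4 * real N ^ (k + 6)"
proof -
  have Y2: "Y \<ge> 2" using Y N2 by linarith
  have N1: "1 \<le> real N" using N2 by simp
  have aK: "real (smooth_seq Y n) \<le> 3 * real N ^ k" if "n \<in> level Y" for n
    using level_ln(2)[OF that, of 0] by simp
  note cl = card_smooth_seq_le[OF Y2 _ aK]
  show fin: "finite (level Y)" using cl(1)[of "level Y"] by simp
  have cardl: "real (card I) \<le> 3 * real N ^ k" "finite I" if "I \<subseteq> level Y" for I
    using cl[of I] that by auto
  let ?g = "\<lambda>n. smooth_gap Y n powr (3 / 2)"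
  let ?S = "{n \<in> level Y. smooth_gap Y n < real N ^ 4}" and ?B = "{n \<in> level Y. \<not> smooth_gap Y n < real N ^ 4}"
  have mono: "?g n \<le> ?g n' \<longleftrightarrow> smooth_gap Y n \<le> smooth_gap Y n'" for n n'
    using smooth_gap_pos[OF Y2, of n] smooth_gap_pos[OF Y2, of n']
      powr_mono2[of "3 / 2" "smooth_gap Y n" "smooth_gap Y n'"]
      powr_less_mono2[of "3 / 2" "smooth_gap Y n'" "smooth_gap Y n"]
    by (cases "smooth_gap Y n \<le> smooth_gap Y n'") auto
  have small: "(\<Sum>n\<in>?S. ?g n) \<le> 3 * real N ^ (k + 6)"
  proof -
    have "(\<Sum>n\<in>?S. ?g n) \<le> (\<Sum>n\<in>?S. real N ^ 6)"
    proof (rule sum_mono)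
      fix n assume "n \<in> ?S"
      then have "?g n \<le> (real N ^ 4) powr (3 / 2)"
        using smooth_gap_pos[OF Y2, of n] by (intro powr_mono2) auto
      also have "\<dots> = real N powr (4 * (3 / 2))" using N1 powr_numeral[of "real N" "num.Bit0 (num.Bit0 num.One)"]
        by (simp only: powr_powr[symmetric])
      also have "\<dots> = real N ^ 6" using N1 by simp
      finally show "?g n \<le> real N ^ 6" .
    qed
    also have "\<dots> = card ?S * real N ^ 6" by simp
    also have "\<dots> \<le> 3 * real N ^ k * real N ^ 6"
      using cardl(1)[of ?S] by (intro mult_right_mono) auto
    finally show ?thesis by (simp add: power_add)
  qed
  have big: "(\<Sum>n\<in>?B. ?g n) \<le> real N ^ (k + 6)"
  proof (cases "?B = {}")
    case True
    then show ?thesis unfolding True by simp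
  next
    case False
    have "card {n' \<in> ?B. ?g n \<le> ?g n'} * ?g n \<le> real N ^ (k + 5)" if n: "n \<in> ?B" for n
    proof -
      define H where "H = min (smooth_gap Y n) (real N ^ (k - 1))"
      have H: "real N ^ 4 \<le> H" "H \<le> real N ^ (k - 1)" "H \<le> smooth_gap Y n"
        using n N1 k by (auto simp: H_def intro: power_increasing)
      have H0: "0 < H" using H(1) N1 by (smt (verit) zero_less_power)
      let ?G = "{n \<in> level Y. H \<le> smooth_gap Y n}"
      have cG: "card ?G \<le> real N ^ (k + 5) / H powr (3 / 2)" by (rule card_level_gaps[OF Y H(1,2)])
      have "H = smooth_gap Y n"
      proof (rule ccontr)
        assume "H \<noteq> smooth_gap Y n"
        then have Hk: "H = real N ^ (k - 1)" by (auto simp: H_def min_def split: if_splits)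
        have "n \<in> ?G" using n H by auto
        then have "1 \<le> real (card ?G)" using cardl(2)[of ?G] by (simp add: Suc_le_eq card_gt_0_iff) blast
        then have "1 \<le> real N ^ (k + 5) / H powr (3 / 2)" using cG by linarith
        then have "H powr (3 / 2) \<le> real N ^ (k + 5)" using H0 by simp
        then have "real N powr (3 / 2 * (k - 1)) \<le> real N powr (k + 5)"
          using N1 k by (simp add: Hk powr_realpow[symmetric] powr_powr mult.commute)
        then have "3 / 2 * real (k - 1) \<le> k + 5" using N2 by simp
        then show False using k14 by (simp add: of_nat_diff)
      qed
      then have "card {n' \<in> ?B. ?g n \<le> ?g n'} \<le> card ?G"
        using cardl(2)[of ?G] by (intro card_mono) (auto simp: mono)
      then have "real (card {n' \<in> ?B. ?g n \<le> ?g n'}) \<le> real N ^ (k + 5) / H powr (3 / 2)"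
        using cG by linarith
      then have "card {n' \<in> ?B. ?g n \<le> ?g n'} * H powr (3 / 2) \<le> real N ^ (k + 5)"
        using H0 by (simp add: field_simps)
      then show ?thesis using \<open>H = smooth_gap Y n\<close> by simp
    qed
    then have "(\<Sum>n\<in>?B. ?g n) \<le> real N ^ (k + 5) * (1 + ln (card ?B))"
      using cardl(2)[of ?B] False by (intro sum_le_of_weak_type) auto
    also have "\<dots> \<le> real N ^ (k + 5) * real N"
    proof (rule mult_left_mono)
      have "0 < card ?B" using cardl(2)[of ?B] False by (simp add: card_gt_0_iff)
      then have "ln (card ?B) \<le> ln (4 * real N ^ k)"
        using cardl(1)[of ?B] N1 by (subst ln_le_cancel_iff) (auto intro: order_trans)
      then have "1 + ln (card ?B) \<le> 10000 * (1 + ln (4 * real N ^ k))" using ln_ge by (simp add: algebra_simps)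
      also have "\<dots> \<le> real N powr \<kappa>" by (rule log_le)
      also have "\<dots> \<le> real N powr 1" using \<kappa> by (intro powr_N_mono) auto
      finally show "1 + ln (card ?B) \<le> real N" using N1 by simp
    qed simp
    also have "\<dots> = real N ^ (k + 6)" by (simp add: power_add numeral_eq_Suc)
    finally show ?thesis .
  qed
  have "(\<Sum>n\<in>level Y. ?g n) = (\<Sum>n\<in>?S \<union> ?B. ?g n)" by (rule sum.cong) auto
  also have "\<dots> = (\<Sum>n\<in>?S. ?g n) + (\<Sum>n\<in>?B. ?g n)"
    using fin by (intro sum.union_disjoint) auto
  also have "\<dots> \<le> 4 * real N ^ (k + 6)" using small big by linarith
  finally show "(\<Sum>n\<in>level Y. ?g n) \<le> 4 * real N ^ (k + 6)" .
qed

end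

lemma eventually_large_regular_block:
  assumes k: "k \<ge> 14"
  shows "\<exists>\<kappa>. eventually (\<lambda>N. large_regular_block k N \<kappa>) sequentially"
proof -
  obtain \<kappa> where \<kappa>: "\<kappa> > 0" "\<kappa> \<le> 1 / 12" and ev: "eventually (regular k \<kappa>) sequentially"
    using eventually_regular[of k] k by auto
  have e1: "eventually (\<lambda>N::nat. 4 / mass k \<le> real N powr (17 * \<kappa>)) sequentially"
    using \<kappa> by (intro eventually_powr_ge) auto
  have e2: "eventually (\<lambda>N::nat. 1088 / (mass k)\<^sup>2 * (9216 / mass k) powr (3 / 2) \<le> real N powr (1 / 2)) sequentially"
    by (intro eventually_powr_ge) auto
  have e3: "eventually (\<lambda>N::nat. 9216 / mass k \<le> real N) sequentially"
    using filterlim_real_sequentially by (simp add: filterlim_at_top)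
  have "eventually (\<lambda>N. large_regular_block k N \<kappa>) sequentially"
    using ev e1 e2 e3 eventually_ge_at_top[of "base_degree k"] eventually_ge_at_top[of "8 * k * (k + 1)"]
  proof eventually_elim
    case (elim N)
    then show ?case using k \<kappa> by unfold_locales auto
  qed
  then show ?thesis by blast
qed

theorem theorem2:
  fixes \<epsilon> :: real
  assumes "\<epsilon> > 0"
  shows "\<exists>C>0. \<exists>x0::real. \<forall>x\<ge>x0.
    \<bar>\<Sum>n | real (smooth_seq (x powr \<epsilon>) n) \<le> x.
        (real (smooth_seq (x powr \<epsilon>) (n + 1)) - real (smooth_seq (x powr \<epsilon>) n)) powr (3 / 2)\<bar>
      \<le> C * x powr (1 + \<epsilon>)"
proof -
  \<comment> \<open>The total loss will be the factor \<open>x powr (7 / k)\<close>.\<close>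
  define k where "k = nat \<lceil>7 / \<epsilon>\<rceil> + 14"
  have k: "k \<ge> 14" "k \<ge> 1" by (auto simp: k_def)
  have "7 / \<epsilon> \<le> k" unfolding k_def by linarith
  then have k7: "7 / k \<le> \<epsilon>" using assms k by (simp add: field_simps)
  have "1 / real k < 7 / k" using k by (simp add: divide_strict_right_mono)
  then have k1: "1 / k < \<epsilon>" using k7 by linarith
  obtain \<kappa> N0 where N0: "\<And>N. N \<ge> N0 \<Longrightarrow> large_regular_block k N \<kappa>"
    using eventually_large_regular_block[OF k(1)] unfolding eventually_sequentially by blast
  \<comment> \<open>Below \<open>K\<close>, which does not depend on \<open>x\<close>, the trivial bound \<open>smooth_gap_le\<close> is enough.\<close>
  define K where "K = real N0 ^ k * exp (1 / 2)"
  have K0: "0 \<le> K" by (simp add: K_def)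
  have "eventually (\<lambda>x::real. 2 * x powr (1 / k) \<le> x powr \<epsilon>) at_top"
  proof -
    have "0 < \<epsilon> - 1 / k" using k1 by simp
    then have "eventually (\<lambda>x::real. 2 \<le> x powr (\<epsilon> - 1 / k)) at_top" by real_asymp
    then show ?thesis using eventually_gt_at_top[of 0]
    proof eventually_elim
      case (elim x)
      then have "2 * x powr (1 / k) \<le> x powr (\<epsilon> - 1 / k) * x powr (1 / k)" by (intro mult_right_mono) auto
      then show ?case by (simp add: powr_add[symmetric])
    qed
  qed
  then have "eventually (\<lambda>x::real. 2 * x powr (1 / k) \<le> x powr \<epsilon> \<and> 1 \<le> x) at_top"
    using eventually_ge_at_top[of 1] by eventually_elim simp
  then obtain x0 where x0: "\<And>x. x \<ge> x0 \<Longrightarrow> 2 * x powr (1 / k) \<le> x powr \<epsilon> \<and> 1 \<le> x"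
    unfolding eventually_at_top_linorder by blast
  show ?thesis
  proof (rule exI[of _ "K * K powr (3 / 2) + 8"], rule conjI, goal_cases)
    case 1
    show ?case using K0 by (simp add: add_nonneg_pos)
  next
    case 2
    show ?case
    proof (intro exI[of _ x0] allI impI)
      fix x assume "x0 \<le> x"
      then have x: "2 * x powr (1 / k) \<le> x powr \<epsilon>" "1 \<le> x" using x0 by auto
      define Y where "Y = x powr \<epsilon>"
      have xk1: "1 \<le> x powr (1 / k)" using x by (intro ge_one_powr_ge_zero) auto
      have Y2: "2 \<le> Y" using x xk1 by (simp add: Y_def)
      let ?g = "\<lambda>n. smooth_gap Y n powr (3 / 2)"
      let ?I = "{n. real (smooth_seq Y n) \<le> x}"
      let ?A = "{n \<in> ?I. real (smooth_seq Y n) < K}" and ?B = "{n \<in> ?I. \<not> real (smooth_seq Y n) < K}"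
      have finI: "finite ?I" using x by (intro card_smooth_seq_le(1)[OF Y2, of x]) auto
      define R where "R = nat \<lfloor>x powr (1 / k)\<rfloor>"
      have R: "real R \<le> x powr (1 / k)" unfolding R_def using xk1 by linarith
      have xx: "1 \<le> x powr (1 + \<epsilon>)"
        using x assms by (intro ge_one_powr_ge_zero) auto
      have sA: "(\<Sum>n\<in>?A. ?g n) \<le> K * K powr (3 / 2)"
      proof -
        have "(\<Sum>n\<in>?A. ?g n) \<le> (\<Sum>n\<in>?A. K powr (3 / 2))"
        proof (rule sum_mono)
          fix n assume "n \<in> ?A"
          then show "?g n \<le> K powr (3 / 2)"
            using smooth_gap_le[OF Y2, of n] smooth_gap_pos[OF Y2, of n] by (intro powr_mono2) auto
        qed
        also have "\<dots> = card ?A * K powr (3 / 2)" by simp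
        also have "\<dots> \<le> K * K powr (3 / 2)"
          using K0 by (intro mult_right_mono card_smooth_seq_le(2)[OF Y2]) auto
        finally show ?thesis .
      qed
      have "\<exists>N\<in>{N0..R}. n \<in> large_regular_block.level k N Y" if n: "n \<in> ?B" for n
      proof -
        define a where "a = real (smooth_seq Y n)"
        have a: "K \<le> a" "a \<le> x" using n by (auto simp: a_def)
        let ?P = "\<lambda>N. real N ^ k * exp (1 / 2) \<le> a"
        have PR: "N \<le> R" if "?P N" for N
        proof -
          have "real N ^ k * 1 \<le> real N ^ k * exp (1 / 2)" by (intro mult_left_mono) auto
          then have "real N ^ k \<le> x" using that a by linarith
          then have "(real N ^ k) powr (1 / k) \<le> x powr (1 / k)" by (intro powr_mono2) auto
          moreover have "(real N ^ k) powr (1 / k) = real N"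
            using k by (cases "N = 0") (auto simp: powr_realpow[symmetric] powr_powr)
          ultimately show ?thesis unfolding R_def by (simp add: le_nat_floor)
        qed
        define N where "N = (GREATEST N. ?P N)"
        have P0: "?P N0" using a by (simp add: K_def)
        have PN: "?P N" unfolding N_def using P0 PR by (rule GreatestI_nat)
        have NN: "N0 \<le> N" unfolding N_def using P0 PR by (rule Greatest_le_nat)
        have "\<not> ?P (N + 1)"
        proof
          assume "?P (N + 1)"
          then have "N + 1 \<le> N" unfolding N_def using PR by (rule Greatest_le_nat)
          then show False by simp
        qed
        then have "n \<in> large_regular_block.level k N Y"
          unfolding large_regular_block.level_def[OF N0[OF NN]] using PN by (simp add: a_def not_le)
        then show ?thesis using NN PR[OF PN] by auto
      qed
      then obtain idx where idx: "\<And>n. n \<in> ?B \<Longrightarrow> idx n \<in> {N0..R} \<and> n \<in> large_regular_block.level k (idx n) Y"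
        by metis
      have finB: "finite ?B" using finI by simp
      have "(\<Sum>n\<in>?B. ?g n) = (\<Sum>N\<in>{N0..R}. \<Sum>n | n \<in> ?B \<and> idx n = N. ?g n)"
        using idx finB by (intro sum.group[symmetric]) auto
      also have "\<dots> \<le> (\<Sum>N\<in>{N0..R}. 4 * real R ^ (k + 6))"
      proof (rule sum_mono)
        fix N assume N: "N \<in> {N0..R}"
        interpret large_regular_block k N \<kappa> using N by (intro N0) auto
        have "2 * real N \<le> 2 * x powr (1 / k)" using N R by simp
        then have NY: "2 * real N \<le> Y" using x by (simp add: Y_def)
        have "(\<Sum>n | n \<in> ?B \<and> idx n = N. ?g n) \<le> (\<Sum>n\<in>level Y. ?g n)"
          using idx by (intro sum_mono2 sum_level_gaps(1)[OF NY]) auto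
        also have "\<dots> \<le> 4 * real N ^ (k + 6)" by (rule sum_level_gaps(2)[OF NY])
        also have "\<dots> \<le> 4 * real R ^ (k + 6)" using N by (intro mult_left_mono power_mono) auto
        finally show "(\<Sum>n | n \<in> ?B \<and> idx n = N. ?g n) \<le> 4 * real R ^ (k + 6)" .
      qed
      also have "\<dots> = card {N0..R} * (4 * real R ^ (k + 6))" by simp
      also have "\<dots> \<le> (real R + 1) * (4 * real R ^ (k + 6))" by (intro mult_right_mono) auto
      also have "\<dots> \<le> (2 * x powr (1 / k)) * (4 * (x powr (1 / k)) ^ (k + 6))"
        using R xk1 by (intro mult_mono power_mono) auto
      also have "\<dots> = 8 * (x powr (1 / k)) ^ (k + 7)" by (simp add: power_add numeral_eq_Suc)
      also have "(x powr (1 / k)) ^ (k + 7) = x powr (1 + 7 / k)"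
        using x k by (simp add: powr_power add_divide_distrib)
      also have "8 * x powr (1 + 7 / k) \<le> 8 * x powr (1 + \<epsilon>)"
        using x k7 by (intro mult_left_mono powr_mono) auto
      finally have sB: "(\<Sum>n\<in>?B. ?g n) \<le> 8 * x powr (1 + \<epsilon>)" .
      have "(\<Sum>n\<in>?I. ?g n) = (\<Sum>n\<in>?A \<union> ?B. ?g n)" by (rule sum.cong) auto
      also have "\<dots> = (\<Sum>n\<in>?A. ?g n) + (\<Sum>n\<in>?B. ?g n)" using finI by (intro sum.union_disjoint) auto
      also have "\<dots> \<le> K * K powr (3 / 2) * x powr (1 + \<epsilon>) + 8 * x powr (1 + \<epsilon>)"
      proof (intro add_mono sB order_trans[OF sA])
        have "K * K powr (3 / 2) * 1 \<le> K * K powr (3 / 2) * x powr (1 + \<epsilon>)"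
          using K0 xx by (intro mult_left_mono) auto
        then show "K * K powr (3 / 2) \<le> K * K powr (3 / 2) * x powr (1 + \<epsilon>)" by simp
      qed
      also have "\<dots> = (K * K powr (3 / 2) + 8) * x powr (1 + \<epsilon>)" by (simp add: distrib_right)
      finally have total: "(\<Sum>n\<in>?I. ?g n) \<le> (K * K powr (3 / 2) + 8) * x powr (1 + \<epsilon>)" .
      have "0 \<le> (\<Sum>n\<in>?I. ?g n)" by (intro sum_nonneg) simp
      then show "\<bar>\<Sum>n | real (smooth_seq (x powr \<epsilon>) n) \<le> x.
        (real (smooth_seq (x powr \<epsilon>) (n + 1)) - real (smooth_seq (x powr \<epsilon>) n)) powr (3 / 2)\<bar>
        \<le> (K * K powr (3 / 2) + 8) * x powr (1 + \<epsilon>)"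
        using total unfolding smooth_gap_def Y_def by linarith
    qed
  qed
qed

end
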